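(* The category $\mathcal{SOAT}$ of second-order algebraic theories and algebraic translations is equivalent to the category $\mathcal{SOEP}$ of second-order equational presentations and syntactic translations.
   Context: Signatures and terms. A (unityped second-order) signature $\Sigma=(O,|\cdot|)$ is a set $O$ of operators with an arity function $|\cdot|:O\to\mathbb{N}^*$ (finite sequences of naturals); write $\mathsf{o}:\langle n_1,\dots,n_k\rangle$ when $|\mathsf{o}|=\langle n_1,\dots,n_k\rangle$ ($\mathsf{o}$ takes $k$ arguments, the $i$-th binding $n_i$ variables). A context $\Theta\rhd\Gamma$ consists of a list $\Theta=(\mathsf{m}_1:[m_1],\dots,\mathsf{m}_k:[m_k])$ of distinct metavariables, each with a natural-number arity, and a list $\Gamma$ of distinct variables. Terms $\Theta\rhd\Gamma\vdash t$ are generated by: $x$ for $x\in\Gamma$; $\mathsf{m}[t_1,\dots,t_m]$ for $(\mathsf{m}:[m])\in\Theta$ and terms $\Theta\rhd\Gamma\vdash t_i$; $\mathsf{o}((\vec x_1)t_1,\dots,(\vec x_k)t_k)$ for $\mathsf{o}:\langle n_1,\dots,n_k\rangle$ and terms $\Theta\rhd\Gamma,\vec x_i\vdash t_i$ where $\vec x_i$ is a list of $n_i$ variables, bound in $t_i$; terms are taken up to $\alpha$-equivalence. $t[t_i/x_i]_i$ denotes capture-avoiding simultaneous substitution of terms for variables. Metasubstitution: for $\mathsf{m}_1:[m_1],\dots,\mathsf{m}_k:[m_k]\rhd\Gamma\vdash t$ and $\Theta\rhd\Gamma,\vec x_i\vdash t_i$ ($\vec x_i$ of length $m_i$), the term $\Theta\rhd\Gamma\vdash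 t\{\mathsf{m}_i:=(\vec x_i)t_i\}_{i}$ is defined by $x\mapsto x$; $\mathsf{m}_\ell[s_1,\dots,s_{m_\ell}]\mapsto t_\ell[s'_j/x_{\ell,j}]_{j}$ where $s'_j=s_j\{\mathsf{m}_i:=(\vec x_i)t_i\}_i$; $\mathsf{o}(\dots,(\vec y)s,\dots)\mapsto\mathsf{o}(\dots,(\vec y)s\{\mathsf{m}_i:=(\vec x_i)t_i\}_i,\dots)$. Presentations and logic. A second-order equational presentation $(\Sigma,E)$ is a signature with a set $E$ of axioms, each a pair of terms in the same context, written $\Theta\rhd\Gamma\vdash s\equiv t$. Second-order equational logic derives such judgements by: the axioms of $E$; reflexivity, symmetry and transitivity; and extended metasubstitution: from $\mathsf{m}_1:[m_1],\dots,\mathsf{m}_k:[m_k]\rhd\Gamma\vdash s\equiv t$ and $\Theta\rhd\Delta,\vec x_i\vdash s_i\equiv t_i$ ($1\le i\le k$, $\vec x_i$ of length $m_i$) infer $\Theta\rhd\Gamma,\Delta\vdash s\{\mathsf{m}_i:=(\vec x_i)s_i\}_i\equiv t\{\mathsf{m}_i:=(\vec x_i)t_i\}_i$. The category $\mathbb{M}$. Objects are elements of $\mathbb{N}^*$; a morphism $\langle m_1,\dots,m_k\rangle\to\langle n_1,\dots,n_\ell\rangle$ is a tuple $\langle t_1,\dots,t_\ell\rangle$ with $t_i$ a term over the empty signature in context $\mathsf{m}_1:[m_1],\dots,\mathsf{m}_k:[m_k]\rhd x_1,\dots,x_{n_i}$. The identity on $\langle m_1,\dots,m_k\rangle$ is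 $\langle\mathsf{m}_i[x_1,\dots,x_{m_i}]\rangle_{i}$; the composite of $\langle s_p\rangle_{p\le j}:\langle l_1,\dots,l_i\rangle\to\langle m_1,\dots,m_j\rangle$ and $\langle t_q\rangle_{q\le k}:\langle m_1,\dots,m_j\rangle\to\langle n_1,\dots,n_k\rangle$ is $\langle t_q\{\mathsf{m}_p:=(x_1,\dots,x_{m_p})s_p\}_{p\le j}\rangle_{q\le k}$. $\mathbb{M}$ is strict cartesian (terminal object the empty sequence, products by concatenation), and $\langle 0\rangle$ is exponentiable, with $\langle0\rangle\Rightarrow\langle m_1,\dots,m_k\rangle=\langle m_1+1,\dots,m_k+1\rangle$ and evaluation $\langle m_1+1,\dots,m_k+1,0\rangle\to\langle m_1,\dots,m_k\rangle$ given by $\langle \mathsf{m}_i[x_1,\dots,x_{m_i},\mathsf{m}_{k+1}[\,]]\rangle_{i\le k}$. Theories. A second-order algebraic theory is a cartesian category $\mathbb{T}$ together with a strict cartesian identity-on-objects functor $T:\mathbb{M}\to\mathbb{T}$ that preserves the exponentiable object $\langle0\rangle$. An algebraic translation from $T:\mathbb{M}\to\mathbb{T}$ to $T':\mathbb{M}\to\mathbb{T}'$ is a functor $F:\mathbb{T}\to\mathbb{T}'$ with $T'=F\circ T$; these form the category $\mathcal{SOAT}$. Syntactic translations. A translation $\tau:\Sigma\to\Sigma'$ of signatures assigns to each operator $\mathsf{o}:\langle m_1,\dots,m_k\rangle$ of $\Sigma$ a term $\mathsf{m}_1:[m_1],\dots,\mathsf{m}_k:[m_k]\rhd\cdot\vdash\tau_{\mathsf{o}}$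 over $\Sigma'$; it extends to terms by $\tau(x)=x$, $\tau(\mathsf{m}[t_1,\dots,t_m])=\mathsf{m}[\tau(t_1),\dots,\tau(t_m)]$, $\tau(\mathsf{o}((\vec x_1)t_1,\dots,(\vec x_k)t_k))=\tau_{\mathsf{o}}\{\mathsf{m}_i:=(\vec x_i)\tau(t_i)\}_{i\le k}$. A syntactic translation $(\Sigma,E)\to(\Sigma',E')$ is a translation $\tau:\Sigma\to\Sigma'$ such that for every axiom $\Theta\rhd\Gamma\vdash s\equiv t$ in $E$, the judgement $\Theta\rhd\Gamma\vdash\tau(s)\equiv\tau(t)$ is derivable from $E'$. These form the category $\mathcal{SOEP}$: the identity sends $\mathsf{o}:\langle m_1,\dots,m_k\rangle$ to $\mathsf{o}(\dots,(x_1,\dots,x_{m_i})\mathsf{m}_i[x_1,\dots,x_{m_i}],\dots)$, and the composite of $\tau$ followed by $\tau'$ sends $\mathsf{o}$ to $\tau'(\tau_{\mathsf{o}})$.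
   Formalization: Arrows of SOEP are syntactic translations up to derivable equality of the images of operators (with literal equality SOEP has no terminal object while SOAT has one, so the claim fails); operators and hom-sets are subsets of an arbitrary fixed infinite set. *)

theory Defs
  imports "HOL-Library.FuncSet"
begin

section \<open>Categories, functors and equivalences\<close>

text \<open>Hom-sets are indexed by their endpoints and need not be disjoint, so identities and
  composition take the objects as arguments: \<open>Comp C X Y Z g f\<close> is the composite of
  \<open>f : X \<rightarrow> Y\<close> followed by \<open>g : Y \<rightarrow> Z\<close>.\<close>

record ('o, 'a) category =
  Obj :: "'o set"
  Hom :: "'o \<Rightarrow> 'o \<Rightarrow> 'a set"
  Id :: "'o \<Rightarrow> 'a"
  Comp :: "'o \<Rightarrow> 'o \<Rightarrow> 'o \<Rightarrow> 'a \<Rightarrow> 'a \<Rightarrow> 'a"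

definition is_category :: "('o, 'a) category \<Rightarrow> bool" where
  "is_category C \<longleftrightarrow>
     (\<forall>X\<in>Obj C. Id C X \<in> Hom C X X) \<and>
     (\<forall>X\<in>Obj C. \<forall>Y\<in>Obj C. \<forall>Z\<in>Obj C. \<forall>f\<in>Hom C X Y. \<forall>g\<in>Hom C Y Z.
        Comp C X Y Z g f \<in> Hom C X Z) \<and>
     (\<forall>X\<in>Obj C. \<forall>Y\<in>Obj C. \<forall>f\<in>Hom C X Y.
        Comp C X X Y f (Id C X) = f \<and> Comp C X Y Y (Id C Y) f = f) \<and>
     (\<forall>W\<in>Obj C. \<forall>X\<in>Obj C. \<forall>Y\<in>Obj C. \<forall>Z\<in>Obj C.
        \<forall>f\<in>Hom C W X. \<forall>g\<in>Hom C X Y. \<forall>h\<in>Hom C Y Z.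
        Comp C W Y Z h (Comp C W X Y g f) = Comp C W X Z (Comp C X Y Z h g) f)"

text \<open>Functors are in extensional form (\<open>undefined\<close> outside the objects and arrows of
  the source), so that equality of functors is equality in HOL.\<close>

record ('o, 'a, 'p, 'b) cat_functor =
  fobj :: "'o \<Rightarrow> 'p"
  farr :: "'o \<Rightarrow> 'o \<Rightarrow> 'a \<Rightarrow> 'b"

definition is_functor ::
  "('o, 'a) category \<Rightarrow> ('p, 'b) category \<Rightarrow> ('o, 'a, 'p, 'b) cat_functor \<Rightarrow> bool" where
  "is_functor C D F \<longleftrightarrow>
     is_category C \<and> is_category D \<and>
     fobj F \<in> Obj C \<rightarrow>\<^sub>E Obj D \<and>
     (\<forall>X\<in>Obj C. \<forall>Y\<in>Obj C. farr F X Y \<in> Hom C X Y \<rightarrow>\<^sub>E Hom D (fobj F X) (fobj F Y)) \<and>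
     (\<forall>X Y. \<not> (X \<in> Obj C \<and> Y \<in> Obj C) \<longrightarrow> farr F X Y = undefined) \<and>
     (\<forall>X\<in>Obj C. farr F X X (Id C X) = Id D (fobj F X)) \<and>
     (\<forall>X\<in>Obj C. \<forall>Y\<in>Obj C. \<forall>Z\<in>Obj C. \<forall>f\<in>Hom C X Y. \<forall>g\<in>Hom C Y Z.
        farr F X Z (Comp C X Y Z g f)
          = Comp D (fobj F X) (fobj F Y) (fobj F Z) (farr F Y Z g) (farr F X Y f))"

definition id_functor :: "('o, 'a) category \<Rightarrow> ('o, 'a, 'o, 'a) cat_functor" where
  "id_functor C =
     \<lparr>fobj = (\<lambda>X\<in>Obj C. X),
      farr = (\<lambda>X Y. if X \<in> Obj C \<and> Y \<in> Obj C then \<lambda>f\<in>Hom C X Y. f else undefined)\<rparr>"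

definition comp_functor ::
  "('o, 'a) category \<Rightarrow> ('p, 'b, 'q, 'c) cat_functor \<Rightarrow> ('o, 'a, 'p, 'b) cat_functor
     \<Rightarrow> ('o, 'a, 'q, 'c) cat_functor" where
  "comp_functor C G F =
     \<lparr>fobj = compose (Obj C) (fobj G) (fobj F),
      farr = (\<lambda>X Y. if X \<in> Obj C \<and> Y \<in> Obj C
                    then compose (Hom C X Y) (farr G (fobj F X) (fobj F Y)) (farr F X Y)
                    else undefined)\<rparr>"

definition is_iso :: "('o, 'a) category \<Rightarrow> 'o \<Rightarrow> 'o \<Rightarrow> 'a \<Rightarrow> bool" where
  "is_iso C X Y f \<longleftrightarrow> f \<in> Hom C X Y \<and>
     (\<exists>g\<in>Hom C Y X. Comp C X Y X g f = Id C X \<and> Comp C Y X Y f g = Id C Y)"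

definition is_natural_iso ::
  "('o, 'a) category \<Rightarrow> ('p, 'b) category \<Rightarrow> ('o, 'a, 'p, 'b) cat_functor
     \<Rightarrow> ('o, 'a, 'p, 'b) cat_functor \<Rightarrow> ('o \<Rightarrow> 'b) \<Rightarrow> bool" where
  "is_natural_iso C D F G \<eta> \<longleftrightarrow>
     is_functor C D F \<and> is_functor C D G \<and>
     (\<forall>X\<in>Obj C. is_iso D (fobj F X) (fobj G X) (\<eta> X)) \<and>
     (\<forall>X\<in>Obj C. \<forall>Y\<in>Obj C. \<forall>f\<in>Hom C X Y.
        Comp D (fobj F X) (fobj F Y) (fobj G Y) (\<eta> Y) (farr F X Y f)
          = Comp D (fobj F X) (fobj G X) (fobj G Y) (farr G X Y f) (\<eta> X))"

definition equivalent_categories :: "('o, 'a) category \<Rightarrow> ('p, 'b) category \<Rightarrow> bool" where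
  "equivalent_categories C D \<longleftrightarrow>
     (\<exists>F G \<eta> \<epsilon>. is_functor C D F \<and> is_functor D C G \<and>
        is_natural_iso C C (id_functor C) (comp_functor C G F) \<eta> \<and>
        is_natural_iso D D (comp_functor D F G) (id_functor D) \<epsilon>)"


section \<open>Cartesian structure and exponentials\<close>

record ('o, 'a) cartesian =
  terminal :: "'o"
  prodobj :: "'o \<Rightarrow> 'o \<Rightarrow> 'o"
  proj1 :: "'o \<Rightarrow> 'o \<Rightarrow> 'a"
  proj2 :: "'o \<Rightarrow> 'o \<Rightarrow> 'a"

definition is_cartesian :: "('o, 'a) category \<Rightarrow> ('o, 'a) cartesian \<Rightarrow> bool" where
  "is_cartesian C K \<longleftrightarrow>
     is_category C \<and>
     terminal K \<in> Obj C \<and>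
     (\<forall>X\<in>Obj C. \<exists>!f. f \<in> Hom C X (terminal K)) \<and>
     (\<forall>X\<in>Obj C. \<forall>Y\<in>Obj C.
        prodobj K X Y \<in> Obj C \<and>
        proj1 K X Y \<in> Hom C (prodobj K X Y) X \<and>
        proj2 K X Y \<in> Hom C (prodobj K X Y) Y \<and>
        (\<forall>Z\<in>Obj C. \<forall>f\<in>Hom C Z X. \<forall>g\<in>Hom C Z Y.
           \<exists>!h. h \<in> Hom C Z (prodobj K X Y) \<and>
                Comp C Z (prodobj K X Y) X (proj1 K X Y) h = f \<and>
                Comp C Z (prodobj K X Y) Y (proj2 K X Y) h = g))"

definition is_strict_cartesian_functor ::
  "('o, 'a) category \<Rightarrow> ('o, 'a) cartesian \<Rightarrow> ('p, 'b) category \<Rightarrow> ('p, 'b) cartesian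
     \<Rightarrow> ('o, 'a, 'p, 'b) cat_functor \<Rightarrow> bool" where
  "is_strict_cartesian_functor C K D L F \<longleftrightarrow>
     is_cartesian C K \<and> is_cartesian D L \<and> is_functor C D F \<and>
     fobj F (terminal K) = terminal L \<and>
     (\<forall>X\<in>Obj C. \<forall>Y\<in>Obj C.
        fobj F (prodobj K X Y) = prodobj L (fobj F X) (fobj F Y) \<and>
        farr F (prodobj K X Y) X (proj1 K X Y) = proj1 L (fobj F X) (fobj F Y) \<and>
        farr F (prodobj K X Y) Y (proj2 K X Y) = proj2 L (fobj F X) (fobj F Y))"

text \<open>\<open>prod_left C K B E X g\<close> is the arrow \<open>g \<times> X : B \<times> X \<rightarrow> E \<times> X\<close> for \<open>g : B \<rightarrow> E\<close>.\<close>

definition prod_left ::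
  "('o, 'a) category \<Rightarrow> ('o, 'a) cartesian \<Rightarrow> 'o \<Rightarrow> 'o \<Rightarrow> 'o \<Rightarrow> 'a \<Rightarrow> 'a" where
  "prod_left C K B E X g =
     (THE h. h \<in> Hom C (prodobj K B X) (prodobj K E X) \<and>
        Comp C (prodobj K B X) (prodobj K E X) E (proj1 K E X) h
          = Comp C (prodobj K B X) B E g (proj1 K B X) \<and>
        Comp C (prodobj K B X) (prodobj K E X) X (proj2 K E X) h = proj2 K B X)"

text \<open>\<open>is_exponential C K X A E ev\<close>: the object \<open>E\<close> with evaluation \<open>ev : E \<times> X \<rightarrow> A\<close> is an
  exponential \<open>X \<Rightarrow> A\<close>.\<close>

definition is_exponential ::
  "('o, 'a) category \<Rightarrow> ('o, 'a) cartesian \<Rightarrow> 'o \<Rightarrow> 'o \<Rightarrow> 'o \<Rightarrow> 'a \<Rightarrow> bool" where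
  "is_exponential C K X A E ev \<longleftrightarrow>
     E \<in> Obj C \<and> ev \<in> Hom C (prodobj K E X) A \<and>
     (\<forall>B\<in>Obj C. \<forall>f\<in>Hom C (prodobj K B X) A.
        \<exists>!g. g \<in> Hom C B E \<and>
             Comp C (prodobj K B X) (prodobj K E X) A ev (prod_left C K B E X g) = f)"


section \<open>Second-order signatures and terms\<close>

record 'o signature =
  ops :: "'o set"
  arity :: "'o \<Rightarrow> nat list"

text \<open>Terms up to \<open>\<alpha>\<close>-equivalence, in de Bruijn form. A context \<open>\<Theta> \<rhd> \<Gamma>\<close> is
  given by the list of arities of its metavariables and by the length of \<open>\<Gamma>\<close>;
  \<open>Meta k\<close> is the metavariable in position \<open>k\<close> of \<open>\<Theta>\<close>, counting from \<open>0\<close>, and \<open>Var i\<close> the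
  variable in position \<open>i\<close> of \<open>\<Gamma>\<close>.
  An abstraction \<open>(x\<^sub>1, \<dots>, x\<^sub>n) t\<close> is the pair \<open>(n, t)\<close>, in which \<open>Var 0, \<dots>, Var (n - 1)\<close> are
  the bound variables \<open>x\<^sub>1, \<dots>, x\<^sub>n\<close> and \<open>Var (n + i)\<close> is \<open>Var i\<close> of the surrounding context.\<close>

datatype 'o tm =
    Var nat
  | Meta nat "'o tm list"
  | Op 'o "(nat \<times> 'o tm) list"

fun wf_tm :: "'o signature \<Rightarrow> nat list \<Rightarrow> nat \<Rightarrow> 'o tm \<Rightarrow> bool" where
  "wf_tm S \<Theta> n (Var i) \<longleftrightarrow> i < n"
| "wf_tm S \<Theta> n (Meta k ts) \<longleftrightarrow>
     k < length \<Theta> \<and> length ts = \<Theta> ! k \<and> (\<forall>t\<in>set ts. wf_tm S \<Theta> n t)"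
| "wf_tm S \<Theta> n (Op f bs) \<longleftrightarrow>
     f \<in> ops S \<and> map fst bs = arity S f \<and> (\<forall>(m, t)\<in>set bs. wf_tm S \<Theta> (n + m) t)"

text \<open>A renaming and a substitution passing under a binder of \<open>n\<close> variables:\<close>

definition up_ren :: "nat \<Rightarrow> (nat \<Rightarrow> nat) \<Rightarrow> nat \<Rightarrow> nat" where
  "up_ren n r i = (if i < n then i else n + r (i - n))"

fun rename :: "(nat \<Rightarrow> nat) \<Rightarrow> 'o tm \<Rightarrow> 'o tm" where
  "rename r (Var i) = Var (r i)"
| "rename r (Meta k ts) = Meta k (map (rename r) ts)"
| "rename r (Op f bs) = Op f (map (\<lambda>(m, t). (m, rename (up_ren m r) t)) bs)"

definition up_subst :: "nat \<Rightarrow> (nat \<Rightarrow> 'o tm) \<Rightarrow> nat \<Rightarrow> 'o tm" where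
  "up_subst n \<sigma> i = (if i < n then Var i else rename (\<lambda>j. n + j) (\<sigma> (i - n)))"

fun subst :: "(nat \<Rightarrow> 'o tm) \<Rightarrow> 'o tm \<Rightarrow> 'o tm" where
  "subst \<sigma> (Var i) = \<sigma> i"
| "subst \<sigma> (Meta k ts) = Meta k (map (subst \<sigma>) ts)"
| "subst \<sigma> (Op f bs) = Op f (map (\<lambda>(m, t). (m, subst (up_subst m \<sigma>) t)) bs)"

text \<open>\<open>subst (inst ss) t\<close> is \<open>t[s\<^sub>j/x\<^sub>j]\<^sub>j\<close> for an abstraction \<open>(x\<^sub>1, \<dots>, x\<^sub>m) t\<close> and \<open>ss\<close> of
  length \<open>m\<close>.\<close>

definition inst :: "'o tm list \<Rightarrow> nat \<Rightarrow> 'o tm" where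
  "inst ss i = (if i < length ss then ss ! i else Var (i - length ss))"

text \<open>Weakening of an abstraction: \<open>n\<close> variables are added to the front of the surrounding
  context, the bound variables are left alone.\<close>

definition weaken_abs :: "nat \<Rightarrow> nat \<times> 'o tm \<Rightarrow> nat \<times> 'o tm" where
  "weaken_abs n = (\<lambda>(m, t). (m, rename (up_ren m (\<lambda>j. n + j)) t))"

text \<open>\<open>msubst th t\<close> is \<open>t{m\<^sub>i := (x\<^sub>i) t\<^sub>i}\<^sub>i\<close>, where \<open>th\<close> is the list of the abstractions
  \<open>(x\<^sub>i) t\<^sub>i\<close>.\<close>

fun msubst :: "(nat \<times> 'o tm) list \<Rightarrow> 'o tm \<Rightarrow> 'o tm" where
  "msubst th (Var i) = Var i"
| "msubst th (Meta k ss) = subst (inst (map (msubst th) ss)) (snd (th ! k))"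
| "msubst th (Op f bs) = Op f (map (\<lambda>(m, t). (m, msubst (map (weaken_abs m) th) t)) bs)"

text \<open>The term \<open>m[x\<^sub>1, \<dots>, x\<^sub>n]\<close> for the metavariable in position \<open>k\<close>:\<close>

definition meta_vars :: "nat \<Rightarrow> nat \<Rightarrow> 'o tm" where
  "meta_vars k n = Meta k (map Var [0..<n])"


section \<open>Second-order equational presentations\<close>

text \<open>The axiom \<open>\<Theta> \<rhd> \<Gamma> \<turnstile> s \<equiv> t\<close> is the tuple \<open>(\<Theta>, n, s, t)\<close> with \<open>n\<close> the length of \<open>\<Gamma>\<close>.\<close>

record 'o presentation =
  sig :: "'o signature"
  axs :: "(nat list \<times> nat \<times> 'o tm \<times> 'o tm) set"

definition is_presentation :: "'o presentation \<Rightarrow> bool" where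
  "is_presentation P \<longleftrightarrow>
     (\<forall>(\<Theta>, n, s, t)\<in>axs P. wf_tm (sig P) \<Theta> n s \<and> wf_tm (sig P) \<Theta> n t)"

text \<open>In the rule \<open>ext_msubst\<close>, \<open>g\<close> and \<open>d\<close> are the lengths of \<open>\<Gamma>\<close> and \<open>\<Delta>\<close>. In the context
  \<open>\<Gamma>, \<Delta>\<close> the variables of \<open>\<Gamma>\<close> come first, so \<open>s\<close> and \<open>t\<close> are unchanged by the weakening from
  \<open>\<Gamma>\<close>, while the abstractions \<open>(x\<^sub>i) s\<^sub>i\<close> and \<open>(x\<^sub>i) t\<^sub>i\<close> over \<open>\<Delta>\<close> are weakened by \<open>g\<close> variables.\<close>

inductive derivable :: "'o presentation \<Rightarrow> nat list \<Rightarrow> nat \<Rightarrow> 'o tm \<Rightarrow> 'o tm \<Rightarrow> bool"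
  for P :: "'o presentation" where
  ax: "(\<Theta>, n, s, t) \<in> axs P \<Longrightarrow> derivable P \<Theta> n s t"
| refl: "wf_tm (sig P) \<Theta> n t \<Longrightarrow> derivable P \<Theta> n t t"
| sym: "derivable P \<Theta> n s t \<Longrightarrow> derivable P \<Theta> n t s"
| trans: "derivable P \<Theta> n s t \<Longrightarrow> derivable P \<Theta> n t u \<Longrightarrow> derivable P \<Theta> n s u"
| ext_msubst:
    "derivable P ms g s t \<Longrightarrow>
     length ss = length ms \<Longrightarrow> length ts = length ms \<Longrightarrow>
     (\<forall>i<length ms. derivable P \<Theta> (ms ! i + d) (ss ! i) (ts ! i)) \<Longrightarrow>
     derivable P \<Theta> (g + d)
       (msubst (map (weaken_abs g) (zip ms ss)) s)
       (msubst (map (weaken_abs g) (zip ms ts)) t)"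


section \<open>The category of second-order equational presentations\<close>

definition is_sig_translation :: "'o signature \<Rightarrow> 'p signature \<Rightarrow> ('o \<Rightarrow> 'p tm) \<Rightarrow> bool" where
  "is_sig_translation S S' \<tau> \<longleftrightarrow> (\<forall>f\<in>ops S. wf_tm S' (arity S f) 0 (\<tau> f))"

fun translate :: "('o \<Rightarrow> 'p tm) \<Rightarrow> 'o tm \<Rightarrow> 'p tm" where
  "translate \<tau> (Var i) = Var i"
| "translate \<tau> (Meta k ts) = Meta k (map (translate \<tau>) ts)"
| "translate \<tau> (Op f bs) = msubst (map (\<lambda>(m, t). (m, translate \<tau> t)) bs) (\<tau> f)"

definition syntactic_translations ::
  "'o presentation \<Rightarrow> 'p presentation \<Rightarrow> ('o \<Rightarrow> 'p tm) set" where
  "syntactic_translations P Q =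
     {\<tau>. is_sig_translation (sig P) (sig Q) \<tau> \<and>
         (\<forall>(\<Theta>, n, s, t)\<in>axs P. derivable Q \<Theta> n (translate \<tau> s) (translate \<tau> t))}"

definition id_translation :: "'o signature \<Rightarrow> 'o \<Rightarrow> 'o tm" where
  "id_translation S f =
     Op f (map (\<lambda>i. (arity S f ! i, meta_vars i (arity S f ! i))) [0..<length (arity S f)])"

definition comp_translation :: "('p \<Rightarrow> 'q tm) \<Rightarrow> ('o \<Rightarrow> 'p tm) \<Rightarrow> 'o \<Rightarrow> 'q tm" where
  "comp_translation \<tau>' \<tau> f = translate \<tau>' (\<tau> f)"

text \<open>As terms over a presentation are compared up to derivable equality, two syntactic
  translations \<open>P \<rightarrow> Q\<close> are the same arrow iff they send each operator to terms that are
  derivably equal in \<open>Q\<close>. With comparison up to literal equality of terms the category would have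
  no terminal object: from \<open>o : \<langle>0, 0\<rangle>\<close> without axioms there are always the two distinct
  translations \<open>m\<^sub>1[]\<close> and \<open>m\<^sub>2[]\<close>. The category of theories does have one.\<close>

definition translation_eq ::
  "'o presentation \<Rightarrow> 'p presentation \<Rightarrow> (('o \<Rightarrow> 'p tm) \<times> ('o \<Rightarrow> 'p tm)) set" where
  "translation_eq P Q =
     {(\<tau>, \<tau>'). \<tau> \<in> syntactic_translations P Q \<and> \<tau>' \<in> syntactic_translations P Q \<and>
        (\<forall>f\<in>ops (sig P). derivable Q (arity (sig P) f) 0 (\<tau> f) (\<tau>' f))}"

definition SOEP :: "('o presentation, ('o \<Rightarrow> 'o tm) set) category" where
  "SOEP =
     \<lparr>Obj = {P. is_presentation P},
      Hom = (\<lambda>P Q. syntactic_translations P Q // translation_eq P Q),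
      Id = (\<lambda>P. translation_eq P P `` {id_translation (sig P)}),
      Comp = (\<lambda>P Q R Y X.
        \<Union>\<tau>\<in>X. \<Union>\<tau>'\<in>Y. translation_eq P R `` {comp_translation \<tau>' \<tau>})\<rparr>"


section \<open>The category \<open>\<M>\<close>\<close>

text \<open>The type of operators is arbitrary here, as the signature is empty.\<close>

definition empty_signature :: "'o signature" where
  "empty_signature = \<lparr>ops = {}, arity = (\<lambda>_. [])\<rparr>"

definition M_cat :: "(nat list, 'o tm list) category" where
  "M_cat =
     \<lparr>Obj = UNIV,
      Hom = (\<lambda>ms ns. {ts. length ts = length ns \<and>
               (\<forall>i<length ns. wf_tm empty_signature ms (ns ! i) (ts ! i))}),
      Id = (\<lambda>ms. map (\<lambda>i. meta_vars i (ms ! i)) [0..<length ms]),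
      Comp = (\<lambda>ls ms ns ts ss. map (msubst (zip ms ss)) ts)\<rparr>"

definition M_cart :: "(nat list, 'o tm list) cartesian" where
  "M_cart =
     \<lparr>terminal = [],
      prodobj = (\<lambda>ms ns. ms @ ns),
      proj1 = (\<lambda>ms ns. map (\<lambda>i. meta_vars i (ms ! i)) [0..<length ms]),
      proj2 = (\<lambda>ms ns. map (\<lambda>j. meta_vars (length ms + j) (ns ! j)) [0..<length ns])\<rparr>"

text \<open>The exponential \<open>\<langle>0\<rangle> \<Rightarrow> ms\<close> and its evaluation:\<close>

definition M_exp :: "nat list \<Rightarrow> nat list" where
  "M_exp ms = map Suc ms"

definition M_ev :: "nat list \<Rightarrow> 'o tm list" where
  "M_ev ms =
     map (\<lambda>i. Meta i (map Var [0..<ms ! i] @ [Meta (length ms) []])) [0..<length ms]"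


section \<open>The category of second-order algebraic theories\<close>

record 'a so_theory =
  tcat :: "(nat list, 'a) category"
  tcart :: "(nat list, 'a) cartesian"
  tfun :: "(nat list, 'a tm list, nat list, 'a) cat_functor"

text \<open>The last condition says that \<open>tfun T\<close> sends the exponential \<open>\<langle>0\<rangle> \<Rightarrow> ms\<close> of \<open>\<M>\<close> to an
  exponential in \<open>tcat T\<close>.\<close>

definition is_so_theory :: "'a so_theory \<Rightarrow> bool" where
  "is_so_theory T \<longleftrightarrow>
     Obj (tcat T) = UNIV \<and> fobj (tfun T) = (\<lambda>ms. ms) \<and>
     is_strict_cartesian_functor M_cat M_cart (tcat T) (tcart T) (tfun T) \<and>
     (\<forall>ms. is_exponential (tcat T) (tcart T) (fobj (tfun T) [0]) (fobj (tfun T) ms)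
              (fobj (tfun T) (M_exp ms)) (farr (tfun T) (M_exp ms @ [0]) ms (M_ev ms)))"

definition algebraic_translations ::
  "'a so_theory \<Rightarrow> 'a so_theory \<Rightarrow> (nat list, 'a, nat list, 'a) cat_functor set" where
  "algebraic_translations T T' =
     {F. is_functor (tcat T) (tcat T') F \<and> tfun T' = comp_functor M_cat F (tfun T)}"

definition SOAT :: "('a so_theory, (nat list, 'a, nat list, 'a) cat_functor) category" where
  "SOAT =
     \<lparr>Obj = {T. is_so_theory T},
      Hom = algebraic_translations,
      Id = (\<lambda>T. id_functor (tcat T)),
      Comp = (\<lambda>T T' T'' G F. comp_functor (tcat T) G F)\<rparr>"

end

theory Submission
  imports Defs
begin

text \<open>Every presentation has a theory whose arrows are tuples of terms up to derivable equality, and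
  this assignment is a functor from presentations to theories. It is fully faithful and essentially
  surjective, which gives the equivalence.

  Both properties rest on an interpretation of terms in an arbitrary theory: at a stage \<open>Z\<close>, the
  variables and metavariables stand for generalised elements \<open>Z \<rightarrow> [0]\<close> and \<open>Z \<rightarrow> [m]\<close>, and a binder of
  \<open>m\<close> variables passes to the stage \<open>Z \<times> [0]\<^sup>m\<close> and applies the transpose. This interpretation is sound,
  it is preserved by algebraic translations, and it is the only assignment of arrows to terms that is
  compatible with metasubstitution and agrees with the given arrows on the operators. Hence a
  translation out of the theory of a presentation is determined by the images of the operators,
  which is fullness. For essential surjectivity, present a theory by one operator for each arrow into
  \<open>[0]\<close> and by all equations that hold in the interpretation; since \<open>[n]\<close> is an exponential of \<open>[0]\<close>,
  every arrow is then the interpretation of a term.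

  The type of operators is infinite, so it can encode both tuples of terms and pairs of an arity and an
  arrow.\<close>

section \<open>Equivalences of categories\<close>

text \<open>The arrows of a theory are elements of the type of operators, not sets of terms. A class
  of term tuples must therefore be a single element, so a representative is chosen in each class and
  coded.

  A binder changes the codomain \<open>[n]\<close> of the arrow that a term denotes, which makes a
  direct induction on terms in context awkward. Valuing every term in \<open>[0]\<close> at a
  varying stage removes this: weakening, substitution and metasubstitution all become
  precomposition, one naturality law (\<open>sem_cmp\<close>) carries the inductions, and the
  variables are abstracted only at the end (\<open>interp\<close>).

  Algebraic translations commute with the functor from \<M> strictly, so the comparisons needed are
  equalities of arrows. Uniqueness of the interpretation supplies them: on terms without operators
  it is that functor (\<open>interp_M\<close>), and in the theory of a presentation it is the class
  of the translated term (\<open>interp_translate\<close>). Translations are merely functors under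
  \<M>; they preserve tuples and transposes because projections and evaluation come from
  \<M>.\<close>

lemma cat_id: "is_category C \<Longrightarrow> X \<in> Obj C \<Longrightarrow> Id C X \<in> Hom C X X"
  by (simp add: is_category_def)

lemma cat_comp:
  "is_category C \<Longrightarrow> X \<in> Obj C \<Longrightarrow> Y \<in> Obj C \<Longrightarrow> Z \<in> Obj C \<Longrightarrow> f \<in> Hom C X Y \<Longrightarrow> g \<in> Hom C Y Z
   \<Longrightarrow> Comp C X Y Z g f \<in> Hom C X Z"
  by (simp add: is_category_def)

lemma cat_id_right:
  "is_category C \<Longrightarrow> X \<in> Obj C \<Longrightarrow> Y \<in> Obj C \<Longrightarrow> f \<in> Hom C X Y \<Longrightarrow> Comp C X X Y f (Id C X) = f"
  by (simp add: is_category_def)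

lemma cat_id_left:
  "is_category C \<Longrightarrow> X \<in> Obj C \<Longrightarrow> Y \<in> Obj C \<Longrightarrow> f \<in> Hom C X Y \<Longrightarrow> Comp C X Y Y (Id C Y) f = f"
  by (simp add: is_category_def)

lemma cat_assoc:
  assumes "is_category C" "W \<in> Obj C" "X \<in> Obj C" "Y \<in> Obj C" "Z \<in> Obj C"
    "f \<in> Hom C W X" "g \<in> Hom C X Y" "h \<in> Hom C Y Z"
  shows "Comp C W Y Z h (Comp C W X Y g f) = Comp C W X Z (Comp C X Y Z h g) f"
  using assms unfolding is_category_def by blast

lemma fun_cats: "is_functor C D F \<Longrightarrow> is_category C \<and> is_category D"
  by (simp add: is_functor_def)

lemma fun_obj: "is_functor C D F \<Longrightarrow> X \<in> Obj C \<Longrightarrow> fobj F X \<in> Obj D"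
  by (auto simp: is_functor_def)

lemma fun_arr:
  "is_functor C D F \<Longrightarrow> X \<in> Obj C \<Longrightarrow> Y \<in> Obj C \<Longrightarrow> f \<in> Hom C X Y
   \<Longrightarrow> farr F X Y f \<in> Hom D (fobj F X) (fobj F Y)"
  by (auto simp: is_functor_def PiE_iff)

lemma fun_id: "is_functor C D F \<Longrightarrow> X \<in> Obj C \<Longrightarrow> farr F X X (Id C X) = Id D (fobj F X)"
  by (auto simp: is_functor_def)

lemma fun_comp:
  assumes "is_functor C D F" "X \<in> Obj C" "Y \<in> Obj C" "Z \<in> Obj C" "f \<in> Hom C X Y" "g \<in> Hom C Y Z"
  shows "farr F X Z (Comp C X Y Z g f)
     = Comp D (fobj F X) (fobj F Y) (fobj F Z) (farr F Y Z g) (farr F X Y f)"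
  using assms unfolding is_functor_def by blast

lemma is_functor_id: "is_category C \<Longrightarrow> is_functor C C (id_functor C)"
  by (auto simp: is_functor_def id_functor_def cat_id cat_comp)

lemma is_functor_comp:
  assumes F: "is_functor C D F" and G: "is_functor D E G"
  shows "is_functor C E (comp_functor C G F)"
proof -
  let ?H = "comp_functor C G F"
  have o: "fobj ?H X = fobj G (fobj F X)" if "X \<in> Obj C" for X
    using that by (simp add: comp_functor_def compose_def)
  have a: "farr ?H X Y f = farr G (fobj F X) (fobj F Y) (farr F X Y f)"
    if "X \<in> Obj C" "Y \<in> Obj C" "f \<in> Hom C X Y" for X Y f
    using that by (simp add: comp_functor_def compose_def)
  have C: "is_category C" and E: "is_category E" using fun_cats[OF F] fun_cats[OF G] by auto
  note Fo = fun_obj[OF F] and Go = fun_obj[OF G]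
  show ?thesis
    unfolding is_functor_def
  proof (intro conjI ballI allI impI C E)
    show "fobj ?H \<in> Obj C \<rightarrow>\<^sub>E Obj E"
      using Go[OF Fo] by (auto simp: comp_functor_def compose_def)
    show "farr ?H X Y \<in> Hom C X Y \<rightarrow>\<^sub>E Hom E (fobj ?H X) (fobj ?H Y)"
      if "X \<in> Obj C" "Y \<in> Obj C" for X Y
      unfolding o[OF that(1)] o[OF that(2)] using that fun_arr[OF G Fo Fo fun_arr[OF F]]
      by (auto simp: comp_functor_def compose_def)
    show "farr ?H X Y = undefined" if "\<not> (X \<in> Obj C \<and> Y \<in> Obj C)" for X Y
      using that by (auto simp: comp_functor_def)
    show "farr ?H X X (Id C X) = Id E (fobj ?H X)" if X: "X \<in> Obj C" for X
      using a[OF X X cat_id[OF C X]] o[OF X] fun_id[OF F X] fun_id[OF G Fo[OF X]] by simp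
    fix X Y Z f g assume X: "X \<in> Obj C" and Y: "Y \<in> Obj C" and Z: "Z \<in> Obj C"
      and f: "f \<in> Hom C X Y" and g: "g \<in> Hom C Y Z"
    show "farr ?H X Z (Comp C X Y Z g f)
        = Comp E (fobj ?H X) (fobj ?H Y) (fobj ?H Z) (farr ?H Y Z g) (farr ?H X Y f)"
      unfolding a[OF X Z cat_comp[OF C X Y Z f g]] a[OF X Y f] a[OF Y Z g] o[OF X] o[OF Y] o[OF Z]
        fun_comp[OF F X Y Z f g]
      by (rule fun_comp[OF G Fo[OF X] Fo[OF Y] Fo[OF Z] fun_arr[OF F X Y f] fun_arr[OF F Y Z g]])
  qed
qed

text \<open>The laws of the category of theories are equalities of functors and reduce to this
  lemma.\<close>

lemma functor_eqI:
  fixes F F' :: "('o, 'a, 'p, 'b) cat_functor"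
  assumes "is_functor C D F" "is_functor C D F'"
    and "\<And>X. X \<in> Obj C \<Longrightarrow> fobj F X = fobj F' X"
    and "\<And>X Y f. X \<in> Obj C \<Longrightarrow> Y \<in> Obj C \<Longrightarrow> f \<in> Hom C X Y \<Longrightarrow> farr F X Y f = farr F' X Y f"
  shows "F = F'"
proof -
  have "fobj F \<in> Obj C \<rightarrow>\<^sub>E Obj D" "fobj F' \<in> Obj C \<rightarrow>\<^sub>E Obj D"
    using assms(1,2) by (simp_all add: is_functor_def)
  then have 1: "fobj F = fobj F'" using assms(3) by (rule PiE_ext)
  have "farr F X Y = farr F' X Y" for X Y
  proof (cases "X \<in> Obj C \<and> Y \<in> Obj C")
    case True
    then have "farr F X Y \<in> Hom C X Y \<rightarrow>\<^sub>E Hom D (fobj F X) (fobj F Y)"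
      "farr F' X Y \<in> Hom C X Y \<rightarrow>\<^sub>E Hom D (fobj F' X) (fobj F' Y)"
      using assms(1,2) by (simp_all add: is_functor_def)
    then show ?thesis using assms(4) True 1 by (intro PiE_ext[of "farr F X Y" _ _ "farr F' X Y"]) auto
  next
    case False
    then show ?thesis using assms unfolding is_functor_def by metis
  qed
  then have "farr F = farr F'" by blast
  with 1 show ?thesis by simp
qed

text \<open>Choose \<open>p T\<close> and an isomorphism \<open>h T\<close> from
  \<open>G (p T)\<close> to \<open>T\<close> with inverse \<open>k T\<close>. The quasi-inverse
  sends \<open>f\<close> to the unique arrow whose \<open>G\<close>-image is the conjugate of
  \<open>f\<close> by \<open>h\<close> and \<open>k\<close>. The unit is \<open>k\<close>; the
  counit at \<open>P\<close> is the unique arrow that \<open>G\<close> sends to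
  \<open>h (G P)\<close>.\<close>

lemma equivalent_categoriesI:
  assumes G: "is_functor D C G"
    and ff: "\<And>X Y. X \<in> Obj D \<Longrightarrow> Y \<in> Obj D
               \<Longrightarrow> bij_betw (farr G X Y) (Hom D X Y) (Hom C (fobj G X) (fobj G Y))"
    and ess: "\<And>T. T \<in> Obj C \<Longrightarrow> \<exists>P\<in>Obj D. \<exists>h. is_iso C (fobj G P) T h"
  shows "equivalent_categories C D"
proof -
  have C: "is_category C" and D: "is_category D" using fun_cats[OF G] by auto
  obtain p where p0: "\<And>T. T \<in> Obj C \<Longrightarrow> p T \<in> Obj D \<and> (\<exists>h. is_iso C (fobj G (p T)) T h)"
    using ess by metis
  then obtain h where h0: "\<And>T. T \<in> Obj C \<Longrightarrow> is_iso C (fobj G (p T)) T (h T)" by metis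
  define g where "g T = fobj G (p T)" for T
  have p: "\<And>T. T \<in> Obj C \<Longrightarrow> p T \<in> Obj D" using p0 by blast
  have g: "\<And>T. T \<in> Obj C \<Longrightarrow> g T \<in> Obj C" using fun_obj[OF G p] by (simp add: g_def)
  have "\<exists>k. \<forall>T\<in>Obj C. h T \<in> Hom C (g T) T \<and> k T \<in> Hom C T (g T)
      \<and> Comp C (g T) T (g T) (k T) (h T) = Id C (g T) \<and> Comp C T (g T) T (h T) (k T) = Id C T"
    using h0 unfolding is_iso_def g_def by metis
  then obtain k where h: "\<And>T. T \<in> Obj C \<Longrightarrow> h T \<in> Hom C (g T) T"
    and k: "\<And>T. T \<in> Obj C \<Longrightarrow> k T \<in> Hom C T (g T)"
    and kh: "\<And>T. T \<in> Obj C \<Longrightarrow> Comp C (g T) T (g T) (k T) (h T) = Id C (g T)"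
    and hk: "\<And>T. T \<in> Obj C \<Longrightarrow> Comp C T (g T) T (h T) (k T) = Id C T"
    by metis
  define i where "i X Y a = inv_into (Hom D X Y) (farr G X Y) a" for X Y a
  have i: "i X Y a \<in> Hom D X Y" and Gi: "farr G X Y (i X Y a) = a"
    if "X \<in> Obj D" "Y \<in> Obj D" "a \<in> Hom C (fobj G X) (fobj G Y)" for X Y a
    using ff[OF that(1,2)] that(3) unfolding i_def bij_betw_def
    by (auto intro: inv_into_into f_inv_into_f)
  have inj: "u = v" if "X \<in> Obj D" "Y \<in> Obj D" "u \<in> Hom D X Y" "v \<in> Hom D X Y"
      "farr G X Y u = farr G X Y v" for X Y u v
    using ff[OF that(1,2)] that(3-) unfolding bij_betw_def inj_on_def by blast
  define F where "F = \<lparr>fobj = (\<lambda>T\<in>Obj C. p T),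
      farr = (\<lambda>T T'. if T \<in> Obj C \<and> T' \<in> Obj C
         then (\<lambda>f\<in>Hom C T T'. i (p T) (p T') (Comp C (g T) T' (g T') (k T') (Comp C (g T) T T' f (h T))))
         else undefined)\<rparr>"
  have Fo: "fobj F T = p T" if "T \<in> Obj C" for T using that by (simp add: F_def)
  have conj_in: "Comp C (g T) T' (g T') (k T') (Comp C (g T) T T' f (h T)) \<in> Hom C (g T) (g T')"
    if "T \<in> Obj C" "T' \<in> Obj C" "f \<in> Hom C T T'" for T T' f
    using that by (intro cat_comp[OF C] g h k) auto
  have Fin: "farr F T T' f \<in> Hom D (p T) (p T')" if "T \<in> Obj C" "T' \<in> Obj C" "f \<in> Hom C T T'" for T T' f
    using i[OF p p conj_in[unfolded g_def]] that by (simp add: F_def g_def)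
  have GF: "farr G (p T) (p T') (farr F T T' f) = Comp C (g T) T' (g T') (k T') (Comp C (g T) T T' f (h T))"
    if "T \<in> Obj C" "T' \<in> Obj C" "f \<in> Hom C T T'" for T T' f
    using Gi[OF p p conj_in[unfolded g_def]] that by (simp add: F_def g_def)
  \<comment> \<open>This is naturality of \<open>h\<close>, with the conjugation removed by the
    inverse law for \<open>h\<close> and \<open>k\<close>.\<close>
  have hGF: "Comp C (g T) (g T') T' (h T') (farr G (p T) (p T') (farr F T T' f)) = Comp C (g T) T T' f (h T)"
    if a: "T \<in> Obj C" "T' \<in> Obj C" "f \<in> Hom C T T'" for T T' f
  proof -
    have c: "Comp C (g T) T T' f (h T) \<in> Hom C (g T) T'" using a by (intro cat_comp[OF C] g h) auto
    show ?thesis unfolding GF[OF a]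
      using cat_assoc[OF C g[OF a(1)] a(2) g[OF a(2)] a(2) c k[OF a(2)] h[OF a(2)]]
        cat_id_left[OF C g[OF a(1)] a(2) c] hk[OF a(2)] by simp
  qed
  \<comment> \<open>\<open>h T\<close> is a split monomorphism, so equations between arrows into
    \<open>g T\<close> may be checked after composing with it.\<close>
  have cancel: "u = v" if a: "S \<in> Obj C" "T \<in> Obj C" "u \<in> Hom C S (g T)" "v \<in> Hom C S (g T)"
      "Comp C S (g T) T (h T) u = Comp C S (g T) T (h T) v" for S T u v
  proof -
    have "Comp C S T (g T) (k T) (Comp C S (g T) T (h T) w) = w" if "w \<in> Hom C S (g T)" for w
      using cat_assoc[OF C a(1) g[OF a(2)] a(2) g[OF a(2)] that h[OF a(2)] k[OF a(2)]]
        kh[OF a(2)] cat_id_left[OF C a(1) g[OF a(2)] that] by simp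
    then show ?thesis using a by metis
  qed
  have Ff: "is_functor C D F"
    unfolding is_functor_def
  proof (intro conjI ballI allI impI C D)
    show "fobj F \<in> Obj C \<rightarrow>\<^sub>E Obj D" using p by (auto simp: F_def)
    show "farr F X Y \<in> Hom C X Y \<rightarrow>\<^sub>E Hom D (fobj F X) (fobj F Y)" if "X \<in> Obj C" "Y \<in> Obj C" for X Y
      using Fin[OF that] that Fo by (auto simp: PiE_iff extensional_def F_def)
    show "farr F X Y = undefined" if "\<not> (X \<in> Obj C \<and> Y \<in> Obj C)" for X Y
      using that by (auto simp: F_def)
    fix X assume X: "X \<in> Obj C"
    have "farr G (p X) (p X) (farr F X X (Id C X)) = Id C (g X)"
      unfolding GF[OF X X cat_id[OF C X]] using cat_id_left[OF C g[OF X] X h[OF X]] kh[OF X] by simp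
    then show "farr F X X (Id C X) = Id D (fobj F X)"
      unfolding Fo[OF X]
      by (intro inj[OF p[OF X] p[OF X]] X Fin cat_id[OF C] cat_id[OF D] p)
        (simp add: fun_id[OF G p[OF X]] g_def)
  next
    fix X Y Z u v assume o: "X \<in> Obj C" "Y \<in> Obj C" "Z \<in> Obj C" and u: "u \<in> Hom C X Y" and v: "v \<in> Hom C Y Z"
    have vu: "Comp C X Y Z v u \<in> Hom C X Z" by (intro cat_comp[OF C] o u v)
    let ?Gu = "farr G (p X) (p Y) (farr F X Y u)" and ?Gv = "farr G (p Y) (p Z) (farr F Y Z v)"
    have Gu: "?Gu \<in> Hom C (g X) (g Y)" and Gv: "?Gv \<in> Hom C (g Y) (g Z)"
      unfolding g_def by (intro fun_arr[OF G] p o Fin u v)+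
    \<comment> \<open>Functoriality of \<open>F\<close> is proved in three layers: compose with
      \<open>h Z\<close> and use naturality, cancel \<open>h Z\<close>, and then cancel
      \<open>G\<close> by faithfulness.\<close>
    have "Comp C (g X) (g Z) Z (h Z) (Comp C (g X) (g Y) (g Z) ?Gv ?Gu)
        = Comp C (g X) (g Y) Z (Comp C (g Y) (g Z) Z (h Z) ?Gv) ?Gu"
      by (intro cat_assoc[OF C] g o Gu Gv h)
    also have "\<dots> = Comp C (g X) (g Y) Z (Comp C (g Y) Y Z v (h Y)) ?Gu"
      using hGF o v by simp
    also have "\<dots> = Comp C (g X) Y Z v (Comp C (g X) (g Y) Y (h Y) ?Gu)"
      by (intro cat_assoc[OF C, symmetric] g o Gu v h)
    also have "\<dots> = Comp C (g X) Y Z v (Comp C (g X) X Y u (h X))"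
      using hGF o u by simp
    also have "\<dots> = Comp C (g X) X Z (Comp C X Y Z v u) (h X)"
      by (intro cat_assoc[OF C] g o u v h)
    also have "\<dots> = Comp C (g X) (g Z) Z (h Z) (farr G (p X) (p Z) (farr F X Z (Comp C X Y Z v u)))"
      using hGF o vu by simp
    finally have eq: "Comp C (g X) (g Z) Z (h Z) (Comp C (g X) (g Y) (g Z) ?Gv ?Gu)
        = Comp C (g X) (g Z) Z (h Z) (farr G (p X) (p Z) (farr F X Z (Comp C X Y Z v u)))" .
    have "Comp C (g X) (g Y) (g Z) ?Gv ?Gu \<in> Hom C (g X) (g Z)"
      by (rule cat_comp[OF C g[OF o(1)] g[OF o(2)] g[OF o(3)] Gu Gv])
    moreover have "farr G (p X) (p Z) (farr F X Z (Comp C X Y Z v u)) \<in> Hom C (g X) (g Z)"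
      unfolding g_def by (rule fun_arr[OF G p[OF o(1)] p[OF o(3)] Fin[OF o(1) o(3) vu]])
    ultimately have e: "Comp C (g X) (g Y) (g Z) ?Gv ?Gu = farr G (p X) (p Z) (farr F X Z (Comp C X Y Z v u))"
      using eq by (rule cancel[OF g[OF o(1)] o(3)])
    show "farr F X Z (Comp C X Y Z v u) = Comp D (fobj F X) (fobj F Y) (fobj F Z) (farr F Y Z v) (farr F X Y u)"
      unfolding Fo[OF o(1)] Fo[OF o(2)] Fo[OF o(3)]
      by (rule inj[OF p[OF o(1)] p[OF o(3)] Fin[OF o(1) o(3) vu]
            cat_comp[OF D p[OF o(1)] p[OF o(2)] p[OF o(3)] Fin[OF o(1) o(2) u] Fin[OF o(2) o(3) v]]])
        (simp add: fun_comp[OF G p[OF o(1)] p[OF o(2)] p[OF o(3)] Fin[OF o(1) o(2) u] Fin[OF o(2) o(3) v]]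
          e[symmetric] g_def)
  qed
  define \<epsilon> where "\<epsilon> P = i (p (fobj G P)) P (h (fobj G P))" for P
  have eps: "\<epsilon> P \<in> Hom D (p (fobj G P)) P" and Geps: "farr G (p (fobj G P)) P (\<epsilon> P) = h (fobj G P)"
    if "P \<in> Obj D" for P
    using i[OF p[OF fun_obj[OF G that]] that] Gi[OF p[OF fun_obj[OF G that]] that]
      h[OF fun_obj[OF G that]] by (auto simp: \<epsilon>_def g_def)
  have iso_eps: "is_iso D (p (fobj G P)) P (\<epsilon> P)" if P: "P \<in> Obj D" for P
  proof -
    let ?T = "fobj G P"
    have T: "?T \<in> Obj C" by (rule fun_obj[OF G P])
    \<comment> \<open>The inverse of the counit is the preimage of \<open>k\<close> under the full
      and faithful \<open>G\<close>; both inverse laws are reflected by \<open>G\<close>.\<close>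
    let ?k = "i P (p ?T) (k ?T)"
    have kk: "?k \<in> Hom D P (p ?T)" "farr G P (p ?T) ?k = k ?T"
      using i[OF P p[OF T]] Gi[OF P p[OF T]] k[OF T] by (auto simp: g_def)
    have "Comp D (p ?T) P (p ?T) ?k (\<epsilon> P) = Id D (p ?T)"
      by (intro inj[OF p[OF T] p[OF T]] cat_comp[OF D] cat_id[OF D] p T P kk eps)
        (simp add: fun_comp[OF G p[OF T] P p[OF T] eps[OF P] kk(1)] Geps[OF P] kk(2)
          fun_id[OF G p[OF T]] kh[OF T, unfolded g_def])
    moreover have "Comp D P (p ?T) P (\<epsilon> P) ?k = Id D P"
      by (intro inj[OF P P] cat_comp[OF D] cat_id[OF D] p T P kk eps)
        (simp add: fun_comp[OF G P p[OF T] P kk(1) eps[OF P]] Geps[OF P] kk(2)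
          fun_id[OF G P] hk[OF T, unfolded g_def])
    ultimately show ?thesis using kk eps[OF P] unfolding is_iso_def by blast
  qed
  have "is_natural_iso C C (id_functor C) (comp_functor C G F) k"
    unfolding is_natural_iso_def
  proof (intro conjI ballI is_functor_id C is_functor_comp[OF Ff G])
    fix X assume X: "X \<in> Obj C"
    show "is_iso C (fobj (id_functor C) X) (fobj (comp_functor C G F) X) (k X)"
      using h[OF X] k[OF X] kh[OF X] hk[OF X] X
      by (auto simp: is_iso_def id_functor_def comp_functor_def compose_def Fo g_def)
    fix Y f assume Y: "Y \<in> Obj C" and f: "f \<in> Hom C X Y"
    have fh: "Comp C (g X) X Y f (h X) \<in> Hom C (g X) Y" by (intro cat_comp[OF C] g X Y h f)
    have "Comp C X (g X) (g Y) (Comp C (g X) Y (g Y) (k Y) (Comp C (g X) X Y f (h X))) (k X)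
       = Comp C X Y (g Y) (k Y) (Comp C X (g X) Y (Comp C (g X) X Y f (h X)) (k X))"
      by (intro cat_assoc[OF C, symmetric] g X Y k fh)
    also have "Comp C X (g X) Y (Comp C (g X) X Y f (h X)) (k X) = Comp C X X Y f (Comp C X (g X) X (h X) (k X))"
      by (intro cat_assoc[OF C, symmetric] g X Y k h f)
    finally show "Comp C (fobj (id_functor C) X) (fobj (id_functor C) Y) (fobj (comp_functor C G F) Y) (k Y)
          (farr (id_functor C) X Y f) =
         Comp C (fobj (id_functor C) X) (fobj (comp_functor C G F) X) (fobj (comp_functor C G F) Y)
          (farr (comp_functor C G F) X Y f) (k X)"
      using X Y f GF[OF X Y f] hk[OF X] cat_id_right[OF C X Y f]
      by (simp add: id_functor_def comp_functor_def compose_def Fo g_def)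
  qed
  moreover have "is_natural_iso D D (comp_functor D F G) (id_functor D) \<epsilon>"
    unfolding is_natural_iso_def
  proof (intro conjI ballI is_functor_id D is_functor_comp[OF G Ff])
    fix X assume X: "X \<in> Obj D"
    let ?X = "fobj G X"
    have GX: "?X \<in> Obj C" by (rule fun_obj[OF G X])
    show "is_iso D (fobj (comp_functor D F G) X) (fobj (id_functor D) X) (\<epsilon> X)"
      using iso_eps[OF X] X GX by (simp add: id_functor_def comp_functor_def compose_def Fo)
    fix Y f assume Y: "Y \<in> Obj D" and f: "f \<in> Hom D X Y"
    let ?Y = "fobj G Y"
    have GY: "?Y \<in> Obj C" by (rule fun_obj[OF G Y])
    have Gf: "farr G X Y f \<in> Hom C ?X ?Y" by (rule fun_arr[OF G X Y f])
    have "Comp D (p ?X) (p ?Y) Y (\<epsilon> Y) (farr F ?X ?Y (farr G X Y f)) = Comp D (p ?X) X Y f (\<epsilon> X)"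
      by (intro inj[OF p[OF GX] Y] cat_comp[OF D] p GX GY X Y f eps Fin Gf)
        (simp add: fun_comp[OF G p[OF GX] p[OF GY] Y Fin[OF GX GY Gf] eps[OF Y]]
          fun_comp[OF G p[OF GX] X Y eps[OF X] f] Geps X Y hGF[OF GX GY Gf, unfolded g_def])
    then show "Comp D (fobj (comp_functor D F G) X) (fobj (comp_functor D F G) Y) (fobj (id_functor D) Y) (\<epsilon> Y)
          (farr (comp_functor D F G) X Y f) =
         Comp D (fobj (comp_functor D F G) X) (fobj (id_functor D) X) (fobj (id_functor D) Y)
          (farr (id_functor D) X Y f) (\<epsilon> X)"
      using X Y f GX GY by (simp add: id_functor_def comp_functor_def compose_def Fo)
  qed
  ultimately show ?thesis unfolding equivalent_categories_def using Ff G by blast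
qed

section \<open>Encodings into an infinite type\<close>

text \<open>Cardinal arithmetic: an infinite set is equipotent to its square.\<close>

lemma infinite_pairing:
  assumes "infinite (UNIV :: 'u set)"
  shows "\<exists>f :: 'u \<times> 'u \<Rightarrow> 'u. inj f"
proof -
  have "(card_of (UNIV \<times> UNIV :: ('u \<times> 'u) set), card_of (UNIV :: 'u set)) \<in> ordLeq"
    using card_of_Times_same_infinite[OF assms] ordIso_iff_ordLeq by blast
  then obtain f :: "'u \<times> 'u \<Rightarrow> 'u" where "inj_on f (UNIV \<times> UNIV)"
    using card_of_ordLeq[of "UNIV \<times> UNIV :: ('u \<times> 'u) set" "UNIV :: 'u set"] by blast
  then show ?thesis by auto
qed

lemma infinite_nat_embedding:
  assumes "infinite (UNIV :: 'u set)"
  shows "\<exists>f :: nat \<Rightarrow> 'u. inj f"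
  using infinite_countable_subset[OF assms] by auto

fun list_code :: "('u \<times> 'u \<Rightarrow> 'u) \<Rightarrow> 'u \<Rightarrow> 'u list \<Rightarrow> 'u" where
  "list_code pr c [] = c"
| "list_code pr c (x # xs) = pr (x, list_code pr c xs)"

text \<open>\<open>list_code\<close> alone need not be injective, as the end marker may lie in the
  range of \<open>pr\<close>. It does separate lists of equal length, so the length is stored as a
  first component.\<close>

lemma infinite_list_embedding:
  assumes "infinite (UNIV :: 'u set)"
  shows "\<exists>f :: 'u list \<Rightarrow> 'u. inj f"
proof -
  obtain pr :: "'u \<times> 'u \<Rightarrow> 'u" where pr: "inj pr" using infinite_pairing[OF assms] by blast
  obtain nc :: "nat \<Rightarrow> 'u" where nc: "inj nc" using infinite_nat_embedding[OF assms] by blast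
  have "xs = ys" if "length xs = length ys" "list_code pr c xs = list_code pr c ys" for c and xs ys :: "'u list"
    using that by (induction rule: list_induct2) (auto simp: inj_eq[OF pr])
  then have "inj (\<lambda>xs. pr (nc (length xs), list_code pr (nc 0) xs))"
    by (intro injI) (auto simp: inj_eq[OF pr] inj_eq[OF nc])
  then show ?thesis by blast
qed

fun tm_code :: "('u \<times> 'u \<Rightarrow> 'u) \<Rightarrow> (nat \<Rightarrow> 'u) \<Rightarrow> ('u list \<Rightarrow> 'u) \<Rightarrow> 'u tm \<Rightarrow> 'u" where
  "tm_code pr nc lc (Var i) = pr (nc 0, nc i)"
| "tm_code pr nc lc (Meta k ts) = pr (nc 1, pr (nc k, lc (map (tm_code pr nc lc) ts)))"
| "tm_code pr nc lc (Op f bs) =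
     pr (nc 2, pr (f, lc (map (\<lambda>(m, t). pr (nc m, tm_code pr nc lc t)) bs)))"

lemma map_eq_injD:
  "map f xs = map g ys \<Longrightarrow> (\<And>x y. x \<in> set xs \<Longrightarrow> f x = g y \<Longrightarrow> x = y) \<Longrightarrow> xs = ys"
  by (induction xs arbitrary: ys) (auto simp: Cons_eq_map_conv)

lemma inj_tm_code:
  assumes pr: "inj pr" and nc: "inj nc" and lc: "inj lc"
  shows "tm_code pr nc lc s = tm_code pr nc lc t \<Longrightarrow> s = t"
proof (induction s arbitrary: t)
  case (Var i)
  then show ?case by (cases t) (simp_all add: inj_eq[OF pr] inj_eq[OF nc])
next
  case (Meta k ts)
  show ?case
  proof (cases t)
    case t: (Meta k' ts')
    have "k = k'" and e: "map (tm_code pr nc lc) ts = map (tm_code pr nc lc) ts'"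
      using Meta.prems unfolding t tm_code.simps inj_eq[OF pr] inj_eq[OF nc] inj_eq[OF lc] prod.inject
      by blast+
    then show ?thesis unfolding t using map_eq_injD[OF e Meta.IH] by blast
  qed (use Meta.prems in \<open>simp_all add: inj_eq[OF pr] inj_eq[OF nc]\<close>)
next
  case (Op f bs)
  let ?c = "\<lambda>(m, t). pr (nc m, tm_code pr nc lc t)"
  show ?case
  proof (cases t)
    case t: (Op f' bs')
    have f: "f = f'" and e: "map ?c bs = map ?c bs'"
      using Op.prems unfolding t tm_code.simps inj_eq[OF pr] inj_eq[OF nc] inj_eq[OF lc] prod.inject
      by blast+
    have "x = y" if "x \<in> set bs" "?c x = ?c y" for x y
    proof -
      have "fst x = fst y" "tm_code pr nc lc (snd x) = tm_code pr nc lc (snd y)"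
        using that(2) unfolding case_prod_unfold inj_eq[OF pr] inj_eq[OF nc] prod.inject by blast+
      \<comment> \<open>The induction hypothesis of the nested datatype ranges over the components
        \<open>snds\<close> of each pair.\<close>
      moreover have "snd x \<in> Basic_BNFs.snds x" by (simp add: snds.simps)
      ultimately show ?thesis using Op.IH[OF that(1)] by (simp add: prod_eq_iff)
    qed
    from map_eq_injD[OF e this] f show ?thesis unfolding t by blast
  qed (use Op.prems in \<open>simp_all add: inj_eq[OF pr] inj_eq[OF nc]\<close>)
qed

lemma infinite_tm_list_embedding:
  assumes "infinite (UNIV :: 'u set)"
  shows "\<exists>f :: 'u tm list \<Rightarrow> 'u. inj f"
proof -
  obtain pr :: "'u \<times> 'u \<Rightarrow> 'u" where pr: "inj pr" using infinite_pairing[OF assms] by blast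
  obtain nc :: "nat \<Rightarrow> 'u" where nc: "inj nc" using infinite_nat_embedding[OF assms] by blast
  obtain lc :: "'u list \<Rightarrow> 'u" where lc: "inj lc" using infinite_list_embedding[OF assms] by blast
  have "inj (tm_code pr nc lc)" using inj_tm_code[OF pr nc lc] by (rule injI)
  then have "inj (lc \<circ> map (tm_code pr nc lc))" using lc by (intro inj_compose inj_mapI)
  then show ?thesis by blast
qed

lemma infinite_nat_list_times_embedding:
  assumes "infinite (UNIV :: 'u set)"
  shows "\<exists>f :: nat list \<times> 'u \<Rightarrow> 'u. inj f"
proof -
  obtain pr :: "'u \<times> 'u \<Rightarrow> 'u" where pr: "inj pr" using infinite_pairing[OF assms] by blast
  obtain nc :: "nat \<Rightarrow> 'u" where nc: "inj nc" using infinite_nat_embedding[OF assms] by blast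
  obtain lc :: "'u list \<Rightarrow> 'u" where lc: "inj lc" using infinite_list_embedding[OF assms] by blast
  have "inj (\<lambda>(ms, f). pr (lc (map nc ms), f))"
    by (auto intro!: injI simp: inj_eq[OF pr] inj_eq[OF lc] inj_eq[OF inj_mapI[OF nc]])
  then show ?thesis by blast
qed

section \<open>Renaming, substitution and metasubstitution\<close>

text \<open>Restates the induction rule of the nested datatype with membership of a pair
  \<open>(m, t)\<close> in place of \<open>snds\<close>, so that the binder arity \<open>m\<close>
  is at hand in the \<open>Op\<close> case.\<close>

lemma tm_induct [case_names Var Meta Op]:
  assumes "\<And>i. P (Var i)" "\<And>k ts. (\<And>t. t \<in> set ts \<Longrightarrow> P t) \<Longrightarrow> P (Meta k ts)"
    "\<And>f bs. (\<And>m t. (m, t) \<in> set bs \<Longrightarrow> P t) \<Longrightarrow> P (Op f bs)"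
  shows "P t"
proof (induction t)
  case (Op f bs)
  then show ?case using assms(3)[of bs f] by (fastforce simp: prod_set_simps)
qed (use assms in auto)

lemma map_binders_cong:
  assumes "\<And>m t. (m, t) \<in> set bs \<Longrightarrow> F m t = G m t"
  shows "map (\<lambda>(m, t). (m, F m t)) bs = map (\<lambda>(m, t). (m, G m t)) bs"
proof (rule map_cong[OF HOL.refl])
  fix b assume "b \<in> set bs"
  then show "(case b of (m, t) \<Rightarrow> (m, F m t)) = (case b of (m, t) \<Rightarrow> (m, G m t))"
    using assms[of "fst b" "snd b"] by (simp add: case_prod_unfold)
qed

lemma map_binders_id:
  assumes "\<And>m t. (m, t) \<in> set bs \<Longrightarrow> F m t = t"
  shows "map (\<lambda>(m, t). (m, F m t)) bs = bs"
  using map_binders_cong[of bs F "\<lambda>m t. t", OF assms] by simp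

lemma map_map_binders:
  "map (\<lambda>(m, t). (m, F m t)) (map (\<lambda>(m, t). (m, G m t)) bs) = map (\<lambda>(m, t). (m, F m (G m t))) bs"
  by (simp add: case_prod_unfold)

lemma Op_binders_cong:
  assumes "\<And>m t. (m, t) \<in> set bs \<Longrightarrow> F m t = G m t"
  shows "Op f (map (\<lambda>(m, t). (m, F m t)) bs) = Op f (map (\<lambda>(m, t). (m, G m t)) bs)"
  by (simp only: map_binders_cong[of bs F G, OF assms])

lemma up_subst_cong: "(\<And>i. i < n \<Longrightarrow> \<sigma> i = \<sigma>' i) \<Longrightarrow> i < n + m \<Longrightarrow> up_subst m \<sigma> i = up_subst m \<sigma>' i"
  by (auto simp: up_subst_def)

lemma subst_cong:
  "wf_tm S \<Theta> n t \<Longrightarrow> (\<And>i. i < n \<Longrightarrow> \<sigma> i = \<sigma>' i) \<Longrightarrow> subst \<sigma> t = subst \<sigma>' t"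
proof (induction t arbitrary: n \<sigma> \<sigma>' rule: tm_induct)
  case (Op f bs)
  have "subst (up_subst m \<sigma>) t = subst (up_subst m \<sigma>') t" if "(m, t) \<in> set bs" for m t
    using Op.prems that by (intro Op.IH[OF that, of "n + m"] up_subst_cong[of n]) auto
  note eq = this
  show ?case
    unfolding rename.simps subst.simps msubst.simps map_map_binders by (rule Op_binders_cong[OF eq])
next
  case (Meta k ts)
  have "subst \<sigma> t = subst \<sigma>' t" if "t \<in> set ts" for t
    using Meta.prems that by (intro Meta.IH[OF that, of n]) auto
  then show ?case by simp
qed auto

section \<open>Composition laws for renaming and substitution\<close>

lemma up_ren_comp: "up_ren m r \<circ> up_ren m r' = up_ren m (r \<circ> r')"
  by (auto simp: up_ren_def fun_eq_iff)

lemma up_subst_Var: "up_subst m (Var \<circ> r) = Var \<circ> up_ren m r"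
  by (auto simp: up_ren_def up_subst_def fun_eq_iff)

lemma rename_eq_subst: "rename r t = subst (Var \<circ> r) t"
proof (induction t arbitrary: r rule: tm_induct)
  case (Op f bs)
  have "rename (up_ren m r) t = subst (up_subst m (Var \<circ> r)) t" if "(m, t) \<in> set bs" for m t
    unfolding up_subst_Var by (rule Op.IH[OF that])
  note eq = this
  show ?case
    unfolding rename.simps subst.simps msubst.simps map_map_binders by (rule Op_binders_cong[OF eq])
qed auto

text \<open>\<open>up_subst\<close> contains a renaming, which forces the order of the four
  composition laws: renaming after renaming, substitution after renaming, renaming after
  substitution, and only then substitution after substitution. Each supplies the law for passing
  under a binder that the next one needs.\<close>

lemma rename_rename: "rename r (rename r' t) = rename (r \<circ> r') t"
proof (induction t arbitrary: r r' rule: tm_induct)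
  case (Op f bs)
  have "rename (up_ren m r) (rename (up_ren m r') t) = rename (up_ren m (r \<circ> r')) t"
    if "(m, t) \<in> set bs" for m t
    unfolding up_ren_comp[symmetric] by (rule Op.IH[OF that])
  note eq = this
  show ?case
    unfolding rename.simps subst.simps msubst.simps map_map_binders by (rule Op_binders_cong[OF eq])
qed auto

lemma up_subst_up_ren: "up_subst m \<sigma> \<circ> up_ren m r = up_subst m (\<sigma> \<circ> r)"
  by (auto simp: up_ren_def up_subst_def fun_eq_iff)

lemma subst_rename: "subst \<sigma> (rename r t) = subst (\<sigma> \<circ> r) t"
proof (induction t arbitrary: \<sigma> r rule: tm_induct)
  case (Op f bs)
  have "subst (up_subst m \<sigma>) (rename (up_ren m r) t) = subst (up_subst m (\<sigma> \<circ> r)) t"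
    if "(m, t) \<in> set bs" for m t
    unfolding up_subst_up_ren[symmetric] by (rule Op.IH[OF that])
  note eq = this
  show ?case
    unfolding rename.simps subst.simps msubst.simps map_map_binders by (rule Op_binders_cong[OF eq])
qed auto

lemma rename_up_subst: "rename (up_ren m r) \<circ> up_subst m \<sigma> = up_subst m (rename r \<circ> \<sigma>)"
proof
  fix i
  have "up_ren m r \<circ> (+) m = (+) m \<circ> r" by (auto simp: up_ren_def)
  then show "(rename (up_ren m r) \<circ> up_subst m \<sigma>) i = up_subst m (rename r \<circ> \<sigma>) i"
    by (simp add: up_subst_def rename_rename up_ren_def)
qed

lemma rename_subst: "rename r (subst \<sigma> t) = subst (rename r \<circ> \<sigma>) t"
proof (induction t arbitrary: \<sigma> r rule: tm_induct)
  case (Op f bs)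
  have "rename (up_ren m r) (subst (up_subst m \<sigma>) t) = subst (up_subst m (rename r \<circ> \<sigma>)) t"
    if "(m, t) \<in> set bs" for m t
    unfolding rename_up_subst[symmetric] by (rule Op.IH[OF that])
  note eq = this
  show ?case
    unfolding rename.simps subst.simps msubst.simps map_map_binders by (rule Op_binders_cong[OF eq])
qed auto

lemma up_subst_subst: "subst (up_subst m \<sigma>) (up_subst m \<rho> i) = up_subst m (\<lambda>j. subst \<sigma> (\<rho> j)) i"
proof -
  have "up_subst m \<sigma> \<circ> (+) m = rename ((+) m) \<circ> \<sigma>" by (auto simp: up_subst_def)
  then show ?thesis by (simp add: up_subst_def subst_rename rename_subst)
qed

lemma subst_subst: "subst \<sigma> (subst \<rho> t) = subst (\<lambda>i. subst \<sigma> (\<rho> i)) t"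
proof (induction t arbitrary: \<sigma> \<rho> rule: tm_induct)
  case (Op f bs)
  have "subst (up_subst m \<sigma>) (subst (up_subst m \<rho>) t) = subst (up_subst m (\<lambda>j. subst \<sigma> (\<rho> j))) t"
    if "(m, t) \<in> set bs" for m t
    unfolding up_subst_subst[symmetric] by (rule Op.IH[OF that])
  note eq = this
  show ?case
    unfolding rename.simps subst.simps msubst.simps map_map_binders by (rule Op_binders_cong[OF eq])
qed auto

lemma up_subst_id: "up_subst m Var = Var"
  by (auto simp: up_subst_def)

lemma subst_Var [simp]: "subst Var t = t"
proof (induction t rule: tm_induct)
  case (Op f bs)
  have "subst (up_subst m Var) t = t" if "(m, t) \<in> set bs" for m t
    unfolding up_subst_id by (rule Op.IH[OF that])
  then show ?case by (simp only: subst.simps map_binders_id)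
qed (auto intro: map_idI)

lemma subst_id: "wf_tm S \<Theta> n t \<Longrightarrow> (\<And>i. i < n \<Longrightarrow> \<sigma> i = Var i) \<Longrightarrow> subst \<sigma> t = t"
  using subst_cong[of S \<Theta> n t \<sigma> Var] by simp

lemma rename_id: "wf_tm S \<Theta> n t \<Longrightarrow> (\<And>i. i < n \<Longrightarrow> r i = i) \<Longrightarrow> rename r t = t"
  unfolding rename_eq_subst by (rule subst_id) auto

section \<open>Well-formedness, and substitution inside abstractions\<close>

lemma wf_rename:
  "wf_tm S \<Theta> n t \<Longrightarrow> (\<And>i. i < n \<Longrightarrow> r i < p) \<Longrightarrow> wf_tm S \<Theta> p (rename r t)"
proof (induction t arbitrary: n r p rule: tm_induct)
  case (Op f bs)
  have "wf_tm S \<Theta> (p + m) (rename (up_ren m r) t)" if "(m, t) \<in> set bs" for m t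
    using Op.prems that by (intro Op.IH[OF that, of "n + m"]) (auto simp: up_ren_def)
  then show ?case using Op.prems by (auto simp: comp_def case_prod_unfold)
qed auto

lemma wf_up_subst:
  "(\<And>i. i < n \<Longrightarrow> wf_tm S \<Theta> p (\<sigma> i)) \<Longrightarrow> i < n + m \<Longrightarrow> wf_tm S \<Theta> (p + m) (up_subst m \<sigma> i)"
  by (auto simp: up_subst_def intro!: wf_rename[of _ _ p])

lemma wf_subst:
  "wf_tm S \<Theta> n t \<Longrightarrow> (\<And>i. i < n \<Longrightarrow> wf_tm S \<Theta> p (\<sigma> i)) \<Longrightarrow> wf_tm S \<Theta> p (subst \<sigma> t)"
proof (induction t arbitrary: n \<sigma> p rule: tm_induct)
  case (Op f bs)
  have "wf_tm S \<Theta> (p + m) (subst (up_subst m \<sigma>) t)" if "(m, t) \<in> set bs" for m t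
    using Op.prems that by (intro Op.IH[OF that, of "n + m"] wf_up_subst[of n]) auto
  then show ?case using Op.prems by (auto simp: comp_def case_prod_unfold)
qed auto

text \<open>Generalises \<open>weaken_abs\<close> from shifts to arbitrary substitutions of the
  surrounding context, so that weakening and instantiation of abstractions obey one composition
  law.\<close>

definition subst_abs :: "(nat \<Rightarrow> 'o tm) \<Rightarrow> nat \<times> 'o tm \<Rightarrow> nat \<times> 'o tm" where
  "subst_abs \<sigma> = (\<lambda>(m, t). (m, subst (up_subst m \<sigma>) t))"

lemma fst_subst_abs [simp]: "fst (subst_abs \<sigma> b) = fst b"
  by (simp add: subst_abs_def case_prod_unfold)

lemma snd_subst_abs: "snd (subst_abs \<sigma> b) = subst (up_subst (fst b) \<sigma>) (snd b)"
  by (simp add: subst_abs_def case_prod_unfold)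

lemma weaken_abs_eq: "weaken_abs n = subst_abs (Var \<circ> (+) n)"
  by (auto simp: weaken_abs_def subst_abs_def fun_eq_iff rename_eq_subst up_subst_Var)

lemma fst_weaken_abs [simp]: "fst (weaken_abs n b) = fst b"
  by (simp add: weaken_abs_eq)

lemma snd_weaken_abs: "snd (weaken_abs n b) = rename (up_ren (fst b) ((+) n)) (snd b)"
  by (simp add: weaken_abs_def case_prod_unfold)

lemma map_fst_weaken_abs [simp]: "map (fst \<circ> weaken_abs n) th = map fst th"
  by simp

lemma subst_abs_subst_abs: "subst_abs \<sigma> (subst_abs \<rho> b) = subst_abs (\<lambda>i. subst \<sigma> (\<rho> i)) b"
  by (simp add: subst_abs_def case_prod_unfold subst_subst up_subst_subst)

lemma subst_abs_weaken_abs: "subst_abs (up_subst m \<sigma>) (weaken_abs m b) = weaken_abs m (subst_abs \<sigma> b)"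
proof -
  have "up_subst m \<sigma> (m + i) = rename ((+) m) (\<sigma> i)" for i by (simp add: up_subst_def)
  then show ?thesis
    by (simp add: weaken_abs_eq subst_abs_subst_abs rename_eq_subst comp_def)
qed

lemma subst_abs_Var [simp]: "subst_abs Var b = b"
  by (simp add: subst_abs_def case_prod_unfold up_subst_id)

lemma weaken_abs_id [simp]: "weaken_abs 0 b = b"
  unfolding weaken_abs_eq by (simp add: comp_def)

definition wf_abs :: "'o signature \<Rightarrow> nat list \<Rightarrow> nat \<Rightarrow> nat \<times> 'o tm \<Rightarrow> bool" where
  "wf_abs S \<Theta> n b = wf_tm S \<Theta> (n + fst b) (snd b)"

lemma wf_subst_abs:
  assumes "wf_abs S \<Theta> n b" "\<And>i. i < n \<Longrightarrow> wf_tm S \<Theta> p (\<sigma> i)"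
  shows "wf_abs S \<Theta> p (subst_abs \<sigma> b)"
  using assms unfolding wf_abs_def
  by (auto simp: snd_subst_abs intro!: wf_subst[of S \<Theta> "n + fst b"] wf_up_subst[of n])

lemma wf_weaken_abs: "wf_abs S \<Theta> n b \<Longrightarrow> wf_abs S \<Theta> (n + m) (weaken_abs m b)"
  unfolding weaken_abs_eq by (rule wf_subst_abs) auto

lemma wf_map_weaken_abs:
  "b \<in> set (map (weaken_abs m) th) \<Longrightarrow> (\<And>b. b \<in> set th \<Longrightarrow> wf_abs S \<Theta> n b) \<Longrightarrow> wf_abs S \<Theta> (n + m) b"
  by (metis imageE list.set_map wf_weaken_abs)

lemma subst_abs_cong:
  assumes "wf_abs S \<Theta> n b" "\<And>i. i < n \<Longrightarrow> \<sigma> i = \<sigma>' i"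
  shows "subst_abs \<sigma> b = subst_abs \<sigma>' b"
  using assms subst_cong[of S \<Theta> "n + fst b" "snd b" "up_subst (fst b) \<sigma>" "up_subst (fst b) \<sigma>'"]
    up_subst_cong[of n \<sigma> \<sigma>']
  by (auto simp: wf_abs_def subst_abs_def case_prod_unfold)

text \<open>The classical substitution lemma: both sides agree on each variable, because
  instantiating freshly added variables undoes the shift.\<close>

lemma subst_inst: "subst \<sigma> (subst (inst ss) u) = subst (inst (map (subst \<sigma>) ss)) (subst (up_subst (length ss) \<sigma>) u)"
proof -
  have "subst \<sigma> (inst ss i) = subst (inst (map (subst \<sigma>) ss)) (up_subst (length ss) \<sigma> i)" for i
  proof -
    have "inst (map (subst \<sigma>) ss) \<circ> (+) (length ss) = Var" by (auto simp: inst_def)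
    then show ?thesis by (auto simp: inst_def up_subst_def subst_rename)
  qed
  then show ?thesis by (simp add: subst_subst)
qed

lemma wf_inst:
  "(\<And>s. s \<in> set ss \<Longrightarrow> wf_tm S \<Theta> n s) \<Longrightarrow> i < n + length ss \<Longrightarrow> wf_tm S \<Theta> n (inst ss i)"
  by (auto simp: inst_def)

text \<open>Substitution commutes with metasubstitution as long as it merely renames the variables of the
  term acted on. This covers both renamings and substitutions into the abstractions when the term
  is closed.\<close>

lemma subst_msubst:
  assumes "wf_tm S (map fst th) n t" "\<And>i. i < n \<Longrightarrow> \<sigma> i = Var (r i)"
  shows "subst \<sigma> (msubst th t) = msubst (map (subst_abs \<sigma>) th) (rename r t)"
  using assms
proof (induction t arbitrary: n \<sigma> r th rule: tm_induct)
  case (Meta k ts)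
  then have "map (subst \<sigma>) (map (msubst th) ts) = map (msubst (map (subst_abs \<sigma>) th)) (map (rename r) ts)"
    by auto
  with Meta.prems show ?case
    by (simp add: subst_inst snd_subst_abs del: map_map)
next
  case (Op f bs)
  have "subst (up_subst m \<sigma>) (msubst (map (weaken_abs m) th) t)
      = msubst (map (weaken_abs m) (map (subst_abs \<sigma>) th)) (rename (up_ren m r) t)"
    if "(m, t) \<in> set bs" for m t
  proof -
    have "subst (up_subst m \<sigma>) (msubst (map (weaken_abs m) th) t)
      = msubst (map (subst_abs (up_subst m \<sigma>)) (map (weaken_abs m) th)) (rename (up_ren m r) t)"
      using Op.prems that
      by (intro Op.IH[OF that, of _ "n + m"]) (auto simp: up_subst_def up_ren_def comp_def)
    then show ?thesis by (simp add: subst_abs_weaken_abs comp_def)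
  qed
  note eq = this
  show ?case
    unfolding rename.simps subst.simps msubst.simps map_map_binders by (rule Op_binders_cong[OF eq])
qed auto

lemma rename_msubst:
  assumes "wf_tm S (map fst th) n t"
  shows "rename r (msubst th t) = msubst (map (subst_abs (Var \<circ> r)) th) (rename r t)"
  unfolding rename_eq_subst[of r "msubst th t"] by (rule subst_msubst[OF assms]) simp

lemma subst_msubst_closed:
  assumes "wf_tm S (map fst th) n t" "\<And>i. i < n \<Longrightarrow> \<sigma> i = Var i"
  shows "subst \<sigma> (msubst th t) = msubst (map (subst_abs \<sigma>) th) t"
  using subst_msubst[OF assms(1), of \<sigma> id] assms(2) rename_id[OF assms(1), of id] by auto

lemma wf_msubst:
  assumes "wf_tm S (map fst th) n t" "\<And>b. b \<in> set th \<Longrightarrow> wf_abs S \<Theta> n b"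
  shows "wf_tm S \<Theta> n (msubst th t)"
  using assms
proof (induction t arbitrary: n th rule: tm_induct)
  case (Meta k ts)
  have ts: "wf_tm S \<Theta> n (msubst th t)" if "t \<in> set ts" for t
    using Meta.IH[OF that] Meta.prems that by auto
  have k: "k < length th" "length ts = fst (th ! k)" using Meta.prems by auto
  then have "wf_tm S \<Theta> (n + length ts) (snd (th ! k))"
    using Meta.prems(2)[of "th ! k"] by (simp add: wf_abs_def)
  then show ?case
    unfolding msubst.simps by (rule wf_subst) (use ts in \<open>auto intro!: wf_inst\<close>)
next
  case (Op f bs)
  have "wf_tm S \<Theta> (n + m) (msubst (map (weaken_abs m) th) t)" if "(m, t) \<in> set bs" for m t
  proof (rule Op.IH[OF that, of _ "n + m"])
    show "wf_tm S (map fst (map (weaken_abs m) th)) (n + m) t"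
      using Op.prems that by auto
  qed (use wf_map_weaken_abs Op.prems(2) in blast)
  then show ?case using Op.prems by (auto simp: comp_def case_prod_unfold)
qed auto

text \<open>The abstractions in \<open>th\<close> live over the context into which the terms
  \<sigma> i are placed, whereas on the right \<open>t\<close> still has its old context. So a
  second family \<open>th'\<close> over the old context is needed, which \<sigma>' sends to
  \<open>th\<close>. In the main use \<open>th'\<close> is \<open>th\<close> weakened by some bound
  variables and \<sigma>' instantiates exactly these variables.\<close>

lemma msubst_subst:
  assumes "wf_tm S (map fst th) n t" "length th' = length th"
    "\<And>k. k < length th \<Longrightarrow> th ! k = subst_abs \<sigma>' (th' ! k)"
    "\<And>i. i < n \<Longrightarrow> msubst th (\<sigma> i) = \<sigma>' i"
    "\<And>i. i < n \<Longrightarrow> wf_tm S (map fst th) p (\<sigma> i)"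
  shows "msubst th (subst \<sigma> t) = subst \<sigma>' (msubst th' t)"
  using assms
proof (induction t arbitrary: n \<sigma> \<sigma>' th th' p rule: tm_induct)
  case (Meta k ts)
  have "msubst th (subst \<sigma> t) = subst \<sigma>' (msubst th' t)" if "t \<in> set ts" for t
    using Meta.prems that by (intro Meta.IH[OF that, of _ n _ _ _ p]) auto
  then have eq: "map (msubst th \<circ> subst \<sigma>) ts = map (subst \<sigma>' \<circ> msubst th') ts" by simp
  from Meta.prems show ?case
    by (simp add: subst_inst snd_subst_abs eq)
next
  case (Op f bs)
  have "msubst (map (weaken_abs m) th) (subst (up_subst m \<sigma>) t)
      = subst (up_subst m \<sigma>') (msubst (map (weaken_abs m) th') t)"
    if b: "(m, t) \<in> set bs" for m t
  proof (rule Op.IH[OF b, of "map (weaken_abs m) th" "n + m" _ _ _ "p + m"])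
    show "wf_tm S (map fst (map (weaken_abs m) th)) (n + m) t" using Op.prems b by (auto simp: comp_def)
    fix k assume "k < length (map (weaken_abs m) th)"
    then show "map (weaken_abs m) th ! k = subst_abs (up_subst m \<sigma>') (map (weaken_abs m) th' ! k)"
      using Op.prems(2,3) by (simp add: subst_abs_weaken_abs)
  next
    fix i assume i: "i < n + m"
    show "wf_tm S (map fst (map (weaken_abs m) th)) (p + m) (up_subst m \<sigma> i)"
      using wf_up_subst[of n S _ p \<sigma>, OF Op.prems(5) i] by (simp add: comp_def)
    show "msubst (map (weaken_abs m) th) (up_subst m \<sigma> i) = up_subst m \<sigma>' i"
      using i Op.prems(4,5)[of "i - m"] rename_msubst[of S th p "\<sigma> (i - m)" "(+) m"]
      by (auto simp: up_subst_def weaken_abs_eq comp_def)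
  qed (use Op.prems in \<open>auto \<close>)
  note eq = this
  show ?case
    unfolding rename.simps subst.simps msubst.simps map_map_binders by (rule Op_binders_cong[OF eq])
qed auto

section \<open>Associativity and unit of metasubstitution\<close>

definition msubst_abs :: "(nat \<times> 'o tm) list \<Rightarrow> nat \<times> 'o tm \<Rightarrow> nat \<times> 'o tm" where
  "msubst_abs th = (\<lambda>(m, t). (m, msubst (map (weaken_abs m) th) t))"

lemma fst_msubst_abs [simp]: "fst (msubst_abs th b) = fst b"
  by (simp add: msubst_abs_def case_prod_unfold)

lemma weaken_msubst_abs:
  assumes "wf_abs S (map fst th) n b"
  shows "weaken_abs m (msubst_abs th b) = msubst_abs (map (weaken_abs m) th) (weaken_abs m b)"
proof -
  obtain l t where b: "b = (l, t)" by (cases b)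
  have "rename (up_ren l ((+) m)) (msubst (map (weaken_abs l) th) t)
      = msubst (map (subst_abs (Var \<circ> up_ren l ((+) m))) (map (weaken_abs l) th)) (rename (up_ren l ((+) m)) t)"
    using assms by (intro rename_msubst[of S _ "n + l"]) (simp add: b wf_abs_def comp_def)
  also have "map (subst_abs (Var \<circ> up_ren l ((+) m))) (map (weaken_abs l) th)
      = map (weaken_abs l) (map (weaken_abs m) th)"
    by (simp add: up_subst_Var[symmetric] subst_abs_weaken_abs weaken_abs_eq[of m])
  finally show ?thesis by (simp add: b weaken_abs_def msubst_abs_def)
qed

lemma msubst_Op: "msubst th (Op f bs) = Op f (map (msubst_abs th) bs)"
  by (simp add: msubst_abs_def)

text \<open>The composition law behind associativity of composition, both in \<M> and in the theory
  of a presentation. At a metavariable the inner metasubstitution has produced an ordinary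
  substitution, so this case is \<open>msubst_subst\<close>.\<close>

lemma msubst_msubst:
  assumes "wf_tm S (map fst th') n t" "\<And>b. b \<in> set th' \<Longrightarrow> wf_abs S (map fst th) n b"
  shows "msubst th (msubst th' t) = msubst (map (msubst_abs th) th') t"
  using assms
proof (induction t arbitrary: n th th' rule: tm_induct)
  case (Meta k ts)
  have k: "k < length th'" and len: "length ts = fst (th' ! k)" using Meta.prems by auto
  let ?rs = "map (msubst th') ts"
  have wf: "wf_abs S (map fst th) n (th' ! k)" using Meta.prems(2) k by simp
  have rs: "wf_tm S (map fst th) n r" if "r \<in> set ?rs" for r
    using that Meta.prems by (auto intro!: wf_msubst)
  have "msubst th (subst (inst ?rs) (snd (th' ! k)))
      = subst (inst (map (msubst th) ?rs)) (msubst (map (weaken_abs (length ts)) th) (snd (th' ! k)))"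
  proof (rule msubst_subst[of S _ "n + length ts" _ _ _ _ n])
    show "wf_tm S (map fst th) (n + length ts) (snd (th' ! k))"
      using wf len by (simp add: wf_abs_def)
    \<comment> \<open>Weakening by the bound variables and then instantiating them is the
      identity.\<close>
    show "th ! j = subst_abs (inst (map (msubst th) ?rs)) (map (weaken_abs (length ts)) th ! j)"
      if "j < length th" for j
    proof -
      have "(\<lambda>i. subst (inst (map (msubst th) ?rs)) ((Var \<circ> (+) (length ts)) i)) = Var"
        by (auto simp: inst_def)
      then show ?thesis using that by (simp add: weaken_abs_eq subst_abs_subst_abs)
    qed
    show "wf_tm S (map fst th) n (inst ?rs i)" if "i < n + length ts" for i
      using that rs by (intro wf_inst) auto
    show "msubst th (inst ?rs i) = inst (map (msubst th) ?rs) i" for i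
      by (simp add: inst_def)
  qed simp
  also have "map (msubst th) ?rs = map (msubst (map (msubst_abs th) th')) ts"
    using Meta by auto
  finally show ?case using k len by (simp add: msubst_abs_def case_prod_unfold)
next
  case (Op f bs)
  have "msubst (map (weaken_abs m) th) (msubst (map (weaken_abs m) th') t)
      = msubst (map (weaken_abs m) (map (msubst_abs th) th')) t"
    if b: "(m, t) \<in> set bs" for m t
  proof -
    have "msubst (map (weaken_abs m) th) (msubst (map (weaken_abs m) th') t)
        = msubst (map (msubst_abs (map (weaken_abs m) th)) (map (weaken_abs m) th')) t"
    proof (rule Op.IH[OF b, of _ "n + m"])
      show "wf_tm S (map fst (map (weaken_abs m) th')) (n + m) t"
        using Op.prems b by auto
      show "wf_abs S (map fst (map (weaken_abs m) th)) (n + m) b"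
        if "b \<in> set (map (weaken_abs m) th')" for b
        using wf_map_weaken_abs[OF that] Op.prems(2) by simp
    qed
    moreover have "map (msubst_abs (map (weaken_abs m) th)) (map (weaken_abs m) th')
        = map (weaken_abs m) (map (msubst_abs th) th')"
      using weaken_msubst_abs[OF Op.prems(2)] by auto
    ultimately show ?thesis by (simp only:)
  qed
  note eq = this
  show ?case
    unfolding rename.simps subst.simps msubst.simps map_map_binders by (rule Op_binders_cong[OF eq])
qed auto

text \<open>The unit of metasubstitution. The arities are kept in the pairs, so the same list serves
  as the arguments of the generic application \<open>Op f (id_abs (arity S f))\<close>.\<close>

definition id_abs :: "nat list \<Rightarrow> (nat \<times> 'o tm) list" where
  "id_abs ms = map (\<lambda>i. (ms ! i, meta_vars i (ms ! i))) [0..<length ms]"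

lemma length_id_abs [simp]: "length (id_abs ms) = length ms"
  by (simp add: id_abs_def)

lemma nth_id_abs [simp]: "i < length ms \<Longrightarrow> id_abs ms ! i = (ms ! i, meta_vars i (ms ! i))"
  by (simp add: id_abs_def)

lemma map_fst_id_abs [simp]: "map fst (id_abs ms) = ms"
  by (rule nth_equalityI) auto

lemma wf_meta_vars: "k < length \<Theta> \<Longrightarrow> \<Theta> ! k = m \<Longrightarrow> m \<le> n \<Longrightarrow> wf_tm S \<Theta> n (meta_vars k m)"
  by (auto simp: meta_vars_def)

lemma subst_meta_vars: "subst \<sigma> (meta_vars k m) = Meta k (map \<sigma> [0..<m])"
  by (simp add: meta_vars_def)

lemma weaken_abs_meta_vars [simp]: "weaken_abs n (m, meta_vars k m) = (m, meta_vars k m)"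
  by (auto simp: weaken_abs_eq subst_abs_def meta_vars_def up_subst_def)

lemma map_weaken_id_abs [simp]: "map (weaken_abs n) (id_abs ms) = id_abs ms"
  by (simp add: id_abs_def)

lemma wf_id_abs: "b \<in> set (id_abs ms) \<Longrightarrow> wf_abs S ms n b"
  by (auto simp: id_abs_def wf_abs_def intro!: wf_meta_vars)

lemma map_inst: "length ss = m \<Longrightarrow> map (inst ss) [0..<m] = ss"
  by (auto simp: inst_def intro: nth_equalityI)

lemma msubst_id: "wf_tm S ms n t \<Longrightarrow> msubst (id_abs ms) t = t"
proof (induction t arbitrary: n rule: tm_induct)
  case (Meta k ts)
  then have "map (msubst (id_abs ms)) ts = ts" by (auto intro: map_idI)
  with Meta.prems show ?case by (simp add: subst_meta_vars map_inst)
next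
  case (Op f bs)
  then have "msubst (map (weaken_abs m) (id_abs ms)) t = t" if "(m, t) \<in> set bs" for m t
    using that by (auto intro: Op.IH)
  then show ?case by (simp only: msubst.simps map_binders_id)
qed auto

lemma msubst_weaken_meta_vars:
  assumes "k < length th" "fst (th ! k) = m"
  shows "msubst (map (weaken_abs m) th) (meta_vars k m) = snd (th ! k)"
proof -
  have "(inst (map Var [0..<m]) \<circ> up_ren m ((+) m) :: nat \<Rightarrow> 'a tm) = Var"
    by (auto simp: inst_def up_ren_def)
  then show ?thesis using assms
    by (simp add: meta_vars_def snd_weaken_abs subst_rename comp_def[of "msubst _"])
qed

lemma msubst_meta_vars:
  assumes "k < length th" "fst (th ! k) = m" "wf_tm S \<Theta> m (snd (th ! k))"
  shows "msubst th (meta_vars k m) = snd (th ! k)"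
  using assms(1,2) subst_id[OF assms(3), of "inst (map Var [0..<m])"]
  by (simp add: meta_vars_def comp_def inst_def)

text \<open>Every application of an operator is thus a metasubstitution instance of its generic
  application. This is how a compatible family of arrows is reduced to its values on
  operators.\<close>

lemma msubst_abs_id_abs: "map fst th = ms \<Longrightarrow> map (msubst_abs th) (id_abs ms) = th"
  by (intro nth_equalityI) (auto simp: msubst_abs_def msubst_weaken_meta_vars)

section \<open>Translations of terms\<close>

lemma wf_tm_mono_vars: "wf_tm S \<Theta> n t \<Longrightarrow> n \<le> p \<Longrightarrow> wf_tm S \<Theta> p t"
  using wf_rename[of S \<Theta> n t id p] rename_id[of S \<Theta> n t id] by simp

definition translate_abs :: "('o \<Rightarrow> 'p tm) \<Rightarrow> nat \<times> 'o tm \<Rightarrow> nat \<times> 'p tm" where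
  "translate_abs \<tau> = (\<lambda>(m, t). (m, translate \<tau> t))"

lemma fst_translate_abs [simp]: "fst (translate_abs \<tau> b) = fst b"
  by (simp add: translate_abs_def case_prod_unfold)

lemma snd_translate_abs [simp]: "snd (translate_abs \<tau> b) = translate \<tau> (snd b)"
  by (simp add: translate_abs_def case_prod_unfold)

lemma map_fst_translate_abs [simp]: "map (fst \<circ> translate_abs \<tau>) bs = map fst bs"
  by simp

lemma translate_Op: "translate \<tau> (Op f bs) = msubst (map (translate_abs \<tau>) bs) (\<tau> f)"
  by (simp add: translate_abs_def)

section \<open>Translation commutes with renaming, substitution and metasubstitution\<close>

context
  fixes S :: "'o signature" and S' :: "'p signature" and \<tau> :: "'o \<Rightarrow> 'p tm"
  assumes \<tau>: "is_sig_translation S S' \<tau>"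
begin

lemma wf_sig_translation: "f \<in> ops S \<Longrightarrow> wf_tm S' (arity S f) n (\<tau> f)"
  using \<tau> by (auto simp: is_sig_translation_def intro: wf_tm_mono_vars)

lemma wf_translate: "wf_tm S \<Theta> n t \<Longrightarrow> wf_tm S' \<Theta> n (translate \<tau> t)"
proof (induction t arbitrary: n rule: tm_induct)
  case (Op f bs)
  have "wf_abs S' \<Theta> n (translate_abs \<tau> b)" if "b \<in> set bs" for b
    using Op that by (cases b) (auto simp: wf_abs_def snds.simps)
  then show ?case
    using Op.prems wf_sig_translation unfolding translate_Op by (intro wf_msubst) force+
qed auto

lemma translate_rename:
  "wf_tm S \<Theta> n t \<Longrightarrow> translate \<tau> (rename r t) = rename r (translate \<tau> t)"
proof (induction t arbitrary: n r rule: tm_induct)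
  case (Op f bs)
  have f: "f \<in> ops S" "map fst bs = arity S f" using Op.prems by auto
  have "translate_abs \<tau> (subst_abs (Var \<circ> r) b) = subst_abs (Var \<circ> r) (translate_abs \<tau> b)"
    if "b \<in> set bs" for b
    using Op.IH[of "fst b" "snd b" "n + fst b"] Op.prems that
    by (cases b) (auto simp: translate_abs_def subst_abs_def up_subst_Var rename_eq_subst[symmetric])
  then have "map (translate_abs \<tau>) (map (subst_abs (Var \<circ> r)) bs)
      = map (subst_abs (Var \<circ> r)) (map (translate_abs \<tau>) bs)" by simp
  moreover have "rename r (Op f bs) = Op f (map (subst_abs (Var \<circ> r)) bs)"
    unfolding rename_eq_subst by (simp add: subst_abs_def)
  moreover have "rename r (\<tau> f) = \<tau> f"
    by (rule rename_id[OF wf_sig_translation[OF f(1), of 0]]) simp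
  ultimately show ?case
    using rename_msubst[of S' "map (translate_abs \<tau>) bs" 0 "\<tau> f" r] wf_sig_translation[OF f(1), of 0] f(2)
    unfolding translate_Op by (simp only: translate_Op map_map map_fst_translate_abs)
qed auto

lemma translate_up_subst:
  "wf_tm S \<Theta> n (\<sigma> (i - m)) \<Longrightarrow> translate \<tau> (up_subst m \<sigma> i) = up_subst m (\<lambda>j. translate \<tau> (\<sigma> j)) i"
  using translate_rename by (simp add: up_subst_def)

text \<open>In the \<open>Op\<close> case \<tau> f has no free variables, so the substitution
  reaches only the abstractions that replace its metavariables.\<close>

lemma translate_subst:
  "wf_tm S \<Theta> n t \<Longrightarrow> (\<And>i. i < n \<Longrightarrow> wf_tm S \<Theta>' p (\<sigma> i))
   \<Longrightarrow> translate \<tau> (subst \<sigma> t) = subst (\<lambda>i. translate \<tau> (\<sigma> i)) (translate \<tau> t)"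
proof (induction t arbitrary: n \<sigma> p rule: tm_induct)
  case (Meta k ts)
  have "translate \<tau> (subst \<sigma> t) = subst (\<lambda>i. translate \<tau> (\<sigma> i)) (translate \<tau> t)" if "t \<in> set ts" for t
    using Meta.prems that by (intro Meta.IH[OF that, of n p]) auto
  then show ?case by simp
next
  case (Op f bs)
  let ?\<sigma> = "\<lambda>i. translate \<tau> (\<sigma> i)"
  have f: "f \<in> ops S" "map fst bs = arity S f" using Op.prems by auto
  have "translate_abs \<tau> (subst_abs \<sigma> b) = subst_abs ?\<sigma> (translate_abs \<tau> b)" if b: "b \<in> set bs" for b
  proof -
    obtain m t where mt: "b = (m, t)" by (cases b)
    have t: "wf_tm S \<Theta> (n + m) t" using Op.prems(1) b mt by auto
    have "translate \<tau> (subst (up_subst m \<sigma>) t) = subst (\<lambda>i. translate \<tau> (up_subst m \<sigma> i)) (translate \<tau> t)"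
      using b mt Op.prems(2) t by (intro Op.IH[of m t "n + m" "p + m"] wf_up_subst[of n]) auto
    also have "\<dots> = subst (up_subst m ?\<sigma>) (translate \<tau> t)"
    proof (rule subst_cong[OF wf_translate[OF t]])
      fix i assume "i < n + m"
      then show "translate \<tau> (up_subst m \<sigma> i) = up_subst m ?\<sigma> i"
        using translate_up_subst[of \<Theta>' p \<sigma> i m, OF Op.prems(2)[of "i - m"]] by (cases "i < m") (auto simp: up_subst_def)
    qed
    finally show ?thesis by (simp add: mt translate_abs_def subst_abs_def)
  qed
  then have "map (translate_abs \<tau>) (map (subst_abs \<sigma>) bs) = map (subst_abs ?\<sigma>) (map (translate_abs \<tau>) bs)"
    by simp
  moreover have "subst \<sigma> (Op f bs) = Op f (map (subst_abs \<sigma>) bs)" by (simp add: subst_abs_def)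
  ultimately show ?case
    using subst_msubst_closed[of S' "map (translate_abs \<tau>) bs" 0 "\<tau> f" ?\<sigma>]
      wf_sig_translation[OF f(1), of 0] f(2)
    unfolding translate_Op by (simp only: translate_Op map_map map_fst_translate_abs)
qed auto

lemma translate_weaken_abs:
  "wf_abs S \<Theta> n b \<Longrightarrow> translate_abs \<tau> (weaken_abs m b) = weaken_abs m (translate_abs \<tau> b)"
  by (auto simp: translate_abs_def weaken_abs_def wf_abs_def translate_rename split: prod.splits)

text \<open>At an operator both sides are metasubstitutions into \<tau> f, and the claim becomes
  associativity of metasubstitution.\<close>

lemma translate_msubst:
  assumes "wf_tm S (map fst th) n t" "\<And>b. b \<in> set th \<Longrightarrow> wf_abs S \<Theta> n b"
  shows "translate \<tau> (msubst th t) = msubst (map (translate_abs \<tau>) th) (translate \<tau> t)"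
  using assms
proof (induction t arbitrary: n th rule: tm_induct)
  case (Meta k ts)
  let ?rs = "map (msubst th) ts"
  have k: "k < length th" "length ts = fst (th ! k)" using Meta.prems by auto
  have wk: "wf_tm S \<Theta> (n + length ts) (snd (th ! k))"
    using Meta.prems(2)[of "th ! k"] k by (simp add: wf_abs_def)
  have rs: "wf_tm S \<Theta> n r" if "r \<in> set ?rs" for r
    using that Meta.prems by (auto intro!: wf_msubst)
  have eq: "map (translate \<tau>) ?rs = map (msubst (map (translate_abs \<tau>) th)) (map (translate \<tau>) ts)"
    using Meta by auto
  have "translate \<tau> (subst (inst ?rs) (snd (th ! k)))
      = subst (\<lambda>i. translate \<tau> (inst ?rs i)) (translate \<tau> (snd (th ! k)))"
    using rs by (intro translate_subst[OF wk, of \<Theta> n] wf_inst) auto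
  also have "(\<lambda>i. translate \<tau> (inst ?rs i)) = inst (map (translate \<tau>) ?rs)"
    by (auto simp: inst_def)
  finally show ?case using k unfolding eq by simp
next
  case (Op f bs)
  have f: "f \<in> ops S" "map fst bs = arity S f" using Op.prems by auto
  have eq: "translate_abs \<tau> (msubst_abs th b) = msubst_abs (map (translate_abs \<tau>) th) (translate_abs \<tau> b)"
    if b: "b \<in> set bs" for b
  proof -
    obtain m t where mt: "b = (m, t)" by (cases b)
    have "translate \<tau> (msubst (map (weaken_abs m) th) t)
        = msubst (map (translate_abs \<tau>) (map (weaken_abs m) th)) (translate \<tau> t)"
    proof (rule Op.IH[of m t _ "n + m"])
      show "(m, t) \<in> set bs" using b mt by simp
      show "wf_tm S (map fst (map (weaken_abs m) th)) (n + m) t" using Op.prems b mt by auto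
    qed (use wf_map_weaken_abs Op.prems(2) in blast)
    also have "map (translate_abs \<tau>) (map (weaken_abs m) th) = map (weaken_abs m) (map (translate_abs \<tau>) th)"
      using translate_weaken_abs[OF Op.prems(2)] by auto
    finally show ?thesis by (simp add: mt translate_abs_def msubst_abs_def)
  qed
  have "translate \<tau> (msubst th (Op f bs)) = msubst (map (translate_abs \<tau>) (map (msubst_abs th) bs)) (\<tau> f)"
    by (simp only: msubst_Op translate_Op)
  also have "map (translate_abs \<tau>) (map (msubst_abs th) bs)
      = map (msubst_abs (map (translate_abs \<tau>) th)) (map (translate_abs \<tau>) bs)"
    using eq by simp
  also have "msubst \<dots> (\<tau> f) = msubst (map (translate_abs \<tau>) th) (msubst (map (translate_abs \<tau>) bs) (\<tau> f))"
  proof (rule msubst_msubst[symmetric])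
    show "wf_tm S' (map fst (map (translate_abs \<tau>) bs)) n (\<tau> f)"
      using wf_sig_translation f by simp
    show "wf_abs S' (map fst (map (translate_abs \<tau>) th)) n b"
      if b: "b \<in> set (map (translate_abs \<tau>) bs)" for b
    proof -
      obtain m t where "(m, t) \<in> set bs" "b = translate_abs \<tau> (m, t)" using b by auto
      then show ?thesis using Op.prems by (auto simp: wf_abs_def wf_translate)
    qed
  qed
  finally show ?case by (simp only: translate_Op)
qed auto

lemma translate_id_abs: "map (translate_abs \<tau>) (id_abs ms) = id_abs ms"
  by (auto simp: id_abs_def translate_abs_def meta_vars_def)

end

lemma translate_translate:
  assumes \<tau>: "is_sig_translation S S' \<tau>" and \<tau>': "is_sig_translation S' S'' \<tau>'"
  shows "wf_tm S \<Theta> n t \<Longrightarrow> translate \<tau>' (translate \<tau> t) = translate (comp_translation \<tau>' \<tau>) t"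
proof (induction t arbitrary: n rule: tm_induct)
  case (Op f bs)
  have "translate_abs \<tau>' (translate_abs \<tau> b) = translate_abs (comp_translation \<tau>' \<tau>) b" if "b \<in> set bs" for b
    using Op.IH[of "fst b" "snd b" "n + fst b"] Op.prems that by (cases b) (auto simp: translate_abs_def)
  then have "map (translate_abs \<tau>') (map (translate_abs \<tau>) bs) = map (translate_abs (comp_translation \<tau>' \<tau>)) bs"
    by simp
  moreover have "translate \<tau>' (msubst (map (translate_abs \<tau>) bs) (\<tau> f))
      = msubst (map (translate_abs \<tau>') (map (translate_abs \<tau>) bs)) (translate \<tau>' (\<tau> f))"
  proof (rule translate_msubst[OF \<tau>'])
    show "wf_tm S' (map fst (map (translate_abs \<tau>) bs)) n (\<tau> f)"
      using wf_sig_translation[OF \<tau>] Op.prems by simp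
    show "wf_abs S' \<Theta> n b" if b: "b \<in> set (map (translate_abs \<tau>) bs)" for b
    proof -
      obtain m t where "(m, t) \<in> set bs" "b = translate_abs \<tau> (m, t)" using b by auto
      then show ?thesis using Op.prems by (auto simp: wf_abs_def wf_translate[OF \<tau>])
    qed
  qed
  moreover have "translate \<tau>' (\<tau> f) = comp_translation \<tau>' \<tau> f" by (simp add: comp_translation_def)
  ultimately show ?case by (simp only: translate_Op)
qed auto

lemma is_sig_translation_comp:
  "is_sig_translation S S' \<tau> \<Longrightarrow> is_sig_translation S' S'' \<tau>' \<Longrightarrow> is_sig_translation S S'' (comp_translation \<tau>' \<tau>)"
  by (auto simp: is_sig_translation_def comp_translation_def intro!: wf_translate[of S' S'' \<tau>'] simp: is_sig_translation_def)

lemma id_translation_eq: "id_translation S f = Op f (id_abs (arity S f))"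
  by (simp add: id_translation_def id_abs_def)

lemma is_sig_translation_id: "is_sig_translation S S (id_translation S)"
  unfolding is_sig_translation_def id_translation_eq wf_tm.simps map_fst_id_abs
  using wf_id_abs[of _ _ S 0] by (fastforce simp: wf_abs_def)

lemma translate_id: "wf_tm S \<Theta> n t \<Longrightarrow> translate (id_translation S) t = t"
proof (induction t arbitrary: n rule: tm_induct)
  case (Meta k ts)
  then show ?case by (auto intro: map_idI)
next
  case (Op f bs)
  have "translate_abs (id_translation S) b = b" if "b \<in> set bs" for b
    using Op.IH[of "fst b" "snd b" "n + fst b"] Op.prems that by (cases b) (auto simp: translate_abs_def)
  then have "map (translate_abs (id_translation S)) bs = bs" by (rule map_idI)
  with Op.prems show ?case
    unfolding translate_Op wf_tm.simps by (simp only: id_translation_eq msubst_Op msubst_abs_id_abs)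
qed auto

section \<open>The category of presentations\<close>

lemma wf_tm_zip:
  assumes "length ss = length ms" "\<And>i. i < length ms \<Longrightarrow> wf_tm S \<Theta> (ms ! i + d) (ss ! i)" "b \<in> set (zip ms ss)"
  shows "wf_abs S \<Theta> d b"
proof -
  obtain i where "i < length ms" "b = (ms ! i, ss ! i)" using assms(1,3) by (auto simp: set_zip)
  then show ?thesis using assms(2)[of i] by (simp add: wf_abs_def add.commute)
qed

lemma derivable_wf:
  assumes P: "is_presentation P"
  shows "derivable P \<Theta> n s t \<Longrightarrow> wf_tm (sig P) \<Theta> n s \<and> wf_tm (sig P) \<Theta> n t"
proof (induction rule: derivable.induct)
  case (ax \<Theta> n s t)
  then show ?case using P by (auto simp: is_presentation_def)
next
  case (ext_msubst ms g s t ss ts \<Theta> d)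
  have "wf_tm (sig P) \<Theta> (g + d) (msubst (map (weaken_abs g) (zip ms us)) u)"
    if u: "wf_tm (sig P) ms g u" and len: "length us = length ms"
      and us: "\<And>i. i < length ms \<Longrightarrow> wf_tm (sig P) \<Theta> (ms ! i + d) (us ! i)" for u us
  proof (rule wf_msubst)
    show "wf_tm (sig P) (map fst (map (weaken_abs g) (zip ms us))) (g + d) u"
      using u len by (auto intro: wf_tm_mono_vars)
    show "wf_abs (sig P) \<Theta> (g + d) b" if "b \<in> set (map (weaken_abs g) (zip ms us))" for b
      using wf_map_weaken_abs[OF that, of "sig P" \<Theta> d] wf_tm_zip[OF len us]
      by (simp add: add.commute)
  qed
  then show ?case using ext_msubst by blast
qed auto

section \<open>Derived rules of second-order equational logic\<close>

lemma derivable_msubst_closed: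
  assumes "derivable P ms 0 s t" "length ss = length ms" "length ts = length ms"
    "\<And>i. i < length ms \<Longrightarrow> derivable P \<Theta> (ms ! i + d) (ss ! i) (ts ! i)"
  shows "derivable P \<Theta> d (msubst (zip ms ss) s) (msubst (zip ms ts) t)"
proof -
  have "map (weaken_abs 0) th = th" for th :: "(nat \<times> 'a tm) list" by (rule map_idI) simp
  then show ?thesis using derivable.ext_msubst[OF assms(1-3), of \<Theta> d] assms(4) by simp
qed

lemma weaken_abs_closed: "wf_abs S \<Theta> 0 b \<Longrightarrow> weaken_abs n b = b"
  using subst_abs_cong[of S \<Theta> 0 b "Var \<circ> (+) n" Var] by (simp add: weaken_abs_eq)

text \<open>The extreme case of \<open>ext_msubst\<close> in which \<Delta> is empty: an abstraction
  without free variables is unchanged by weakening. The previous rule is the other extreme, with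
  \<Gamma> empty.\<close>

lemma derivable_msubst:
  assumes P: "is_presentation P"
    and st: "derivable P ms g s t" "length ss = length ms" "length ts = length ms"
    and a: "\<And>i. i < length ms \<Longrightarrow> derivable P \<Theta> (ms ! i) (ss ! i) (ts ! i)"
  shows "derivable P \<Theta> g (msubst (zip ms ss) s) (msubst (zip ms ts) t)"
proof -
  have "weaken_abs g b = b" if "b \<in> set (zip ms ss) \<or> b \<in> set (zip ms ts)" for b
    using that derivable_wf[OF P a]
    by (intro weaken_abs_closed[of "sig P" \<Theta>]) (auto intro!: wf_tm_zip[of _ ms] simp: st)
  then have "map (weaken_abs g) (zip ms ss) = zip ms ss" "map (weaken_abs g) (zip ms ts) = zip ms ts"
    by (auto intro: map_idI)
  then show ?thesis using derivable.ext_msubst[OF st, of \<Theta> 0] a by simp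
qed

text \<open>The application of the abstraction in position \<open>0\<close> to the closed terms in positions
  \<open>1, \<dots>, a\<close>; under metasubstitution it turns into a substitution.\<close>

definition app_tm :: "nat \<Rightarrow> 'o tm" where
  "app_tm a = Meta 0 (map (\<lambda>j. Meta (Suc j) []) [0..<a])"

lemma wf_app_tm: "wf_tm S (a # replicate a 0) n (app_tm a)"
  by (auto simp: app_tm_def)

lemma inst_Nil [simp]: "inst [] = Var"
  by (auto simp: inst_def)

lemma msubst_app_tm:
  assumes "length ts = a"
  shows "msubst (zip (a # replicate a 0) (u # ts)) (app_tm a) = subst (inst ts) u"
proof -
  have "map (msubst (zip (a # replicate a 0) (u # ts))) (map (\<lambda>j. Meta (Suc j) []) [0..<a]) = ts"
    using assms by (auto intro: nth_equalityI)
  then show ?thesis by (simp add: app_tm_def del: map_map)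
qed

text \<open>Congruence for metavariables is not among the rules. It is \<open>ext_msubst\<close>
  applied to reflexivity of \<open>app_tm\<close>: the first metavariable receives
  \<open>meta_vars\<close>, the nullary ones receive the arguments.\<close>

lemma derivable_Meta:
  assumes "k < length \<Theta>" "length ts = \<Theta> ! k" "length ts' = \<Theta> ! k"
    "\<And>j. j < \<Theta> ! k \<Longrightarrow> derivable P \<Theta> n (ts ! j) (ts' ! j)"
  shows "derivable P \<Theta> n (Meta k ts) (Meta k ts')"
proof -
  let ?a = "\<Theta> ! k"
  have "derivable P \<Theta> n
      (msubst (zip (?a # replicate ?a 0) (meta_vars k ?a # ts)) (app_tm ?a))
      (msubst (zip (?a # replicate ?a 0) (meta_vars k ?a # ts')) (app_tm ?a))"
  proof (rule derivable_msubst_closed[OF derivable.refl[OF wf_app_tm]])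
    fix i assume "i < length (?a # replicate ?a 0)"
    then show "derivable P \<Theta> ((?a # replicate ?a 0) ! i + n) ((meta_vars k ?a # ts) ! i) ((meta_vars k ?a # ts') ! i)"
      using assms by (cases i) (auto intro!: derivable.refl wf_meta_vars)
  qed (use assms in auto)
  then show ?thesis using assms by (simp only: msubst_app_tm subst_meta_vars map_inst)
qed

lemma syntactic_translationsD:
  "\<tau> \<in> syntactic_translations P Q \<Longrightarrow> is_sig_translation (sig P) (sig Q) \<tau>"
  by (simp add: syntactic_translations_def)

text \<open>Preservation of axioms extends to all derivations because translation turns an instance
  of \<open>ext_msubst\<close> into another instance of it.\<close>

lemma derivable_translate:
  assumes P: "is_presentation P" and \<tau>: "\<tau> \<in> syntactic_translations P Q"
  shows "derivable P \<Theta> n s t \<Longrightarrow> derivable Q \<Theta> n (translate \<tau> s) (translate \<tau> t)"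
proof (induction rule: derivable.induct)
  case (ax \<Theta> n s t)
  then show ?case using \<tau> by (auto simp: syntactic_translations_def)
next
  case (refl \<Theta> n t)
  then show ?case by (intro derivable.refl wf_translate[OF syntactic_translationsD[OF \<tau>]])
next
  case (sym \<Theta> n s t)
  then show ?case by (blast intro: derivable.sym)
next
  case (trans \<Theta> n s t u)
  then show ?case by (blast intro: derivable.trans)
next
  case (ext_msubst ms g s t ss ts \<Theta> d)
  note \<tau>' = syntactic_translationsD[OF \<tau>]
  have eq: "translate \<tau> (msubst (map (weaken_abs g) (zip ms us)) u)
      = msubst (map (weaken_abs g) (zip ms (map (translate \<tau>) us))) (translate \<tau> u)"
    if u: "wf_tm (sig P) ms g u" and len: "length us = length ms"
      and us: "\<And>i. i < length ms \<Longrightarrow> wf_tm (sig P) \<Theta> (ms ! i + d) (us ! i)" for u us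
  proof -
    have wfz: "wf_abs (sig P) \<Theta> d b" if "b \<in> set (zip ms us)" for b
      using wf_tm_zip[OF len us that] by simp
    have "translate \<tau> (msubst (map (weaken_abs g) (zip ms us)) u)
        = msubst (map (translate_abs \<tau>) (map (weaken_abs g) (zip ms us))) (translate \<tau> u)"
    proof (rule translate_msubst[OF \<tau>', of _ "d + g" _ \<Theta>])
      show "wf_tm (sig P) (map fst (map (weaken_abs g) (zip ms us))) (d + g) u"
        using u len by (auto intro: wf_tm_mono_vars)
    qed (use wf_map_weaken_abs wfz in blast)
    also have "map (translate_abs \<tau>) (map (weaken_abs g) (zip ms us))
        = map (weaken_abs g) (map (translate_abs \<tau>) (zip ms us))"
      using translate_weaken_abs[OF \<tau>' wfz] by auto
    also have "map (translate_abs \<tau>) (zip ms us) = zip ms (map (translate \<tau>) us)"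
      by (simp add: translate_abs_def zip_map2)
    finally show ?thesis .
  qed
  have "wf_tm (sig P) ms g s" "wf_tm (sig P) ms g t"
    "\<And>i. i < length ms \<Longrightarrow> wf_tm (sig P) \<Theta> (ms ! i + d) (ss ! i)"
    "\<And>i. i < length ms \<Longrightarrow> wf_tm (sig P) \<Theta> (ms ! i + d) (ts ! i)"
    using derivable_wf[OF P] ext_msubst by blast+
  then show ?case
    using ext_msubst by (simp only: eq) (auto intro!: derivable.ext_msubst)
qed

text \<open>At an operator one use of \<open>ext_msubst\<close> replaces \<tau> f and all translated
  arguments at once; \<Gamma> is empty there, and the free variables form \<Delta>.\<close>

lemma translate_cong:
  assumes \<tau>: "is_sig_translation (sig P) (sig Q) \<tau>"
    and eq: "\<And>f. f \<in> ops (sig P) \<Longrightarrow> derivable Q (arity (sig P) f) 0 (\<tau> f) (\<tau>' f)"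
  shows "wf_tm (sig P) \<Theta> n t \<Longrightarrow> derivable Q \<Theta> n (translate \<tau> t) (translate \<tau>' t)"
proof (induction t arbitrary: n rule: tm_induct)
  case (Var i)
  then show ?case by (auto intro: derivable.refl)
next
  case (Meta k ts)
  then show ?case by (auto intro!: derivable_Meta)
next
  case (Op f bs)
  have f: "f \<in> ops (sig P)" "map fst bs = arity (sig P) f" using Op.prems by auto
  have z: "map (translate_abs \<rho>) bs = zip (arity (sig P) f) (map (translate \<rho> \<circ> snd) bs)" for \<rho> :: "'a \<Rightarrow> 'b tm"
    by (rule nth_equalityI) (auto simp: f(2)[symmetric] prod_eq_iff)
  show ?case
    unfolding translate_Op z
  proof (rule derivable_msubst_closed[OF eq[OF f(1)]])
    fix i assume "i < length (arity (sig P) f)"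
    then have i: "i < length bs" by (simp add: f(2)[symmetric])
    then have "bs ! i \<in> set bs" by simp
    then have "derivable Q \<Theta> (n + fst (bs ! i)) (translate \<tau> (snd (bs ! i))) (translate \<tau>' (snd (bs ! i)))"
      using Op.prems by (intro Op.IH[of "fst (bs ! i)"]) (auto simp: case_prod_unfold)
    then show "derivable Q \<Theta> (arity (sig P) f ! i + n) (map (translate \<tau> \<circ> snd) bs ! i) (map (translate \<tau>' \<circ> snd) bs ! i)"
      using i by (simp add: f(2)[symmetric] add.commute)
  qed (simp_all add: f(2)[symmetric])
qed

section \<open>Classes of translations and their composition\<close>

lemma equiv_translation_eq: "equiv (syntactic_translations P Q) (translation_eq P Q)"
proof (rule equivI)
  show "refl_on (syntactic_translations P Q) (translation_eq P Q)"
    by (auto simp: refl_on_def translation_eq_def intro!: derivable.refl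
        dest!: syntactic_translationsD simp: is_sig_translation_def)
  show "sym (translation_eq P Q)"
    by (auto simp: sym_def translation_eq_def intro: derivable.sym)
  show "trans (translation_eq P Q)"
    unfolding trans_def translation_eq_def by (blast intro: derivable.trans)
qed (auto simp: translation_eq_def)

definition tr_class :: "'u presentation \<Rightarrow> 'u presentation \<Rightarrow> ('u \<Rightarrow> 'u tm) \<Rightarrow> ('u \<Rightarrow> 'u tm) set" where
  "tr_class P Q \<tau> = translation_eq P Q `` {\<tau>}"

lemma SOEP_Obj: "P \<in> Obj SOEP \<longleftrightarrow> is_presentation P"
  by (simp add: SOEP_def)

lemma SOEP_Hom: "Hom SOEP P Q = tr_class P Q ` syntactic_translations P Q"
  by (auto simp: SOEP_def tr_class_def quotient_def)

lemma tr_class_eq_iff: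
  "\<tau> \<in> syntactic_translations P Q \<Longrightarrow> \<tau>' \<in> syntactic_translations P Q \<Longrightarrow>
   tr_class P Q \<tau> = tr_class P Q \<tau>' \<longleftrightarrow> (\<forall>f\<in>ops (sig P). derivable Q (arity (sig P) f) 0 (\<tau> f) (\<tau>' f))"
  unfolding tr_class_def eq_equiv_class_iff[OF equiv_translation_eq]
  by (simp add: translation_eq_def)

lemma tr_class_mem:
  "\<tau>' \<in> tr_class P Q \<tau> \<longleftrightarrow> \<tau> \<in> syntactic_translations P Q \<and> \<tau>' \<in> syntactic_translations P Q
     \<and> (\<forall>f\<in>ops (sig P). derivable Q (arity (sig P) f) 0 (\<tau> f) (\<tau>' f))"
  by (simp add: tr_class_def translation_eq_def)

lemma tr_class_eqI:
  "\<tau> \<in> syntactic_translations P Q \<Longrightarrow> \<tau>' \<in> syntactic_translations P Q \<Longrightarrow>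
   (\<And>f. f \<in> ops (sig P) \<Longrightarrow> \<tau> f = \<tau>' f) \<Longrightarrow> tr_class P Q \<tau> = tr_class P Q \<tau>'"
  using syntactic_translationsD[of \<tau>' P Q]
  by (auto simp: tr_class_eq_iff is_sig_translation_def intro: derivable.refl)

lemma syntactic_translations_comp:
  assumes P: "is_presentation P" and Q: "is_presentation Q"
    and \<tau>: "\<tau> \<in> syntactic_translations P Q" and \<tau>': "\<tau>' \<in> syntactic_translations Q R"
  shows "comp_translation \<tau>' \<tau> \<in> syntactic_translations P R"
proof -
  note t = syntactic_translationsD[OF \<tau>] and t' = syntactic_translationsD[OF \<tau>']
  have "derivable R \<Theta> n (translate (comp_translation \<tau>' \<tau>) s) (translate (comp_translation \<tau>' \<tau>) u)"
    if a: "(\<Theta>, n, s, u) \<in> axs P" for \<Theta> n s u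
  proof -
    have "wf_tm (sig P) \<Theta> n s" "wf_tm (sig P) \<Theta> n u" using P a by (auto simp: is_presentation_def)
    then show ?thesis
      using derivable_translate[OF Q \<tau>' derivable_translate[OF P \<tau> derivable.ax[OF a]]]
      by (simp add: translate_translate[OF t t'])
  qed
  then show ?thesis using is_sig_translation_comp[OF t t'] by (auto simp: syntactic_translations_def)
qed

lemma syntactic_translations_id:
  assumes P: "is_presentation P"
  shows "id_translation (sig P) \<in> syntactic_translations P P"
  using P derivable.ax[of _ _ _ _ P] is_sig_translation_id[of "sig P"]
  by (fastforce simp: syntactic_translations_def is_presentation_def translate_id)

lemma SOEP_Id: "Id SOEP P = tr_class P P (id_translation (sig P))"
  by (simp add: SOEP_def tr_class_def)

text \<open>Composition is a union over all representatives, so it must be shown to be constant: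
  \<open>translate_cong\<close> changes the second translation, \<open>derivable_translate\<close>
  the first.\<close>

lemma SOEP_Comp:
  assumes P: "is_presentation P" and Q: "is_presentation Q"
    and \<tau>: "\<tau> \<in> syntactic_translations P Q" and \<tau>': "\<tau>' \<in> syntactic_translations Q R"
  shows "Comp SOEP P Q R (tr_class Q R \<tau>') (tr_class P Q \<tau>) = tr_class P R (comp_translation \<tau>' \<tau>)"
proof -
  have "tr_class P R (comp_translation \<rho>' \<rho>) = tr_class P R (comp_translation \<tau>' \<tau>)"
    if r: "\<rho> \<in> tr_class P Q \<tau>" and r': "\<rho>' \<in> tr_class Q R \<tau>'" for \<rho> \<rho>'
  proof -
    have \<rho>: "\<rho> \<in> syntactic_translations P Q" "\<And>f. f \<in> ops (sig P) \<Longrightarrow> derivable Q (arity (sig P) f) 0 (\<tau> f) (\<rho> f)"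
      and \<rho>': "\<rho>' \<in> syntactic_translations Q R" "\<And>f. f \<in> ops (sig Q) \<Longrightarrow> derivable R (arity (sig Q) f) 0 (\<tau>' f) (\<rho>' f)"
      using r r' unfolding tr_class_mem by auto
    have "derivable R (arity (sig P) f) 0 (translate \<tau>' (\<tau> f)) (translate \<rho>' (\<rho> f))" if "f \<in> ops (sig P)" for f
    proof (rule derivable.trans)
      show "derivable R (arity (sig P) f) 0 (translate \<tau>' (\<tau> f)) (translate \<rho>' (\<tau> f))"
        using syntactic_translationsD[OF \<tau>] that
        by (intro translate_cong[OF syntactic_translationsD[OF \<tau>'] \<rho>'(2)]) (auto simp: is_sig_translation_def)
      show "derivable R (arity (sig P) f) 0 (translate \<rho>' (\<tau> f)) (translate \<rho>' (\<rho> f))"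
        by (rule derivable_translate[OF Q \<rho>'(1) \<rho>(2)[OF that]])
    qed
    then show ?thesis
      using syntactic_translations_comp[OF P Q \<tau> \<tau>'] syntactic_translations_comp[OF P Q \<rho>(1) \<rho>'(1)]
      by (subst HOL.eq_commute) (simp add: tr_class_eq_iff comp_translation_def)
  qed
  moreover have "\<tau> \<in> tr_class P Q \<tau>" "\<tau>' \<in> tr_class Q R \<tau>'"
    using equiv_class_self[OF equiv_translation_eq \<tau>] equiv_class_self[OF equiv_translation_eq \<tau>']
    by (auto simp: tr_class_def)
  ultimately have "(\<Union>\<rho>\<in>tr_class P Q \<tau>. \<Union>\<rho>'\<in>tr_class Q R \<tau>'. tr_class P R (comp_translation \<rho>' \<rho>))
      = tr_class P R (comp_translation \<tau>' \<tau>)" by blast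
  then show ?thesis by (simp add: SOEP_def tr_class_def)
qed

lemma is_category_SOEP: "is_category (SOEP :: ('u presentation, ('u \<Rightarrow> 'u tm) set) category)"
  unfolding is_category_def
proof (intro conjI ballI)
  fix P Q R S :: "'u presentation"
  assume "P \<in> Obj SOEP" "Q \<in> Obj SOEP" "R \<in> Obj SOEP" "S \<in> Obj SOEP"
  then have P: "is_presentation P" and Q: "is_presentation Q" and R: "is_presentation R" and S: "is_presentation S"
    by (simp_all add: SOEP_Obj)
  show "Id SOEP P \<in> Hom SOEP P P"
    using syntactic_translations_id[OF P] by (simp add: SOEP_Id SOEP_Hom)
  fix f assume "f \<in> Hom SOEP P Q"
  then obtain \<tau> where \<tau>: "\<tau> \<in> syntactic_translations P Q" and f: "f = tr_class P Q \<tau>"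
    by (auto simp: SOEP_Hom)
  note t = syntactic_translationsD[OF \<tau>]
  have "comp_translation \<tau> (id_translation (sig P)) h = \<tau> h" if "h \<in> ops (sig P)" for h
  proof -
    have "wf_tm (sig Q) (arity (sig P) h) 0 (\<tau> h)" using t that by (simp add: is_sig_translation_def)
    then show ?thesis
      unfolding comp_translation_def id_translation_eq translate_Op translate_id_abs[OF t] by (rule msubst_id)
  qed
  then show "Comp SOEP P P Q f (Id SOEP P) = f"
    unfolding f SOEP_Id SOEP_Comp[OF P P syntactic_translations_id[OF P] \<tau>]
    by (intro tr_class_eqI syntactic_translations_comp[OF P P] syntactic_translations_id P \<tau>)
  have "comp_translation (id_translation (sig Q)) \<tau> h = \<tau> h" if "h \<in> ops (sig P)" for h
    using t that unfolding comp_translation_def is_sig_translation_def by (blast intro: translate_id)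
  then show "Comp SOEP P Q Q (Id SOEP Q) f = f"
    unfolding f SOEP_Id SOEP_Comp[OF P Q \<tau> syntactic_translations_id[OF Q]]
    by (intro tr_class_eqI syntactic_translations_comp[OF P Q] syntactic_translations_id Q \<tau>)
  fix g assume "g \<in> Hom SOEP Q R"
  then obtain \<tau>' where \<tau>': "\<tau>' \<in> syntactic_translations Q R" and g: "g = tr_class Q R \<tau>'"
    by (auto simp: SOEP_Hom)
  have gf: "Comp SOEP P Q R g f = tr_class P R (comp_translation \<tau>' \<tau>)"
    unfolding f g by (rule SOEP_Comp[OF P Q \<tau> \<tau>'])
  then show "Comp SOEP P Q R g f \<in> Hom SOEP P R"
    using syntactic_translations_comp[OF P Q \<tau> \<tau>'] by (auto simp: SOEP_Hom)
  fix h assume "h \<in> Hom SOEP R S"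
  then obtain \<tau>'' where \<tau>'': "\<tau>'' \<in> syntactic_translations R S" and h: "h = tr_class R S \<tau>''"
    by (auto simp: SOEP_Hom)
  note c = syntactic_translations_comp
  have "tr_class P S (comp_translation \<tau>'' (comp_translation \<tau>' \<tau>)) = tr_class P S (comp_translation (comp_translation \<tau>'' \<tau>') \<tau>)"
  proof (rule tr_class_eqI)
    fix x assume "x \<in> ops (sig P)"
    then have "wf_tm (sig Q) (arity (sig P) x) 0 (\<tau> x)" using t by (simp add: is_sig_translation_def)
    then show "comp_translation \<tau>'' (comp_translation \<tau>' \<tau>) x = comp_translation (comp_translation \<tau>'' \<tau>') \<tau> x"
      using translate_translate[OF syntactic_translationsD[OF \<tau>'] syntactic_translationsD[OF \<tau>'']]
      by (simp add: comp_translation_def[of _ \<tau>] comp_translation_def[of _ "comp_translation \<tau>' \<tau>"])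
  qed (intro c[OF P R] c[OF P Q] c[OF Q R] \<tau> \<tau>' \<tau>'')+
  then show "Comp SOEP P R S h (Comp SOEP P Q R g f) = Comp SOEP P Q S (Comp SOEP Q R S h g) f"
    unfolding gf unfolding f g h SOEP_Comp[OF Q R \<tau>' \<tau>''] SOEP_Comp[OF P R c[OF P Q \<tau> \<tau>'] \<tau>'']
      SOEP_Comp[OF P Q \<tau> c[OF Q R \<tau>' \<tau>'']] .
qed

section \<open>The category of theories\<close>

lemma fobj_comp_functor: "X \<in> Obj C \<Longrightarrow> fobj (comp_functor C G F) X = fobj G (fobj F X)"
  by (simp add: comp_functor_def compose_def)

lemma farr_comp_functor:
  "X \<in> Obj C \<Longrightarrow> Y \<in> Obj C \<Longrightarrow> f \<in> Hom C X Y
   \<Longrightarrow> farr (comp_functor C G F) X Y f = farr G (fobj F X) (fobj F Y) (farr F X Y f)"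
  by (simp add: comp_functor_def compose_def)

lemma comp_functor_assoc:
  assumes F: "is_functor A B F" and G: "is_functor B C G" and H: "is_functor C D H"
  shows "comp_functor A H (comp_functor A G F) = comp_functor A (comp_functor B H G) F"
  by (rule functor_eqI[OF is_functor_comp[OF is_functor_comp[OF F G] H] is_functor_comp[OF F is_functor_comp[OF G H]]])
    (simp_all add: fobj_comp_functor farr_comp_functor fun_obj[OF F] fun_arr[OF F])

lemma comp_functor_id_left:
  assumes F: "is_functor A B F"
  shows "comp_functor A (id_functor B) F = F"
proof -
  have B: "is_category B" using fun_cats[OF F] by simp
  show ?thesis
    by (rule functor_eqI[OF is_functor_comp[OF F is_functor_id[OF B]] F])
      (simp_all add: fobj_comp_functor farr_comp_functor id_functor_def fun_obj[OF F] fun_arr[OF F])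
qed

lemma comp_functor_id_right:
  assumes F: "is_functor A B F"
  shows "comp_functor A F (id_functor A) = F"
proof -
  have A: "is_category A" using fun_cats[OF F] by simp
  show ?thesis
    by (rule functor_eqI[OF is_functor_comp[OF is_functor_id[OF A] F] F])
      (simp_all add: fobj_comp_functor farr_comp_functor id_functor_def)
qed

lemma so_theory_functor: "is_so_theory T \<Longrightarrow> is_functor M_cat (tcat T) (tfun T)"
  by (simp add: is_so_theory_def is_strict_cartesian_functor_def)

lemma algebraic_translationsD:
  "F \<in> algebraic_translations T T' \<Longrightarrow> is_functor (tcat T) (tcat T') F"
  "F \<in> algebraic_translations T T' \<Longrightarrow> comp_functor M_cat F (tfun T) = tfun T'"
  by (simp_all add: algebraic_translations_def)

lemma algebraic_translations_id:
  "is_so_theory T \<Longrightarrow> id_functor (tcat T) \<in> algebraic_translations T T"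
  using so_theory_functor[of T] fun_cats[of M_cat "tcat T" "tfun T"]
  by (simp add: algebraic_translations_def is_functor_id comp_functor_id_left)

lemma algebraic_translations_comp:
  assumes T: "is_so_theory T"
    and F: "F \<in> algebraic_translations T T'" and G: "G \<in> algebraic_translations T' T''"
  shows "comp_functor (tcat T) G F \<in> algebraic_translations T T''"
  using algebraic_translationsD[OF F] algebraic_translationsD[OF G]
    comp_functor_assoc[OF so_theory_functor[OF T] algebraic_translationsD(1)[OF F] algebraic_translationsD(1)[OF G]]
  by (simp add: algebraic_translations_def is_functor_comp)

lemma is_category_SOAT: "is_category SOAT"
  unfolding is_category_def
proof (intro conjI ballI)
  fix T T' T'' T''' :: "'a so_theory"
  assume "T \<in> Obj SOAT" "T' \<in> Obj SOAT" "T'' \<in> Obj SOAT" "T''' \<in> Obj SOAT"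
  then have T: "is_so_theory T" and T': "is_so_theory T'" by (simp_all add: SOAT_def)
  show "Id SOAT T \<in> Hom SOAT T T"
    using algebraic_translations_id[OF T] by (simp add: SOAT_def)
  fix F assume "F \<in> Hom SOAT T T'"
  then have F: "F \<in> algebraic_translations T T'" by (simp add: SOAT_def)
  show "Comp SOAT T T T' F (Id SOAT T) = F" "Comp SOAT T T' T' (Id SOAT T') F = F"
    using algebraic_translationsD(1)[OF F] by (simp_all add: SOAT_def comp_functor_id_left comp_functor_id_right)
  fix G assume "G \<in> Hom SOAT T' T''"
  then have G: "G \<in> algebraic_translations T' T''" by (simp add: SOAT_def)
  show "Comp SOAT T T' T'' G F \<in> Hom SOAT T T''"
    using algebraic_translations_comp[OF T F G] by (simp add: SOAT_def)
  fix H assume "H \<in> Hom SOAT T'' T'''"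
  then have H: "H \<in> algebraic_translations T'' T'''" by (simp add: SOAT_def)
  show "Comp SOAT T T'' T''' H (Comp SOAT T T' T'' G F) = Comp SOAT T T' T''' (Comp SOAT T' T'' T''' H G) F"
    using comp_functor_assoc[OF algebraic_translationsD(1)[OF F] algebraic_translationsD(1)[OF G]
        algebraic_translationsD(1)[OF H]]
    by (simp add: SOAT_def)
qed

section \<open>Categories of tuples of terms\<close>

text \<open>For the empty signature these are the arrows of \<M>; for the signature of a
  presentation they represent the arrows of its theory.\<close>

definition tuples :: "'o signature \<Rightarrow> nat list \<Rightarrow> nat list \<Rightarrow> 'o tm list set" where
  "tuples S ms ns = {ts. length ts = length ns \<and> (\<forall>i<length ns. wf_tm S ms (ns ! i) (ts ! i))}"

definition ids :: "nat list \<Rightarrow> 'o tm list" where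
  "ids ms = map (\<lambda>i. meta_vars i (ms ! i)) [0..<length ms]"

lemma length_ids [simp]: "length (ids ms) = length ms"
  by (simp add: ids_def)

lemma nth_ids [simp]: "i < length ms \<Longrightarrow> ids ms ! i = meta_vars i (ms ! i)"
  by (simp add: ids_def)

lemma zip_ids: "zip ms (ids ms) = id_abs ms"
  by (rule nth_equalityI) auto

lemma tuplesI:
  "length ts = length ns \<Longrightarrow> (\<And>i. i < length ns \<Longrightarrow> wf_tm S ms (ns ! i) (ts ! i)) \<Longrightarrow> ts \<in> tuples S ms ns"
  by (simp add: tuples_def)

lemma tuples_length: "ts \<in> tuples S ms ns \<Longrightarrow> length ts = length ns"
  by (simp add: tuples_def)

lemma tuples_wf: "ts \<in> tuples S ms ns \<Longrightarrow> i < length ns \<Longrightarrow> wf_tm S ms (ns ! i) (ts ! i)"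
  by (simp add: tuples_def)

lemma ids_tuples: "ids ms \<in> tuples S ms ms"
  by (auto intro!: tuplesI wf_meta_vars)

lemma map_fst_zip_tuples: "ss \<in> tuples S ls ms \<Longrightarrow> map fst (zip ms ss) = ms"
  by (simp add: tuples_length)

lemma zip_tuples_wf: "ss \<in> tuples S ls ms \<Longrightarrow> b \<in> set (zip ms ss) \<Longrightarrow> wf_abs S ls 0 b"
  by (auto intro!: wf_tm_zip[of ss ms] simp: tuples_length tuples_wf)

lemma wf_abs_closed: "wf_abs S \<Theta> 0 b \<Longrightarrow> wf_abs S \<Theta> n b"
  unfolding wf_abs_def by (rule wf_tm_mono_vars) auto

lemma wf_msubst_tuples:
  "ss \<in> tuples S ls ms \<Longrightarrow> wf_tm S ms n t \<Longrightarrow> wf_tm S ls n (msubst (zip ms ss) t)"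
  using wf_abs_closed[OF zip_tuples_wf]
  by (intro wf_msubst) (simp only: map_fst_zip_tuples, blast)

lemma map_msubst_tuples:
  "ss \<in> tuples S ls ms \<Longrightarrow> ts \<in> tuples S ms ns \<Longrightarrow> map (msubst (zip ms ss)) ts \<in> tuples S ls ns"
  by (auto intro!: tuplesI wf_msubst_tuples simp: tuples_length tuples_wf)

lemma map_weaken_zip_tuples: "ss \<in> tuples S ls ms \<Longrightarrow> map (weaken_abs n) (zip ms ss) = zip ms ss"
  by (intro map_idI weaken_abs_closed zip_tuples_wf)

lemma msubst_msubst_tuples:
  assumes rs: "rs \<in> tuples S ks ls" and ss: "ss \<in> tuples S ls ms" and t: "wf_tm S ms n t"
  shows "msubst (zip ls rs) (msubst (zip ms ss) t) = msubst (zip ms (map (msubst (zip ls rs)) ss)) t"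
proof -
  have "msubst (zip ls rs) (msubst (zip ms ss) t) = msubst (map (msubst_abs (zip ls rs)) (zip ms ss)) t"
  proof (rule msubst_msubst[of S _ n])
    show "wf_tm S (map fst (zip ms ss)) n t" using t by (simp only: map_fst_zip_tuples[OF ss])
    show "wf_abs S (map fst (zip ls rs)) n b" if "b \<in> set (zip ms ss)" for b
      using wf_abs_closed[OF zip_tuples_wf[OF ss that]] by (simp only: map_fst_zip_tuples[OF rs])
  qed
  also have "map (msubst_abs (zip ls rs)) (zip ms ss) = zip ms (map (msubst (zip ls rs)) ss)"
    by (simp add: msubst_abs_def map_weaken_zip_tuples[OF rs] zip_map2)
  finally show ?thesis .
qed

section \<open>Projections, pairing and the exponential transpose on tuples\<close>

lemma wf_tm_append_ctx: "wf_tm S \<Theta> n t \<Longrightarrow> wf_tm S (\<Theta> @ \<Theta>') n t"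
proof (induction t arbitrary: n rule: tm_induct)
  case (Op f bs)
  then show ?case by (auto simp: case_prod_unfold)
qed (auto simp: nth_append)

lemma msubst_id_append: "wf_tm S ms n t \<Longrightarrow> msubst (id_abs ms @ th) t = t"
proof (induction t arbitrary: n th rule: tm_induct)
  case (Meta k ts)
  then have "msubst (id_abs ms @ th) t = t" if "t \<in> set ts" for t
    using that by (intro Meta.IH[of t n]) auto
  then have "map (msubst (id_abs ms @ th)) ts = ts" by (rule map_idI)
  with Meta.prems show ?case by (simp add: nth_append subst_meta_vars map_inst)
next
  case (Op f bs)
  then have "msubst (map (weaken_abs m) (id_abs ms @ th)) t = t" if "(m, t) \<in> set bs" for m t
    using that Op.IH[OF that, of "n + m" "map (weaken_abs m) th"] by auto
  then show ?case by (simp only: msubst.simps map_binders_id)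
qed auto

lemma msubst_proj1:
  assumes "ss \<in> tuples S Z X"
  shows "map (msubst (zip (X @ Y) (ss @ ts))) (ids X) = ss"
proof (rule nth_equalityI)
  fix i assume "i < length (map (msubst (zip (X @ Y) (ss @ ts))) (ids X))"
  then show "map (msubst (zip (X @ Y) (ss @ ts))) (ids X) ! i = ss ! i"
    using assms msubst_meta_vars[of i "zip (X @ Y) (ss @ ts)" "X ! i" S Z]
    by (simp add: tuples_length tuples_wf nth_append)
qed (use assms in \<open>simp add: tuples_length\<close>)

lemma proj1_M_cart: "proj1 M_cart X Y = ids X"
  by (simp add: M_cart_def ids_def)

lemma msubst_proj2:
  assumes "ss \<in> tuples S Z X" "ts \<in> tuples S Z Y"
  shows "map (msubst (zip (X @ Y) (ss @ ts))) (proj2 M_cart X Y) = ts"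
proof (rule nth_equalityI)
  fix i assume "i < length (map (msubst (zip (X @ Y) (ss @ ts))) (proj2 M_cart X Y :: 'a tm list))"
  then show "map (msubst (zip (X @ Y) (ss @ ts))) (proj2 M_cart X Y) ! i = ts ! i"
    using assms msubst_meta_vars[of "length X + i" "zip (X @ Y) (ss @ ts)" "Y ! i" S Z]
    by (simp add: tuples_length tuples_wf nth_append M_cart_def)
qed (use assms in \<open>simp add: tuples_length M_cart_def\<close>)

lemma proj1_tuples: "proj1 M_cart X Y \<in> tuples S (X @ Y) X"
  by (auto intro!: tuplesI wf_meta_vars simp: M_cart_def nth_append)

lemma proj2_tuples: "proj2 M_cart X Y \<in> tuples S (X @ Y) Y"
  by (auto intro!: tuplesI wf_meta_vars simp: M_cart_def nth_append)

lemma append_tuples: "ss \<in> tuples S Z X \<Longrightarrow> ts \<in> tuples S Z Y \<Longrightarrow> ss @ ts \<in> tuples S Z (X @ Y)"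
  by (auto intro!: tuplesI simp: tuples_length nth_append tuples_wf)

lemma tuples_appendE:
  assumes "us \<in> tuples S Z (X @ Y)"
  obtains ss ts where "us = ss @ ts" "ss \<in> tuples S Z X" "ts \<in> tuples S Z Y"
proof
  show "us = take (length X) us @ drop (length X) us" by simp
  show "take (length X) us \<in> tuples S Z X"
  proof (rule tuplesI)
    fix i assume "i < length X"
    then show "wf_tm S Z (X ! i) (take (length X) us ! i)"
      using tuples_wf[OF assms, of i] by (simp add: nth_append)
  qed (use assms in \<open>simp add: tuples_length\<close>)
  show "drop (length X) us \<in> tuples S Z Y"
  proof (rule tuplesI)
    fix i assume "i < length Y"
    then show "wf_tm S Z (Y ! i) (drop (length X) us ! i)"
      using tuples_wf[OF assms, of "length X + i"] assms by (simp add: tuples_length nth_append)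
  qed (use assms in \<open>simp add: tuples_length\<close>)
qed

text \<open>The term \<open>uncurry_tm b a u\<close> is \<open>u\<close> with the last variable of its context of length \<open>a + 1\<close>
  replaced by the metavariable in position \<open>b\<close>, and \<open>curry_tm\<close> is the inverse operation. These are
  the two directions of the exponential transpose.\<close>

definition uncurry_tm :: "nat \<Rightarrow> nat \<Rightarrow> 'o tm \<Rightarrow> 'o tm" where
  "uncurry_tm b a = subst (inst (map Var [0..<a] @ [Meta b []]))"

definition curry_tm :: "nat list \<Rightarrow> nat \<Rightarrow> 'o tm \<Rightarrow> 'o tm" where
  "curry_tm B a = msubst (id_abs B @ [(0, Var a)])"

lemma wf_uncurry_tm:
  "wf_tm S B (Suc a) u \<Longrightarrow> wf_tm S (B @ [0]) a (uncurry_tm (length B) a u)"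
  unfolding uncurry_tm_def
  by (rule wf_subst[OF wf_tm_append_ctx, of _ _ "Suc a"]) (auto intro!: wf_inst)

lemma wf_curry_tm:
  "wf_tm S (B @ [0]) a t \<Longrightarrow> wf_tm S B (Suc a) (curry_tm B a t)"
  unfolding curry_tm_def
  by (rule wf_msubst) (auto intro: wf_tm_mono_vars wf_id_abs simp: wf_abs_def[of _ _ _ "(0, Var a)"])

lemma curry_uncurry_tm:
  assumes u: "wf_tm S B (Suc a) u"
  shows "curry_tm B a (uncurry_tm (length B) a u) = u"
proof -
  let ?th = "id_abs B @ [(0, Var a)] :: (nat \<times> 'a tm) list"
  let ?\<sigma> = "inst (map Var [0..<a] @ [Meta (length B) []]) :: nat \<Rightarrow> 'a tm"
  \<comment> \<open>Uncurrying turns the last variable into the new metavariable, and the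
    metasubstitution turns that metavariable back into \<open>Var a\<close>.\<close>
  have var: "msubst ?th (?\<sigma> i) = Var i" if "i < Suc a" for i
    using that by (auto simp: inst_def nth_append less_Suc_eq)
  have "msubst ?th (subst ?\<sigma> u) = subst (\<lambda>i. msubst ?th (?\<sigma> i)) (msubst ?th u)"
  proof (rule msubst_subst[of S _ "Suc a" _ _ _ _ a])
    show "wf_tm S (map fst ?th) (Suc a) u" using wf_tm_append_ctx[OF u] by simp
    fix k assume "k < length ?th"
    then have "wf_abs S B (Suc a) (?th ! k)"
      by (cases "k < length B") (auto simp: nth_append wf_abs_def intro!: wf_meta_vars)
    then have "subst_abs (\<lambda>i. msubst ?th (?\<sigma> i)) (?th ! k) = subst_abs Var (?th ! k)"
      by (rule subst_abs_cong) (rule var)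
    then show "?th ! k = subst_abs (\<lambda>i. msubst ?th (?\<sigma> i)) (?th ! k)" by simp
  next
    fix i assume "i < Suc a"
    then show "wf_tm S (map fst ?th) a (?\<sigma> i)"
      by (auto intro!: wf_inst)
  qed auto
  also have "msubst ?th u = u" by (rule msubst_id_append[OF u])
  also have "subst (\<lambda>i. msubst ?th (?\<sigma> i)) u = u" by (rule subst_id[OF u]) (rule var)
  finally show ?thesis by (simp add: curry_tm_def uncurry_tm_def)
qed

lemma uncurry_curry_tm:
  assumes t: "wf_tm S (B @ [0]) a t"
  shows "uncurry_tm (length B) a (curry_tm B a t) = t"
proof -
  let ?th = "id_abs B @ [(0, Var a)] :: (nat \<times> 'a tm) list"
  let ?\<sigma> = "inst (map Var [0..<a] @ [Meta (length B) []]) :: nat \<Rightarrow> 'a tm"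
  have "subst ?\<sigma> (msubst ?th t) = msubst (map (subst_abs ?\<sigma>) ?th) t"
    by (rule subst_msubst_closed[of S _ a]) (use t in \<open>auto simp: inst_def nth_append\<close>)
  \<comment> \<open>The substitution reaches only the abstractions. It turns \<open>Var a\<close>
    into the new metavariable and fixes the generic entries, which leaves the identity
    metasubstitution.\<close>
  also have "map (subst_abs ?\<sigma>) ?th = id_abs (B @ [0])"
  proof (rule nth_equalityI)
    fix k assume "k < length (map (subst_abs ?\<sigma>) ?th)"
    then show "map (subst_abs ?\<sigma>) ?th ! k = id_abs (B @ [0]) ! k"
      by (cases "k < length B")
        (auto simp: nth_append subst_abs_def subst_meta_vars up_subst_def inst_def meta_vars_def rename_id)
  qed simp
  also have "msubst \<dots> t = t" by (rule msubst_id[OF t])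
  finally show ?thesis by (simp add: curry_tm_def uncurry_tm_def)
qed

lemma M_ev_tuples: "M_ev ms \<in> tuples S (map Suc ms @ [0]) ms"
  by (auto intro!: tuplesI simp: M_ev_def nth_append)

lemma msubst_M_ev:
  assumes "length us = length ms"
  shows "map (msubst (zip (map Suc ms @ [0]) (us @ [Meta b []]))) (M_ev ms)
       = map (\<lambda>i. uncurry_tm b (ms ! i) (us ! i)) [0..<length ms]"
  using assms
  by (auto intro!: nth_equalityI simp: M_ev_def uncurry_tm_def nth_append comp_def)

text \<open>Covers both \<M>, with equality as \<open>R\<close> and the identity as
  \<open>q\<close>, and the theory of a presentation, with derivability as \<open>R\<close> and
  coded classes as \<open>q\<close>. Products and exponentials are then verified once.\<close>

locale tuple_category =
  fixes S :: "'o signature" and R :: "nat list \<Rightarrow> nat \<Rightarrow> 'o tm \<Rightarrow> 'o tm \<Rightarrow> bool"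
    and C :: "(nat list, 'a) category" and q :: "nat list \<Rightarrow> nat list \<Rightarrow> 'o tm list \<Rightarrow> 'a"
  assumes Obj_C: "Obj C = UNIV"
    and Hom_C: "Hom C ms ns = q ms ns ` tuples S ms ns"
    and q_eq_iff: "ts \<in> tuples S ms ns \<Longrightarrow> ts' \<in> tuples S ms ns \<Longrightarrow>
      q ms ns ts = q ms ns ts' \<longleftrightarrow> (\<forall>i<length ns. R ms (ns ! i) (ts ! i) (ts' ! i))"
    and Id_C: "Id C ms = q ms ms (ids ms)"
    and Comp_C: "ss \<in> tuples S ls ms \<Longrightarrow> ts \<in> tuples S ms ns \<Longrightarrow>
      Comp C ls ms ns (q ms ns ts) (q ls ms ss) = q ls ns (map (msubst (zip ms ss)) ts)"
begin

lemma q_in_Hom: "ts \<in> tuples S ms ns \<Longrightarrow> q ms ns ts \<in> Hom C ms ns"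
  by (simp add: Hom_C)

lemma is_category_C: "is_category C"
  unfolding is_category_def Obj_C
proof (intro conjI ballI)
  fix X show "Id C X \<in> Hom C X X" by (simp add: Id_C Hom_C ids_tuples)
  fix Y f assume "f \<in> Hom C X Y"
  then obtain ss where ss: "ss \<in> tuples S X Y" "f = q X Y ss" by (auto simp: Hom_C)
  have "map (msubst (zip X (ids X))) ss = ss"
    using msubst_id[OF tuples_wf[OF ss(1)]]
    by (intro nth_equalityI) (simp_all add: zip_ids tuples_length[OF ss(1)])
  then show "Comp C X X Y f (Id C X) = f"
    by (simp add: Id_C ss Comp_C[OF ids_tuples])
  have "map (msubst (zip Y ss)) (ids Y) = ss"
    using msubst_proj1[OF ss(1), of "[]" "[]"] by simp
  then show "Comp C X Y Y (Id C Y) f = f"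
    by (simp add: Id_C ss Comp_C[OF _ ids_tuples])
  fix Z g assume "g \<in> Hom C Y Z"
  then obtain ts where ts: "ts \<in> tuples S Y Z" "g = q Y Z ts" by (auto simp: Hom_C)
  show gf: "Comp C X Y Z g f \<in> Hom C X Z"
    using ss ts by (simp add: Comp_C Hom_C map_msubst_tuples)
  fix W h assume "h \<in> Hom C Z W"
  then obtain us where us: "us \<in> tuples S Z W" "h = q Z W us" by (auto simp: Hom_C)
  have "map (msubst (zip Z (map (msubst (zip Y ss)) ts))) us = map (msubst (zip Y ss)) (map (msubst (zip Z ts)) us)"
    using msubst_msubst_tuples[OF ss(1) ts(1) tuples_wf[OF us(1)]]
    by (intro nth_equalityI) (simp_all add: tuples_length[OF us(1)])
  then show "Comp C X Z W h (Comp C X Y Z g f) = Comp C X Y W (Comp C Y Z W h g) f"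
    using ss ts us by (simp add: Comp_C map_msubst_tuples del: map_map)
qed

definition K :: "(nat list, 'a) cartesian" where
  "K = \<lparr>terminal = [], prodobj = (@), proj1 = (\<lambda>X Y. q (X @ Y) X (proj1 M_cart X Y)),
        proj2 = (\<lambda>X Y. q (X @ Y) Y (proj2 M_cart X Y))\<rparr>"

lemma K_sel [simp]:
  "terminal K = []" "prodobj K X Y = X @ Y" "proj1 K X Y = q (X @ Y) X (proj1 M_cart X Y)"
  "proj2 K X Y = q (X @ Y) Y (proj2 M_cart X Y)"
  by (simp_all add: K_def)

lemma pairing:
  assumes "ss \<in> tuples S Z X" "ts \<in> tuples S Z Y"
  shows "Comp C Z (X @ Y) X (proj1 K X Y) (q Z (X @ Y) (ss @ ts)) = q Z X ss"
    "Comp C Z (X @ Y) Y (proj2 K X Y) (q Z (X @ Y) (ss @ ts)) = q Z Y ts"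
  using msubst_proj1[OF assms(1)] msubst_proj2[OF assms]
  by (simp_all add: proj1_M_cart Comp_C[OF append_tuples[OF assms] proj1_tuples[unfolded proj1_M_cart]]
      Comp_C[OF append_tuples[OF assms] proj2_tuples])

lemma pairing_unique:
  assumes ss: "ss \<in> tuples S Z X" and ts: "ts \<in> tuples S Z Y" and h: "h \<in> Hom C Z (X @ Y)"
    "Comp C Z (X @ Y) X (proj1 K X Y) h = q Z X ss" "Comp C Z (X @ Y) Y (proj2 K X Y) h = q Z Y ts"
  shows "h = q Z (X @ Y) (ss @ ts)"
proof -
  obtain us where us: "us \<in> tuples S Z (X @ Y)" "h = q Z (X @ Y) us" using h(1) by (auto simp: Hom_C)
  obtain ss' ts' where s: "us = ss' @ ts'" and ss': "ss' \<in> tuples S Z X" and ts': "ts' \<in> tuples S Z Y"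
    by (rule tuples_appendE[OF us(1)])
  have "q Z X ss' = q Z X ss" "q Z Y ts' = q Z Y ts"
    using h(2,3) pairing[OF ss' ts'] by (simp_all add: us(2) s)
  then have R: "\<forall>i<length X. R Z (X ! i) (ss' ! i) (ss ! i)" "\<forall>i<length Y. R Z (Y ! i) (ts' ! i) (ts ! i)"
    using q_eq_iff[OF ss' ss] q_eq_iff[OF ts' ts] by auto
  have "R Z ((X @ Y) ! i) ((ss' @ ts') ! i) ((ss @ ts) ! i)" if "i < length (X @ Y)" for i
    using that R(1) R(2)[rule_format, of "i - length X"]
    by (auto simp: nth_append tuples_length[OF ss] tuples_length[OF ss'])
  then show ?thesis
    unfolding us(2) s using q_eq_iff[OF append_tuples[OF ss' ts'] append_tuples[OF ss ts]] by simp
qed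

lemma is_cartesian_C: "is_cartesian C K"
  unfolding is_cartesian_def Obj_C
proof (intro conjI ballI is_category_C)
  fix X :: "nat list"
  have "tuples S X [] = {[]}" by (auto simp: tuples_def)
  then show "\<exists>!f. f \<in> Hom C X (terminal K)" by (auto simp: Hom_C)
  fix Y :: "nat list"
  show "proj1 K X Y \<in> Hom C (prodobj K X Y) X" "proj2 K X Y \<in> Hom C (prodobj K X Y) Y"
    by (simp_all add: q_in_Hom proj1_tuples proj2_tuples)
  fix Z f g assume "f \<in> Hom C Z X" "g \<in> Hom C Z Y"
  then obtain ss ts where s: "ss \<in> tuples S Z X" "f = q Z X ss" "ts \<in> tuples S Z Y" "g = q Z Y ts"
    by (auto simp: Hom_C)
  show "\<exists>!h. h \<in> Hom C Z (prodobj K X Y) \<and> Comp C Z (prodobj K X Y) X (proj1 K X Y) h = f \<and>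
                Comp C Z (prodobj K X Y) Y (proj2 K X Y) h = g"
  proof (rule ex1I)
    show "q Z (X @ Y) (ss @ ts) \<in> Hom C Z (prodobj K X Y) \<and>
        Comp C Z (prodobj K X Y) X (proj1 K X Y) (q Z (X @ Y) (ss @ ts)) = f \<and>
        Comp C Z (prodobj K X Y) Y (proj2 K X Y) (q Z (X @ Y) (ss @ ts)) = g"
      using pairing[OF s(1,3)] s by (simp add: q_in_Hom append_tuples)
    show "h = q Z (X @ Y) (ss @ ts)" if "h \<in> Hom C Z (prodobj K X Y) \<and>
        Comp C Z (prodobj K X Y) X (proj1 K X Y) h = f \<and>
        Comp C Z (prodobj K X Y) Y (proj2 K X Y) h = g" for h
      using that s by (intro pairing_unique) auto
  qed
qed auto

text \<open>\<open>prod_left\<close> is a definite description; the appended tuple meets its two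
  equations, and \<open>pairing_unique\<close> excludes any other solution.\<close>

lemma prod_left_C:
  assumes us: "us \<in> tuples S B E"
  shows "prod_left C K B E [0] (q B E us) = q (B @ [0]) (E @ [0]) (us @ [Meta (length B) []])"
proof -
  have us': "us \<in> tuples S (B @ [0]) E"
    using us by (auto intro!: tuplesI wf_tm_append_ctx simp: tuples_length tuples_wf)
  have m: "[Meta (length B) []] \<in> tuples S (B @ [0]) [0]" by (auto intro!: tuplesI)
  have p2: "proj2 K B [0] = q (B @ [0]) [0] [Meta (length B) []]"
    by (simp add: M_cart_def meta_vars_def)
  have "map (msubst (zip B (ids B))) us = us"
    using msubst_id[OF tuples_wf[OF us]]
    by (intro nth_equalityI) (simp_all add: zip_ids tuples_length[OF us])
  then have p1: "Comp C (B @ [0]) B E (q B E us) (proj1 K B [0]) = q (B @ [0]) E us"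
    using Comp_C[OF proj1_tuples us] by (simp add: proj1_M_cart)
  show ?thesis
    unfolding prod_left_def p2
  proof (rule the_equality)
    show "q (B @ [0]) (E @ [0]) (us @ [Meta (length B) []]) \<in> Hom C (prodobj K B [0]) (prodobj K E [0]) \<and>
      Comp C (prodobj K B [0]) (prodobj K E [0]) E (proj1 K E [0]) (q (B @ [0]) (E @ [0]) (us @ [Meta (length B) []])) =
      Comp C (prodobj K B [0]) B E (q B E us) (proj1 K B [0]) \<and>
      Comp C (prodobj K B [0]) (prodobj K E [0]) [0] (proj2 K E [0]) (q (B @ [0]) (E @ [0]) (us @ [Meta (length B) []])) =
      q (B @ [0]) [0] [Meta (length B) []]"
      using pairing[OF us' m] p1 by (simp add: q_in_Hom append_tuples[OF us' m])
    fix h assume "h \<in> Hom C (prodobj K B [0]) (prodobj K E [0]) \<and>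
      Comp C (prodobj K B [0]) (prodobj K E [0]) E (proj1 K E [0]) h =
      Comp C (prodobj K B [0]) B E (q B E us) (proj1 K B [0]) \<and>
      Comp C (prodobj K B [0]) (prodobj K E [0]) [0] (proj2 K E [0]) h =
      q (B @ [0]) [0] [Meta (length B) []]"
    then show "h = q (B @ [0]) (E @ [0]) (us @ [Meta (length B) []])"
      using p1 by (intro pairing_unique[OF us' m]) auto
  qed
qed

text \<open>Evaluation acts as \<open>uncurry_tm\<close> in each component, so
  \<open>curry_tm\<close> gives the transpose. Uniqueness is where \<open>R\<close> enters: related
  uncurried terms must stay related after currying back.\<close>

lemma is_exponential_C:
  assumes R_curry: "\<And>B a s t. wf_tm S (B @ [0]) a s \<Longrightarrow> wf_tm S (B @ [0]) a t \<Longrightarrow> R (B @ [0]) a s t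
      \<Longrightarrow> R B (Suc a) (curry_tm B a s) (curry_tm B a t)"
  shows "is_exponential C K [0] ms (map Suc ms) (q (map Suc ms @ [0]) ms (M_ev ms))"
  unfolding is_exponential_def Obj_C
proof (intro conjI ballI)
  show "q (map Suc ms @ [0]) ms (M_ev ms) \<in> Hom C (prodobj K (map Suc ms) [0]) ms"
    by (simp add: q_in_Hom M_ev_tuples)
  fix B f assume "f \<in> Hom C (prodobj K B [0]) ms"
  then obtain ts where ts: "ts \<in> tuples S (B @ [0]) ms" "f = q (B @ [0]) ms ts" by (auto simp: Hom_C)
  let ?U = "\<lambda>us. map (\<lambda>i. uncurry_tm (length B) (ms ! i) (us ! i)) [0..<length ms]"
  let ?ev = "\<lambda>g. Comp C (prodobj K B [0]) (prodobj K (map Suc ms) [0]) ms (q (map Suc ms @ [0]) ms (M_ev ms))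
            (prod_left C K B (map Suc ms) [0] g)"
  have U: "?U us \<in> tuples S (B @ [0]) ms" if "us \<in> tuples S B (map Suc ms)" for us
  proof (rule tuplesI)
    fix i assume i: "i < length ms"
    then have "wf_tm S B (Suc (ms ! i)) (us ! i)" using tuples_wf[OF that, of i] by simp
    then show "wf_tm S (B @ [0]) (ms ! i) (?U us ! i)" using wf_uncurry_tm i by simp
  qed simp
  have ev: "?ev (q B (map Suc ms) us) = q (B @ [0]) ms (?U us)" if us: "us \<in> tuples S B (map Suc ms)" for us
  proof -
    have "us @ [Meta (length B) []] \<in> tuples S (B @ [0]) (map Suc ms @ [0])"
    proof (rule append_tuples)
      show "us \<in> tuples S (B @ [0]) (map Suc ms)"
        using us wf_tm_append_ctx[of S B _ _ "[0]"] unfolding tuples_def by blast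
    qed (simp add: tuples_def)
    then show ?thesis
      using msubst_M_ev[of us ms "length B"] us
      by (simp add: prod_left_C Comp_C[OF _ M_ev_tuples] tuples_length)
  qed
  let ?us = "map (\<lambda>i. curry_tm B (ms ! i) (ts ! i)) [0..<length ms]"
  have us: "?us \<in> tuples S B (map Suc ms)"
  proof (rule tuplesI)
    fix i assume "i < length (map Suc ms)"
    then show "wf_tm S B (map Suc ms ! i) (?us ! i)" using wf_curry_tm[OF tuples_wf[OF ts(1), of i]] by simp
  qed simp
  have Uus: "?U ?us = ts"
    using uncurry_curry_tm[OF tuples_wf[OF ts(1)]]
    by (intro nth_equalityI) (simp_all add: tuples_length[OF ts(1)])
  show "\<exists>!g. g \<in> Hom C B (map Suc ms) \<and> ?ev g = f"
  proof (rule ex1I)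
    show "q B (map Suc ms) ?us \<in> Hom C B (map Suc ms) \<and> ?ev (q B (map Suc ms) ?us) = f"
      using ev[OF us] Uus ts(2) us by (simp add: q_in_Hom)
    fix g assume g: "g \<in> Hom C B (map Suc ms) \<and> ?ev g = f"
    then obtain vs where vs: "vs \<in> tuples S B (map Suc ms)" "g = q B (map Suc ms) vs" by (auto simp: Hom_C)
    have "q (B @ [0]) ms (?U vs) = q (B @ [0]) ms ts" using g ev[OF vs(1)] vs(2) ts(2) by simp
    then have R: "R (B @ [0]) (ms ! i) (uncurry_tm (length B) (ms ! i) (vs ! i)) (ts ! i)" if "i < length ms" for i
      using q_eq_iff[OF U[OF vs(1)] ts(1)] that by simp
    have "R B (Suc (ms ! i)) (vs ! i) (curry_tm B (ms ! i) (ts ! i))" if i: "i < length ms" for i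
    proof -
      have w: "wf_tm S B (Suc (ms ! i)) (vs ! i)" using tuples_wf[OF vs(1), of i] i by simp
      show ?thesis
        using R_curry[OF wf_uncurry_tm[OF w] tuples_wf[OF ts(1) i] R[OF i]] curry_uncurry_tm[OF w] by simp
    qed
    then show "g = q B (map Suc ms) ?us"
      unfolding vs(2) using q_eq_iff[OF vs(1) us] by simp
  qed
qed auto

end

interpretation M: tuple_category empty_signature "\<lambda>_ _. (=)" M_cat "\<lambda>_ _ ts. ts"
  by standard (auto simp: M_cat_def tuples_def ids_def intro: nth_equalityI)

lemma Hom_M_cat: "Hom M_cat ms ns = tuples empty_signature ms ns"
  using M.Hom_C by simp

lemma Obj_M_cat [simp]: "Obj M_cat = UNIV"
  by (rule M.Obj_C)

lemma M_cart_eq: "M.K = M_cart"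
  by (simp add: M.K_def M_cart_def fun_eq_iff)

lemma wf_tm_empty: "wf_tm empty_signature \<Theta> n t \<Longrightarrow> wf_tm S \<Theta> n t"
  by (induction t arbitrary: n rule: tm_induct) (auto simp: empty_signature_def)

lemma tuples_empty: "ts \<in> tuples empty_signature ms ns \<Longrightarrow> ts \<in> tuples S ms ns"
  by (auto simp: tuples_def intro: wf_tm_empty)

section \<open>The theory of a presentation\<close>

lemma M_cart_sel: "terminal M_cart = []" "prodobj M_cart X Y = X @ Y"
  by (simp_all add: M_cart_def)

text \<open>A chosen representative instead of an equivalence class, so that a class of tuples is
  again a tuple of terms and can be coded. Derivably equal terms satisfy the same predicate and
  hence get the same choice.\<close>

definition nf :: "'u presentation \<Rightarrow> nat list \<Rightarrow> nat \<Rightarrow> 'u tm \<Rightarrow> 'u tm" where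
  "nf P \<Theta> n t = (SOME s. derivable P \<Theta> n t s)"

lemma derivable_nf: "wf_tm (sig P) \<Theta> n t \<Longrightarrow> derivable P \<Theta> n t (nf P \<Theta> n t)"
  unfolding nf_def by (rule someI, rule derivable.refl)

lemma nf_eq_iff:
  assumes "wf_tm (sig P) \<Theta> n s" "wf_tm (sig P) \<Theta> n t"
  shows "nf P \<Theta> n s = nf P \<Theta> n t \<longleftrightarrow> derivable P \<Theta> n s t"
proof
  assume "nf P \<Theta> n s = nf P \<Theta> n t"
  then show "derivable P \<Theta> n s t"
    using derivable_nf[OF assms(1)] derivable_nf[OF assms(2)] by (metis derivable.sym derivable.trans)
next
  assume "derivable P \<Theta> n s t"
  then have "derivable P \<Theta> n s = derivable P \<Theta> n t"
    by (intro ext) (metis derivable.sym derivable.trans)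
  then show "nf P \<Theta> n s = nf P \<Theta> n t" by (simp add: nf_def)
qed

definition tuple_code :: "'u tm list \<Rightarrow> 'u" where
  "tuple_code = (SOME f. inj f)"

lemma inj_tuple_code: "infinite (UNIV :: 'u set) \<Longrightarrow> inj (tuple_code :: 'u tm list \<Rightarrow> 'u)"
  unfolding tuple_code_def by (drule infinite_tm_list_embedding) (erule someI_ex)

definition nfs :: "'u presentation \<Rightarrow> nat list \<Rightarrow> nat list \<Rightarrow> 'u tm list \<Rightarrow> 'u tm list" where
  "nfs P ms ns ts = map (\<lambda>i. nf P ms (ns ! i) (ts ! i)) [0..<length ns]"

definition tm_class :: "'u presentation \<Rightarrow> nat list \<Rightarrow> nat list \<Rightarrow> 'u tm list \<Rightarrow> 'u" where
  "tm_class P ms ns ts = tuple_code (nfs P ms ns ts)"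

definition syn_cat :: "'u presentation \<Rightarrow> (nat list, 'u) category" where
  "syn_cat P =
     \<lparr>Obj = UNIV,
      Hom = (\<lambda>ms ns. tm_class P ms ns ` tuples (sig P) ms ns),
      Id = (\<lambda>ms. tm_class P ms ms (ids ms)),
      Comp = (\<lambda>ls ms ns g f. tm_class P ls ns (map (msubst (zip ms (inv tuple_code f))) (inv tuple_code g)))\<rparr>"

lemma tuple_category_syn_cat:
  assumes inf: "infinite (UNIV :: 'u set)" and P: "is_presentation (P :: 'u presentation)"
  shows "tuple_category (sig P) (derivable P) (syn_cat P) (tm_class P)"
proof
  note inj = inj_tuple_code[OF inf]
  show eq: "(tm_class P ms ns ts = tm_class P ms ns ts') = (\<forall>i<length ns. derivable P ms (ns ! i) (ts ! i) (ts' ! i))"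
    if "ts \<in> tuples (sig P) ms ns" "ts' \<in> tuples (sig P) ms ns" for ts ms ns ts'
    using nf_eq_iff[OF tuples_wf[OF that(1)] tuples_wf[OF that(2)]]
    by (auto simp: tm_class_def inj_eq[OF inj] nfs_def)
  have dec: "inv tuple_code (tm_class P ms ns ts) = nfs P ms ns ts" for ms ns and ts :: "'u tm list"
    by (simp add: tm_class_def inj)
  have nfs: "nfs P ms ns ts \<in> tuples (sig P) ms ns" if "ts \<in> tuples (sig P) ms ns" for ms ns ts
    using derivable_wf[OF P derivable_nf[OF tuples_wf[OF that]]] by (auto simp: nfs_def intro!: tuplesI)
  fix ls ms ns and ss ts :: "'u tm list"
  assume ss: "ss \<in> tuples (sig P) ls ms" and ts: "ts \<in> tuples (sig P) ms ns"
  \<comment> \<open>Composition decodes to chosen representatives and substitutes these.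
    \<open>ext_msubst\<close> shows that any other representatives give the same class.\<close>
  have "derivable P ls (ns ! i) (msubst (zip ms (nfs P ls ms ss)) (nfs P ms ns ts ! i)) (msubst (zip ms ss) (ts ! i))"
    if i: "i < length ns" for i
  proof (rule derivable.sym, rule derivable_msubst[OF P])
    show "derivable P ms (ns ! i) (ts ! i) (nfs P ms ns ts ! i)"
      using derivable_nf[OF tuples_wf[OF ts i]] i by (simp add: nfs_def)
    show "derivable P ls (ms ! j) (ss ! j) (nfs P ls ms ss ! j)" if "j < length ms" for j
      using derivable_nf[OF tuples_wf[OF ss that]] that by (simp add: nfs_def)
  qed (use ss in \<open>simp_all add: tuples_length nfs_def\<close>)
  then have "tm_class P ls ns (map (msubst (zip ms (nfs P ls ms ss))) (nfs P ms ns ts))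
      = tm_class P ls ns (map (msubst (zip ms ss)) ts)"
    using eq[OF map_msubst_tuples[OF nfs[OF ss] nfs[OF ts]] map_msubst_tuples[OF ss ts]]
    by (simp add: tuples_length[OF ts] tuples_length[OF nfs[OF ts]])
  then show "Comp (syn_cat P) ls ms ns (tm_class P ms ns ts) (tm_class P ls ms ss)
      = tm_class P ls ns (map (msubst (zip ms ss)) ts)"
    by (simp add: syn_cat_def dec)
qed (simp_all add: syn_cat_def)

definition syn_theory :: "'u presentation \<Rightarrow> 'u so_theory" where
  "syn_theory P =
     \<lparr>tcat = syn_cat P, tcart = tuple_category.K (tm_class P),
      tfun = \<lparr>fobj = (\<lambda>ms. ms), farr = (\<lambda>ms ns. restrict (tm_class P ms ns) (Hom M_cat ms ns))\<rparr>\<rparr>"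

text \<open>Currying puts a fresh variable for the last metavariable. This is an instance of
  \<open>ext_msubst\<close> in which \<Delta> has one variable; weakened past the \<open>a\<close>
  variables of \<Gamma> it becomes \<open>Var a\<close>. Exponentials in the theory thus depend on
  the context \<Delta> of the rule.\<close>

lemma derivable_curry:
  assumes st: "derivable P (B @ [0]) a s t"
  shows "derivable P B (Suc a) (curry_tm B a s) (curry_tm B a t)"
proof -
  let ?us = "ids B @ [Var 0]"
  have eq: "map (weaken_abs a) (zip (B @ [0]) ?us) = id_abs B @ [(0, Var a)]"
    by (simp add: zip_ids weaken_abs_def[of a] up_ren_def) (simp add: weaken_abs_def[symmetric])
  have "derivable P B (a + 1) (msubst (map (weaken_abs a) (zip (B @ [0]) ?us)) s)
       (msubst (map (weaken_abs a) (zip (B @ [0]) ?us)) t)"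
  proof (rule derivable.ext_msubst[OF st])
    show "\<forall>i<length (B @ [0]). derivable P B ((B @ [0]) ! i + 1) (?us ! i) (?us ! i)"
      by (auto simp: nth_append less_Suc_eq intro!: derivable.refl wf_meta_vars)
  qed auto
  then show ?thesis unfolding eq curry_tm_def by simp
qed

lemma is_so_theory_syn_theory:
  assumes inf: "infinite (UNIV :: 'u set)" and P: "is_presentation (P :: 'u presentation)"
  shows "is_so_theory (syn_theory P)"
proof -
  interpret tuple_category "sig P" "derivable P" "syn_cat P" "tm_class P"
    by (rule tuple_category_syn_cat[OF inf P])
  let ?T = "tfun (syn_theory P)"
  have T: "fobj ?T = (\<lambda>ms. ms)" "\<And>ms ns ts. ts \<in> tuples empty_signature ms ns \<Longrightarrow> farr ?T ms ns ts = tm_class P ms ns ts"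
    by (simp_all add: syn_theory_def Hom_M_cat)
  have "is_functor M_cat (syn_cat P) ?T"
    unfolding is_functor_def
  proof (intro conjI ballI allI impI M.is_category_C is_category_C)
    show "fobj ?T \<in> Obj M_cat \<rightarrow>\<^sub>E Obj (syn_cat P)" by (simp add: T Obj_C)
    show "farr ?T X Y \<in> Hom M_cat X Y \<rightarrow>\<^sub>E Hom (syn_cat P) (fobj ?T X) (fobj ?T Y)" for X Y
      by (auto simp: syn_theory_def Hom_M_cat intro!: q_in_Hom[OF tuples_empty])
    show "farr ?T X X (Id M_cat X) = Id (syn_cat P) (fobj ?T X)" for X
      by (simp add: T Id_C M.Id_C ids_tuples)
    fix X Y Z and f g :: "'u tm list" assume "f \<in> Hom M_cat X Y" "g \<in> Hom M_cat Y Z"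
    then show "farr ?T X Z (Comp M_cat X Y Z g f) = Comp (syn_cat P) (fobj ?T X) (fobj ?T Y) (fobj ?T Z) (farr ?T Y Z g) (farr ?T X Y f)"
      unfolding Hom_M_cat
      by (simp add: T M.Comp_C Comp_C tuples_empty[of _ _ _ "sig P"] map_msubst_tuples)
  qed auto
  then have "is_strict_cartesian_functor M_cat M_cart (syn_cat P) K ?T"
    using M.is_cartesian_C[unfolded M_cart_eq] is_cartesian_C
    by (simp add: is_strict_cartesian_functor_def T proj1_tuples proj2_tuples M_cart_sel)
  moreover have "is_exponential (syn_cat P) K [0] ms (map Suc ms) (tm_class P (map Suc ms @ [0]) ms (M_ev ms))" for ms
    by (rule is_exponential_C[OF derivable_curry])
  ultimately show ?thesis
    by (simp add: is_so_theory_def T Obj_C M_exp_def M_ev_tuples) (simp add: syn_theory_def Obj_C)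
qed

section \<open>Abstraction and application in a theory\<close>

definition ext :: "nat list \<Rightarrow> nat \<Rightarrow> nat list" where
  "ext Z m = Z @ replicate m 0"

lemma length_ext [simp]: "length (ext Z m) = length Z + m"
  by (simp add: ext_def)

lemma nth_ext: "i < length Z \<Longrightarrow> ext Z m ! i = Z ! i" "length Z \<le> i \<Longrightarrow> i < length Z + m \<Longrightarrow> ext Z m ! i = 0"
  by (simp_all add: ext_def nth_append)

lemma ext_ext: "ext (ext Z n) m = ext Z (n + m)"
  by (simp add: ext_def replicate_add)

lemma ext_0 [simp]: "ext Z 0 = Z"
  by (simp add: ext_def)

lemma ext_Suc: "ext Z (Suc m) = ext (Z @ [0]) m"
  by (simp add: ext_def)

lemma single_tuples: "wf_tm S X n t \<Longrightarrow> [t] \<in> tuples S X [n]"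
  by (simp add: tuples_def)

locale so_theory =
  fixes T :: "'a so_theory"
  assumes T: "is_so_theory T"
begin

section \<open>Composition and the structure functor of a theory\<close>

abbreviation H where "H \<equiv> Hom (tcat T)"
abbreviation cmp where "cmp \<equiv> Comp (tcat T)"
abbreviation marr where "marr \<equiv> farr (tfun T)"

lemma Obj_T [simp]: "Obj (tcat T) = UNIV"
  using T by (simp add: is_so_theory_def)

lemma fobj_T [simp]: "fobj (tfun T) ms = ms"
  using T by (simp add: is_so_theory_def)

lemma T_functor: "is_functor M_cat (tcat T) (tfun T)"
  by (rule so_theory_functor[OF T])

lemma T_cat: "is_category (tcat T)"
  using fun_cats[OF T_functor] by simp

lemma cmp_in: "f \<in> H X Y \<Longrightarrow> g \<in> H Y Z \<Longrightarrow> cmp X Y Z g f \<in> H X Z"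
  using cat_comp[OF T_cat] by simp

lemma assoc:
  "f \<in> H W X \<Longrightarrow> g \<in> H X Y \<Longrightarrow> h \<in> H Y Z \<Longrightarrow> cmp W Y Z h (cmp W X Y g f) = cmp W X Z (cmp X Y Z h g) f"
  using cat_assoc[OF T_cat] by simp

lemma Id_in: "Id (tcat T) X \<in> H X X"
  using cat_id[OF T_cat] by simp

lemma cmp_Id: "f \<in> H X Y \<Longrightarrow> cmp X X Y f (Id (tcat T) X) = f"
  using cat_id_right[OF T_cat] by simp

lemma marr_in: "ts \<in> tuples empty_signature X Y \<Longrightarrow> marr X Y ts \<in> H X Y"
  using fun_arr[OF T_functor, of X Y ts] by (simp add: Hom_M_cat)

lemma marr_comp:
  "ss \<in> tuples empty_signature X Y \<Longrightarrow> ts \<in> tuples empty_signature Y Z \<Longrightarrow>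
   cmp X Y Z (marr Y Z ts) (marr X Y ss) = marr X Z (map (msubst (zip Y ss)) ts)"
  using fun_comp[OF T_functor, of X Y Z ss ts] by (simp add: Hom_M_cat M.Comp_C)

lemma marr_ids: "marr X X (ids X) = Id (tcat T) X"
  using fun_id[OF T_functor, of X] by (simp add: M.Id_C)

lemma T_strict: "is_strict_cartesian_functor M_cat M_cart (tcat T) (tcart T) (tfun T)"
  using T by (simp add: is_so_theory_def)

lemma T_cartesian: "is_cartesian (tcat T) (tcart T)"
  using T_strict by (simp add: is_strict_cartesian_functor_def)

lemma terminal_T: "terminal (tcart T) = []"
  using T_strict by (simp add: is_strict_cartesian_functor_def M_cart_sel)

lemma prodobj_T: "prodobj (tcart T) X Y = X @ Y"
  using T_strict by (simp add: is_strict_cartesian_functor_def M_cart_sel)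

lemma proj1_T: "proj1 (tcart T) X Y = marr (X @ Y) X (proj1 M_cart X Y)"
  using T_strict by (simp add: is_strict_cartesian_functor_def M_cart_sel prodobj_T)

lemma proj2_T: "proj2 (tcart T) X Y = marr (X @ Y) Y (proj2 M_cart X Y)"
  using T_strict by (simp add: is_strict_cartesian_functor_def M_cart_sel prodobj_T)

lemma product_T:
  assumes "f \<in> H Z X" "g \<in> H Z Y"
  shows "\<exists>!h. h \<in> H Z (X @ Y) \<and> cmp Z (X @ Y) X (marr (X @ Y) X (proj1 M_cart X Y)) h = f \<and>
           cmp Z (X @ Y) Y (marr (X @ Y) Y (proj2 M_cart X Y)) h = g"
  using T_cartesian assms unfolding is_cartesian_def prodobj_T proj1_T proj2_T Obj_T by blast

section \<open>Finite products indexed by lists\<close>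

definition pr :: "nat list \<Rightarrow> nat \<Rightarrow> 'a" where
  "pr ns i = marr ns [ns ! i] [meta_vars i (ns ! i)]"

definition fam :: "nat list \<Rightarrow> nat list \<Rightarrow> 'a list \<Rightarrow> bool" where
  "fam Z ns fs \<longleftrightarrow> length fs = length ns \<and> (\<forall>i<length ns. fs ! i \<in> H Z [ns ! i])"

definition tup :: "nat list \<Rightarrow> nat list \<Rightarrow> 'a list \<Rightarrow> 'a" where
  "tup Z ns fs = (THE h. h \<in> H Z ns \<and> (\<forall>i<length ns. cmp Z ns [ns ! i] (pr ns i) h = fs ! i))"

lemma famI: "length fs = length ns \<Longrightarrow> (\<And>i. i < length ns \<Longrightarrow> fs ! i \<in> H Z [ns ! i]) \<Longrightarrow> fam Z ns fs"
  by (simp add: fam_def)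

lemma pr_in: "i < length ns \<Longrightarrow> pr ns i \<in> H ns [ns ! i]"
  unfolding pr_def by (intro marr_in single_tuples wf_meta_vars) auto

lemma pr_marr:
  assumes ts: "ts \<in> tuples empty_signature X Y" and i: "i < length Y"
  shows "cmp X Y [Y ! i] (pr Y i) (marr X Y ts) = marr X [Y ! i] [ts ! i]"
proof -
  have "msubst (zip Y ts) (meta_vars i (Y ! i)) = ts ! i"
    using msubst_meta_vars[of i "zip Y ts" "Y ! i" empty_signature X] i tuples_wf[OF ts i] tuples_length[OF ts]
    by simp
  then show ?thesis
    unfolding pr_def using marr_comp[OF ts single_tuples[OF wf_meta_vars[OF i HOL.refl order.refl]]] by simp
qed

text \<open>Each object is the product of its one-entry lists. The theory supplies only a terminal
  object and binary products, so the induction splits off the head; strictness makes the projections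
  composites of projections from \<M>.\<close>

lemma tup_ex1:
  "fam Z ns fs \<Longrightarrow> \<exists>!h. h \<in> H Z ns \<and> (\<forall>i<length ns. cmp Z ns [ns ! i] (pr ns i) h = fs ! i)"
proof (induction ns arbitrary: fs)
  case Nil
  then show ?case using T_cartesian terminal_T by (simp add: is_cartesian_def)
next
  case (Cons n ns)
  then obtain f fs' where fs: "fs = f # fs'" by (cases fs) (auto simp: fam_def)
  have f: "f \<in> H Z [n]" using Cons.prems[unfolded fam_def] fs by force
  have "fam Z ns fs'" using Cons.prems[unfolded fam_def] fs by (fastforce intro: famI)
  from Cons.IH[OF this] obtain h' where h': "h' \<in> H Z ns" "\<And>i. i < length ns \<Longrightarrow> cmp Z ns [ns ! i] (pr ns i) h' = fs' ! i"
    and uniq: "\<And>h. h \<in> H Z ns \<Longrightarrow> (\<And>i. i < length ns \<Longrightarrow> cmp Z ns [ns ! i] (pr ns i) h = fs' ! i) \<Longrightarrow> h = h'"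
    by blast
  let ?N = "n # ns"
  let ?p2 = "marr ?N ns (proj2 M_cart [n] ns)"
  have p2t: "proj2 M_cart [n] ns \<in> tuples empty_signature ?N ns"
    using proj2_tuples[of "[n]" ns empty_signature] by simp
  have p2: "?p2 \<in> H ?N ns" by (rule marr_in[OF p2t])
  have pr0: "pr ?N 0 = marr ?N [n] (proj1 M_cart [n] ns)" by (simp add: pr_def M_cart_def)
  have prS: "cmp ?N ns [ns ! i] (pr ns i) ?p2 = pr ?N (Suc i)" if "i < length ns" for i
    using pr_marr[OF p2t that] that by (simp add: pr_def M_cart_def)
  have prh: "cmp Z ?N [ns ! i] (pr ?N (Suc i)) h = cmp Z ns [ns ! i] (pr ns i) (cmp Z ?N ns ?p2 h)"
    if "h \<in> H Z ?N" "i < length ns" for h i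
    using assoc[OF that(1) p2 pr_in[OF that(2)]] prS[OF that(2)] by simp
  have ex: "\<exists>!h. h \<in> H Z ?N \<and> cmp Z ?N [n] (pr ?N 0) h = f \<and> cmp Z ?N ns ?p2 h = h'"
    using product_T[OF f h'(1)] pr0 by simp
  have "(h \<in> H Z ?N \<and> (\<forall>i<length ?N. cmp Z ?N [?N ! i] (pr ?N i) h = fs ! i))
     \<longleftrightarrow> (h \<in> H Z ?N \<and> cmp Z ?N [n] (pr ?N 0) h = f \<and> cmp Z ?N ns ?p2 h = h')" (is "?L \<longleftrightarrow> ?R") for h
  proof
    assume L: ?L
    then have "cmp Z ?N [ns ! i] (pr ?N (Suc i)) h = fs' ! i" if "i < length ns" for i
      using that fs by force
    then have "cmp Z ?N ns ?p2 h = h'"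
      using L p2 prh[of h] by (intro uniq cmp_in) auto
    with L fs show ?R by force
  next
    assume R: ?R
    then have "cmp Z ?N [?N ! i] (pr ?N i) h = fs ! i" if "i < length ?N" for i
      using that h'(2) prh[of h] fs by (cases i) auto
    with R show ?L by blast
  qed
  with ex show ?case by simp
qed

lemma tup_in: "fam Z ns fs \<Longrightarrow> tup Z ns fs \<in> H Z ns"
  and pr_tup: "fam Z ns fs \<Longrightarrow> i < length ns \<Longrightarrow> cmp Z ns [ns ! i] (pr ns i) (tup Z ns fs) = fs ! i"
  using theI'[OF tup_ex1] by (auto simp: tup_def)

lemma arr_eqI:
  assumes "h \<in> H Z ns" "h' \<in> H Z ns"
    "\<And>i. i < length ns \<Longrightarrow> cmp Z ns [ns ! i] (pr ns i) h = cmp Z ns [ns ! i] (pr ns i) h'"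
  shows "h = h'"
proof -
  have "fam Z ns (map (\<lambda>i. cmp Z ns [ns ! i] (pr ns i) h) [0..<length ns])"
    using assms(1) pr_in by (auto intro!: famI cmp_in)
  from tup_ex1[OF this] show ?thesis using assms by auto
qed

lemma tup_unique:
  "fam Z ns fs \<Longrightarrow> h \<in> H Z ns \<Longrightarrow> (\<And>i. i < length ns \<Longrightarrow> cmp Z ns [ns ! i] (pr ns i) h = fs ! i) \<Longrightarrow> h = tup Z ns fs"
  by (rule arr_eqI) (auto simp: pr_tup tup_in)

lemma fam_map: "(\<And>i. i < length ns \<Longrightarrow> f i \<in> H Z [ns ! i]) \<Longrightarrow> fam Z ns (map f [0..<length ns])"
  by (rule famI) auto

lemma tup_cmp:
  assumes fs: "fam Z ns fs" and h: "h \<in> H W Z"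
  shows "cmp W Z ns (tup Z ns fs) h = tup W ns (map (\<lambda>i. cmp W Z [ns ! i] (fs ! i) h) [0..<length ns])"
proof (rule tup_unique)
  show "fam W ns (map (\<lambda>i. cmp W Z [ns ! i] (fs ! i) h) [0..<length ns])"
    using fs h by (intro fam_map cmp_in) (auto simp: fam_def)
  show "cmp W Z ns (tup Z ns fs) h \<in> H W ns" using tup_in[OF fs] h by (rule cmp_in[rotated])
  fix i assume i: "i < length ns"
  show "cmp W ns [ns ! i] (pr ns i) (cmp W Z ns (tup Z ns fs) h) = map (\<lambda>i. cmp W Z [ns ! i] (fs ! i) h) [0..<length ns] ! i"
    using assoc[OF h tup_in[OF fs] pr_in[OF i]] pr_tup[OF fs i] i by simp
qed

text \<open>The operation on generalised elements that an arrow of \<M> induces. Equations of \<M>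
  thereby hold for elements at every stage (\<open>val_msubst\<close>), and these operations are
  stable under change of stage (\<open>val_cmp\<close>).\<close>

definition val :: "nat list \<Rightarrow> nat list \<Rightarrow> nat \<Rightarrow> 'a tm \<Rightarrow> 'a list \<Rightarrow> 'a" where
  "val Z X n t fs = cmp Z X [n] (marr X [n] [t]) (tup Z X fs)"

lemma val_in: "fam Z X fs \<Longrightarrow> wf_tm empty_signature X n t \<Longrightarrow> val Z X n t fs \<in> H Z [n]"
  unfolding val_def by (intro cmp_in tup_in marr_in single_tuples)

lemma val_meta_vars: "fam Z X fs \<Longrightarrow> i < length X \<Longrightarrow> X ! i = n \<Longrightarrow> val Z X n (meta_vars i n) fs = fs ! i"
  using pr_tup[of Z X fs i] by (auto simp: val_def pr_def)

lemma val_msubst: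
  assumes ss: "ss \<in> tuples empty_signature X Y" and t: "wf_tm empty_signature Y n t" and fs: "fam Z X fs"
  shows "val Z Y n t (map (\<lambda>i. val Z X (Y ! i) (ss ! i) fs) [0..<length Y]) = val Z X n (msubst (zip Y ss) t) fs"
proof -
  have "cmp Z X Y (marr X Y ss) (tup Z X fs) = tup Z Y (map (\<lambda>i. val Z X (Y ! i) (ss ! i) fs) [0..<length Y])"
  proof (rule tup_unique)
    show "fam Z Y (map (\<lambda>i. val Z X (Y ! i) (ss ! i) fs) [0..<length Y])"
      using val_in[OF fs tuples_wf[OF ss]] by (rule fam_map)
    show "cmp Z X Y (marr X Y ss) (tup Z X fs) \<in> H Z Y"
      by (intro cmp_in marr_in tup_in ss fs)
    fix i assume i: "i < length Y"
    show "cmp Z Y [Y ! i] (pr Y i) (cmp Z X Y (marr X Y ss) (tup Z X fs))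
        = map (\<lambda>i. val Z X (Y ! i) (ss ! i) fs) [0..<length Y] ! i"
      using assoc[OF tup_in[OF fs] marr_in[OF ss] pr_in[OF i]] pr_marr[OF ss i] i by (simp add: val_def)
  qed
  then show ?thesis
    using assoc[OF tup_in[OF fs] marr_in[OF ss] marr_in[OF single_tuples[OF t]]]
      marr_comp[OF ss single_tuples[OF t]]
    by (simp add: val_def)
qed

lemma val_cmp:
  assumes fs: "fam Z X fs" and t: "wf_tm empty_signature X n t" and h: "h \<in> H W Z"
  shows "cmp W Z [n] (val Z X n t fs) h = val W X n t (map (\<lambda>i. cmp W Z [X ! i] (fs ! i) h) [0..<length X])"
  unfolding val_def tup_cmp[OF fs h, symmetric]
  by (rule assoc[OF h tup_in[OF fs] marr_in[OF single_tuples[OF t]], symmetric])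

section \<open>Application of a generalised element of \<open>[a]\<close> to \<open>a\<close>
  arguments\<close>

definition app :: "nat list \<Rightarrow> nat \<Rightarrow> 'a \<Rightarrow> 'a list \<Rightarrow> 'a" where
  "app Z a g us = val Z (a # replicate a 0) 0 (app_tm a) (g # us)"

definition args :: "nat list \<Rightarrow> nat \<Rightarrow> 'a list \<Rightarrow> bool" where
  "args Z a us \<longleftrightarrow> length us = a \<and> set us \<subseteq> H Z [0]"

lemma fam_app: "g \<in> H Z [a] \<Longrightarrow> args Z a us \<Longrightarrow> fam Z (a # replicate a 0) (g # us)"
proof (rule famI)
  fix i assume "g \<in> H Z [a]" "args Z a us" "i < length (a # replicate a 0)"
  then show "(g # us) ! i \<in> H Z [(a # replicate a 0) ! i]"
    by (cases i) (auto simp: args_def)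
qed (auto simp: args_def)

lemma app_in: "g \<in> H Z [a] \<Longrightarrow> args Z a us \<Longrightarrow> app Z a g us \<in> H Z [0]"
  unfolding app_def by (intro val_in fam_app wf_app_tm)

lemma app_cmp:
  assumes g: "g \<in> H Z [a]" and us: "args Z a us" and h: "h \<in> H W Z"
  shows "cmp W Z [0] (app Z a g us) h = app W a (cmp W Z [a] g h) (map (\<lambda>u. cmp W Z [0] u h) us)"
proof -
  have "map (\<lambda>i. cmp W Z [(a # replicate a 0) ! i] ((g # us) ! i) h) [0..<length (a # replicate a 0)]
      = cmp W Z [a] g h # map (\<lambda>u. cmp W Z [0] u h) us"
  proof (rule nth_equalityI)
    show "length (map (\<lambda>i. cmp W Z [(a # replicate a 0) ! i] ((g # us) ! i) h) [0..<length (a # replicate a 0)])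
        = length (cmp W Z [a] g h # map (\<lambda>u. cmp W Z [0] u h) us)"
      using us by (simp add: args_def)
    fix i assume "i < length (map (\<lambda>i. cmp W Z [(a # replicate a 0) ! i] ((g # us) ! i) h) [0..<length (a # replicate a 0)])"
    then have i: "i < Suc a" by simp
    then show "map (\<lambda>i. cmp W Z [(a # replicate a 0) ! i] ((g # us) ! i) h) [0..<length (a # replicate a 0)] ! i
        = (cmp W Z [a] g h # map (\<lambda>u. cmp W Z [0] u h) us) ! i"
      using us by (cases i) (simp_all add: args_def del: upt_Suc)
  qed
  then show ?thesis
    unfolding app_def using val_cmp[OF fam_app[OF g us] wf_app_tm h] by simp
qed

lemma app_0: "g \<in> H Z [0] \<Longrightarrow> app Z 0 g [] = g"
  using val_meta_vars[OF fam_app[of g Z 0 "[]"], of 0 0]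
  by (simp add: app_def app_tm_def meta_vars_def args_def)

text \<open>The term is the component of \<open>M_ev [m]\<close>, so this is evaluation for the
  exponential of \<open>[m]\<close> by \<open>[0]\<close>: it consumes the last argument and leaves
  \<open>m\<close> of them.\<close>

definition evl :: "nat list \<Rightarrow> nat \<Rightarrow> 'a \<Rightarrow> 'a \<Rightarrow> 'a" where
  "evl Z m g u = val Z [Suc m, 0] m (Meta 0 (map Var [0..<m] @ [Meta 1 []])) [g, u]"

lemma wf_ev: "wf_tm empty_signature [Suc m, 0] m (Meta 0 (map Var [0..<m] @ [Meta 1 []]))"
  by auto

lemma fam2: "g \<in> H Z [a] \<Longrightarrow> u \<in> H Z [b] \<Longrightarrow> fam Z [a, b] [g, u]"
  by (auto intro!: famI simp: less_Suc_eq)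

lemma evl_in: "g \<in> H Z [Suc m] \<Longrightarrow> u \<in> H Z [0] \<Longrightarrow> evl Z m g u \<in> H Z [m]"
  unfolding evl_def by (intro val_in fam2 wf_ev)

lemma evl_cmp:
  assumes g: "g \<in> H Z [Suc m]" and u: "u \<in> H Z [0]" and h: "h \<in> H W Z"
  shows "cmp W Z [m] (evl Z m g u) h = evl W m (cmp W Z [Suc m] g h) (cmp W Z [0] u h)"
  unfolding evl_def using val_cmp[OF fam2[OF g u] wf_ev h] by simp

text \<open>An equation of \<M>: both sides are values of operator-free terms over the same
  elements, and metasubstituting the partial evaluation \<open>?e\<close> into
  \<open>app_tm m\<close> yields \<open>app_tm (Suc m)\<close>.\<close>

lemma app_Suc:
  assumes g: "g \<in> H Z [Suc m]" and us: "args Z m us" and u: "u \<in> H Z [0]"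
  shows "app Z (Suc m) g (us @ [u]) = app Z m (evl Z m g u) us"
proof -
  define X where "X = Suc m # replicate (Suc m) (0 :: nat)"
  have X: "length X = Suc (Suc m)" "X ! 0 = Suc m" "\<And>j. j < Suc m \<Longrightarrow> X ! Suc j = 0" "X \<noteq> []"
    by (simp_all add: X_def del: replicate_Suc)
  let ?fs = "g # us @ [u]"
  have len: "length us = m" using us by (simp add: args_def)
  have fs: "fam Z X ?fs"
    unfolding X_def using us u by (intro fam_app g) (auto simp: args_def)
  let ?e = "Meta 0 (map Var [0..<m] @ [Meta (Suc m) []])"
  have e: "evl Z m g u = val Z X m ?e ?fs"
  proof -
    have ss: "[meta_vars 0 (Suc m), Meta (Suc m) []] \<in> tuples empty_signature X [Suc m, 0]"
      by (auto intro!: tuplesI wf_meta_vars simp: less_Suc_eq X)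
    have "val Z X (Suc m) (meta_vars 0 (Suc m)) ?fs = g"
      using val_meta_vars[OF fs, of 0 "Suc m"] by (simp add: X)
    moreover have "val Z X 0 (Meta (Suc m) []) ?fs = u"
      using val_meta_vars[OF fs, of "Suc m" 0] len by (simp add: X meta_vars_def nth_append)
    ultimately have vs: "map (\<lambda>i. val Z X ([Suc m, 0] ! i) ([meta_vars 0 (Suc m), Meta (Suc m) []] ! i) ?fs)
        [0..<length [Suc m, 0]] = [g, u]"
      by simp
    have ms: "msubst (zip [Suc m, 0] [meta_vars 0 (Suc m), Meta (Suc m) []]) (Meta 0 (map Var [0..<m] @ [Meta 1 []])) = ?e"
      by (simp add: subst_meta_vars inst_def nth_append comp_def)
    from val_msubst[OF ss wf_ev fs] show ?thesis unfolding vs ms by (simp add: evl_def)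
  qed
  let ?Y = "m # replicate m 0"
  let ?ss = "?e # map (\<lambda>j. Meta (Suc j) []) [0..<m]"
  have ss: "?ss \<in> tuples empty_signature X ?Y"
  proof (rule tuplesI)
    fix i assume "i < length ?Y"
    then show "wf_tm empty_signature X (?Y ! i) (?ss ! i)" by (cases i) (auto simp: X)
  qed simp
  have vs: "map (\<lambda>i. val Z X (?Y ! i) (?ss ! i) ?fs) [0..<length ?Y] = evl Z m g u # us"
  proof (rule nth_equalityI)
    fix i assume i: "i < length (map (\<lambda>i. val Z X (?Y ! i) (?ss ! i) ?fs) [0..<length ?Y])"
    show "map (\<lambda>i. val Z X (?Y ! i) (?ss ! i) ?fs) [0..<length ?Y] ! i = (evl Z m g u # us) ! i"
    proof (cases i)
      case 0
      then show ?thesis by (simp add: e del: upt_Suc)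
    next
      case (Suc j)
      then have "val Z X 0 (Meta i []) ?fs = us ! j"
        using val_meta_vars[OF fs, of i 0] i len by (simp add: X meta_vars_def nth_append)
      then show ?thesis using Suc i by (simp del: upt_Suc)
    qed
  qed (simp add: len)
  have "msubst (zip ?Y ?ss) (app_tm m) = app_tm (Suc m)"
  proof -
    have "msubst (zip ?Y ?ss) (app_tm m) = subst (inst (map (\<lambda>j. Meta (Suc j) []) [0..<m])) ?e"
      by (rule msubst_app_tm) simp
    also have "\<dots> = app_tm (Suc m)" by (auto simp: app_tm_def inst_def)
    finally show ?thesis .
  qed
  then have ms: "msubst (zip ?Y ?ss) (app_tm m) = app_tm (Suc m)" .
  from val_msubst[OF ss wf_app_tm fs] show ?thesis
    unfolding vs ms by (simp add: app_def X_def)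
qed

section \<open>Extended stages: weakening, variables and pairing\<close>

definition wk :: "nat list \<Rightarrow> nat \<Rightarrow> 'a" where
  "wk Z m = marr (ext Z m) Z (ids Z)"

text \<open>Bound variables are stored in reverse order, so that a further binder extends the list of
  objects at its end.\<close>

definition var :: "nat list \<Rightarrow> nat \<Rightarrow> nat \<Rightarrow> 'a" where
  "var Z m j = pr (ext Z m) (length Z + (m - 1 - j))"

lemma ids_tuples_ext: "ids Z \<in> tuples S (ext Z m) Z"
  by (auto intro!: tuplesI wf_meta_vars simp: nth_ext)

lemma wk_in: "wk Z m \<in> H (ext Z m) Z"
  unfolding wk_def by (intro marr_in ids_tuples_ext)

lemma pr_wk: "i < length Z \<Longrightarrow> cmp (ext Z m) Z [Z ! i] (pr Z i) (wk Z m) = pr (ext Z m) i"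
  unfolding wk_def by (subst pr_marr[OF ids_tuples_ext]) (auto simp: pr_def nth_ext)

lemma var_in: "j < m \<Longrightarrow> var Z m j \<in> H (ext Z m) [0]"
  unfolding var_def using pr_in[of "length Z + (m - 1 - j)" "ext Z m"] by (simp add: nth_ext)

definition vars :: "nat list \<Rightarrow> nat \<Rightarrow> 'a list" where
  "vars Z m = map (var Z m) [0..<m]"

lemma args_vars: "args (ext Z m) m (vars Z m)"
  by (auto simp: args_def vars_def var_in)

text \<open>Instantiates the \<open>m\<close> added variables by \<open>us\<close> over the arrow
  \<open>h\<close>; \<open>rev\<close> matches the order in which \<open>var\<close> numbers
  them.\<close>

definition pair :: "nat list \<Rightarrow> nat list \<Rightarrow> nat \<Rightarrow> 'a \<Rightarrow> 'a list \<Rightarrow> 'a" where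
  "pair W Z m h us = tup W (ext Z m) (map (\<lambda>i. cmp W Z [Z ! i] (pr Z i) h) [0..<length Z] @ rev us)"

lemma fam_pair:
  assumes "h \<in> H W Z" "args W m us"
  shows "fam W (ext Z m) (map (\<lambda>i. cmp W Z [Z ! i] (pr Z i) h) [0..<length Z] @ rev us)"
proof (rule famI)
  fix i assume i: "i < length (ext Z m)"
  show "(map (\<lambda>i. cmp W Z [Z ! i] (pr Z i) h) [0..<length Z] @ rev us) ! i \<in> H W [ext Z m ! i]"
  proof (cases "i < length Z")
    case True
    then show ?thesis using assms(1) pr_in[OF True] by (auto simp: nth_append nth_ext intro: cmp_in)
  next
    case False
    then have "rev us ! (i - length Z) \<in> set (rev us)"
      using assms(2) i by (intro nth_mem) (auto simp: args_def)
    then show ?thesis using assms(2) i False by (auto simp: nth_append nth_ext args_def)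
  qed
qed (use assms in \<open>auto simp: args_def\<close>)

lemma pair_in: "h \<in> H W Z \<Longrightarrow> args W m us \<Longrightarrow> pair W Z m h us \<in> H W (ext Z m)"
  unfolding pair_def by (intro tup_in fam_pair)

lemma wk_pair:
  assumes h: "h \<in> H W Z" and us: "args W m us"
  shows "cmp W (ext Z m) Z (wk Z m) (pair W Z m h us) = h"
proof (rule arr_eqI)
  show "cmp W (ext Z m) Z (wk Z m) (pair W Z m h us) \<in> H W Z" by (intro cmp_in pair_in wk_in h us)
  fix i assume i: "i < length Z"
  then show "cmp W Z [Z ! i] (pr Z i) (cmp W (ext Z m) Z (wk Z m) (pair W Z m h us)) = cmp W Z [Z ! i] (pr Z i) h"
    using assoc[OF pair_in[OF h us] wk_in pr_in[OF i]] pr_wk[OF i, of m] pr_tup[OF fam_pair[OF h us], of i]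
    by (simp add: pair_def nth_append nth_ext)
qed (rule h)

lemma var_pair:
  assumes h: "h \<in> H W Z" and us: "args W m us" and j: "j < m"
  shows "cmp W (ext Z m) [0] (var Z m j) (pair W Z m h us) = us ! j"
proof -
  define p where "p = m - 1 - j"
  have p: "p < m" "m - Suc p = j" using j by (auto simp: p_def)
  show ?thesis
    unfolding var_def p_def[symmetric] pair_def
    using pr_tup[OF fam_pair[OF h us], of "length Z + p"] us p
    by (simp add: nth_ext nth_append rev_nth args_def)
qed

text \<open>The exponential property for the target \<open>[m]\<close>, restated with
  \<open>evl\<close> so that it can be iterated on generalised elements.\<close>

lemma exponential_T:
  assumes f: "f \<in> H (B @ [0]) [m]"
  shows "\<exists>!g. g \<in> H B [Suc m] \<and> evl (B @ [0]) m (cmp (B @ [0]) B [Suc m] g (wk B 1)) (var B 1 0) = f"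
proof -
  have e1: "ext B 1 = B @ [0]" by (simp add: ext_def)
  have wk: "wk B 1 = proj1 (tcart T) B [0]" "var B 1 0 = proj2 (tcart T) B [0]"
    unfolding wk_def var_def pr_def proj1_T proj2_T proj1_M_cart e1 by (simp_all add: M_cart_def)
  have "\<forall>ms. is_exponential (tcat T) (tcart T) [0] ms (map Suc ms) (marr (map Suc ms @ [0]) ms (M_ev ms))"
    using T by (simp add: is_so_theory_def M_exp_def)
  from spec[OF this, of "[m]"]
  have "is_exponential (tcat T) (tcart T) [0] [m] [Suc m] (marr ([Suc m] @ [0]) [m] (M_ev [m]))"
    by simp
  then have ex: "\<exists>!g. g \<in> H B [Suc m] \<and>
      cmp (B @ [0]) [Suc m, 0] [m] (marr [Suc m, 0] [m] (M_ev [m])) (prod_left (tcat T) (tcart T) B [Suc m] [0] g) = f"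
    using f unfolding is_exponential_def prodobj_T by simp
  have "prod_left (tcat T) (tcart T) B [Suc m] [0] g
      = tup (B @ [0]) [Suc m, 0] [cmp (B @ [0]) B [Suc m] g (wk B 1), var B 1 0]" if g: "g \<in> H B [Suc m]" for g
  proof -
    \<comment> \<open>For a list of two objects the conditions that define \<open>tup\<close> are
      those that define \<open>prod_left\<close>, so both descriptions denote the same
      arrow.\<close>
    have "(\<forall>i<length [Suc m, 0]. cmp (B @ [0]) [Suc m, 0] [[Suc m, 0] ! i] (pr [Suc m, 0] i) h
          = [cmp (B @ [0]) B [Suc m] g (wk B 1), var B 1 0] ! i)
      \<longleftrightarrow> cmp (B @ [0]) [Suc m, 0] [Suc m] (pr [Suc m, 0] 0) h = cmp (B @ [0]) B [Suc m] g (wk B 1) \<and>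
          cmp (B @ [0]) [Suc m, 0] [0] (pr [Suc m, 0] 1) h = var B 1 0" for h
      by (auto simp: less_Suc_eq)
    then show ?thesis
      unfolding prod_left_def tup_def wk[symmetric] prodobj_T proj1_T[of "[Suc m]"] proj2_T[of "[Suc m]"]
      by (simp add: pr_def M_cart_def)
  qed
  then have "(g \<in> H B [Suc m] \<and> cmp (B @ [0]) [Suc m, 0] [m] (marr [Suc m, 0] [m] (M_ev [m])) (prod_left (tcat T) (tcart T) B [Suc m] [0] g) = f)
     \<longleftrightarrow> (g \<in> H B [Suc m] \<and> evl (B @ [0]) m (cmp (B @ [0]) B [Suc m] g (wk B 1)) (var B 1 0) = f)" for g
    by (auto simp: evl_def val_def M_ev_def)
  with ex show ?thesis by simp
qed

section \<open>Iterated transposition\<close>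

lemma wk_Suc: "wk Z (Suc m) = cmp (ext (Z @ [0]) m) (Z @ [0]) Z (wk Z 1) (wk (Z @ [0]) m)"
proof (rule arr_eqI)
  have e1: "ext Z 1 = Z @ [0]" by (simp add: ext_def)
  have w1: "wk Z 1 \<in> H (Z @ [0]) Z" using wk_in[of Z 1] by (simp only: e1)
  show "wk Z (Suc m) \<in> H (ext (Z @ [0]) m) Z" using wk_in[of Z "Suc m"] by (simp add: ext_Suc)
  show "cmp (ext (Z @ [0]) m) (Z @ [0]) Z (wk Z 1) (wk (Z @ [0]) m) \<in> H (ext (Z @ [0]) m) Z"
    by (intro cmp_in wk_in w1)
  fix i assume i: "i < length Z"
  have "cmp (Z @ [0]) Z [Z ! i] (pr Z i) (wk Z 1) = pr (Z @ [0]) i"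
    using pr_wk[OF i, of 1] by (simp only: e1)
  then show "cmp (ext (Z @ [0]) m) Z [Z ! i] (pr Z i) (wk Z (Suc m)) =
      cmp (ext (Z @ [0]) m) Z [Z ! i] (pr Z i) (cmp (ext (Z @ [0]) m) (Z @ [0]) Z (wk Z 1) (wk (Z @ [0]) m))"
    using assoc[OF wk_in w1 pr_in[OF i], of m] pr_wk[OF i, of "Suc m"] pr_wk[of i "Z @ [0]" m] i
    by (simp add: ext_Suc nth_append)
qed

text \<open>The first object added to the stage carries the last variable. This is the argument that
  \<open>evl\<close> consumes first, which is why the reversed order fits the iteration.\<close>

lemma vars_Suc:
  "vars Z (Suc m) = vars (Z @ [0]) m @ [cmp (ext (Z @ [0]) m) (Z @ [0]) [0] (var Z 1 0) (wk (Z @ [0]) m)]"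
proof -
  have "cmp (ext (Z @ [0]) m) (Z @ [0]) [0] (var Z 1 0) (wk (Z @ [0]) m) = var Z (Suc m) m"
    using pr_wk[of "length Z" "Z @ [0]" m] by (simp add: var_def ext_def nth_append)
  moreover have "var Z (Suc m) j = var (Z @ [0]) m j" if "j < m" for j
    using that by (simp add: var_def ext_Suc Suc_diff_Suc)
  ultimately show ?thesis by (simp add: vars_def)
qed

text \<open>Iterating the single transpose makes \<open>[m]\<close> an exponential of
  \<open>[0]\<close> by \<open>m\<close> copies of \<open>[0]\<close>. In the step the induction
  hypothesis inverts application to the first \<open>m\<close> variables, and the exponential
  property inverts application to the last.\<close>

lemma lam_ex1:
  "f \<in> H (ext Z m) [0] \<Longrightarrow>
   \<exists>!g. g \<in> H Z [m] \<and> app (ext Z m) m (cmp (ext Z m) Z [m] g (wk Z m)) (vars Z m) = f"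
proof (induction m arbitrary: Z f)
  case 0
  have "app Z 0 (cmp Z Z [0] g (wk Z 0)) (vars Z 0) = g" if "g \<in> H Z [0]" for g
    using that by (simp add: wk_def marr_ids vars_def cmp_Id app_0)
  with 0 show ?case by auto
next
  case (Suc m)
  let ?B = "Z @ [0]"
  let ?E = "ext ?B m"
  have e1: "ext Z 1 = ?B" by (simp add: ext_def)
  have w1: "wk Z 1 \<in> H ?B Z" using wk_in[of Z 1] by (simp only: e1)
  have v1: "var Z 1 0 \<in> H ?B [0]" using var_in[of 0 1 Z] by (simp only: e1)
  \<comment> \<open>Application to the last variable only; by the exponential property it is a
    bijection from arrows into \<open>[Suc m]\<close> at \<open>Z\<close> to arrows into
    \<open>[m]\<close> at \<open>?B\<close>.\<close>
  define c where "c g = evl ?B m (cmp ?B Z [Suc m] g (wk Z 1)) (var Z 1 0)" for g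
  have c: "c g \<in> H ?B [m]" if "g \<in> H Z [Suc m]" for g
    unfolding c_def by (intro evl_in cmp_in that w1 v1)
  have eq: "app ?E (Suc m) (cmp ?E Z [Suc m] g (wk Z (Suc m))) (vars Z (Suc m))
      = app ?E m (cmp ?E ?B [m] (c g) (wk ?B m)) (vars ?B m)" if g: "g \<in> H Z [Suc m]" for g
  proof -
    have gw: "cmp ?B Z [Suc m] g (wk Z 1) \<in> H ?B [Suc m]" by (intro cmp_in g w1)
    have "app ?E (Suc m) (cmp ?E Z [Suc m] g (wk Z (Suc m))) (vars Z (Suc m))
        = app ?E m (evl ?E m (cmp ?E Z [Suc m] g (wk Z (Suc m))) (cmp ?E ?B [0] (var Z 1 0) (wk ?B m))) (vars ?B m)"
      unfolding vars_Suc
      by (intro app_Suc args_vars cmp_in wk_in g v1) (simp add: wk_in ext_Suc[symmetric])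
    moreover have a1: "cmp ?E Z [Suc m] g (wk Z (Suc m)) = cmp ?E ?B [Suc m] (cmp ?B Z [Suc m] g (wk Z 1)) (wk ?B m)"
      unfolding wk_Suc by (rule assoc[OF wk_in w1 g])
    moreover have a2: "evl ?E m (cmp ?E ?B [Suc m] (cmp ?B Z [Suc m] g (wk Z 1)) (wk ?B m))
        (cmp ?E ?B [0] (var Z 1 0) (wk ?B m)) = cmp ?E ?B [m] (c g) (wk ?B m)"
      unfolding c_def by (rule evl_cmp[OF gw v1 wk_in, symmetric])
    ultimately show ?thesis unfolding a1 a2 by simp
  qed
  from Suc.prems have f: "f \<in> H ?E [0]" by (simp add: ext_Suc)
  obtain k where k: "k \<in> H ?B [m]" "app ?E m (cmp ?E ?B [m] k (wk ?B m)) (vars ?B m) = f"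
    and ku: "\<And>k'. k' \<in> H ?B [m] \<Longrightarrow> app ?E m (cmp ?E ?B [m] k' (wk ?B m)) (vars ?B m) = f \<Longrightarrow> k' = k"
    using Suc.IH[OF f] by blast
  have "\<exists>!g. g \<in> H Z [Suc m] \<and> c g = k"
    using exponential_T[OF k(1)] by (simp add: c_def)
  moreover have "(g \<in> H Z [Suc m] \<and> c g = k) \<longleftrightarrow>
      (g \<in> H Z [Suc m] \<and> app ?E (Suc m) (cmp ?E Z [Suc m] g (wk Z (Suc m))) (vars Z (Suc m)) = f)" for g
  proof (cases "g \<in> H Z [Suc m]")
    case True
    have "c g = k \<longleftrightarrow> app ?E m (cmp ?E ?B [m] (c g) (wk ?B m)) (vars ?B m) = f"
      using ku[OF c[OF True]] k(2) by metis
    then show ?thesis unfolding eq[OF True] by simp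
  qed simp
  ultimately show ?case unfolding ext_Suc by simp
qed

definition lam :: "nat list \<Rightarrow> nat \<Rightarrow> 'a \<Rightarrow> 'a" where
  "lam Z m f = (THE g. g \<in> H Z [m] \<and> app (ext Z m) m (cmp (ext Z m) Z [m] g (wk Z m)) (vars Z m) = f)"

lemma lam_in: "f \<in> H (ext Z m) [0] \<Longrightarrow> lam Z m f \<in> H Z [m]"
  and app_lam: "f \<in> H (ext Z m) [0] \<Longrightarrow> app (ext Z m) m (cmp (ext Z m) Z [m] (lam Z m f) (wk Z m)) (vars Z m) = f"
  using theI'[OF lam_ex1] by (auto simp: lam_def)

lemma lam_unique:
  assumes "g \<in> H Z [m]" "app (ext Z m) m (cmp (ext Z m) Z [m] g (wk Z m)) (vars Z m) = f"
  shows "g = lam Z m f"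
proof -
  have "f \<in> H (ext Z m) [0]" using assms args_vars wk_in by (blast intro: app_in cmp_in)
  from lam_ex1[OF this] show ?thesis
    using lam_in[OF \<open>f \<in> _\<close>] app_lam[OF \<open>f \<in> _\<close>] assms by blast
qed

section \<open>The beta law and naturality of abstraction\<close>

lemma vars_pair:
  assumes "h \<in> H W Z" "args W m us"
  shows "map (\<lambda>u. cmp W (ext Z m) [0] u (pair W Z m h us)) (vars Z m) = us"
  using var_pair[OF assms] assms(2) by (intro nth_equalityI) (auto simp: vars_def args_def)

text \<open>Any application is the generic one, to the variables of the extended stage, pulled back
  along \<open>pair\<close>. Together with \<open>app_lam\<close> this gives the beta law at every
  stage.\<close>

lemma app_pair:
  assumes g: "g \<in> H Z [m]" and h: "h \<in> H W Z" and us: "args W m us"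
  shows "app W m (cmp W Z [m] g h) us
    = cmp W (ext Z m) [0] (app (ext Z m) m (cmp (ext Z m) Z [m] g (wk Z m)) (vars Z m)) (pair W Z m h us)"
  using app_cmp[OF cmp_in[OF wk_in g] args_vars pair_in[OF h us]] vars_pair[OF h us]
    assoc[OF pair_in[OF h us] wk_in g] wk_pair[OF h us] by simp

lemma app_lam_pair:
  assumes f: "f \<in> H (ext Z m) [0]" and h: "h \<in> H W Z" and us: "args W m us"
  shows "app W m (cmp W Z [m] (lam Z m f) h) us = cmp W (ext Z m) [0] f (pair W Z m h us)"
  using app_pair[OF lam_in[OF f] h us] app_lam[OF f] by simp

text \<open>The product of \<open>h\<close> with the identity on the \<open>m\<close> added copies
  of \<open>[0]\<close>.\<close>

definition lift :: "nat list \<Rightarrow> nat list \<Rightarrow> nat \<Rightarrow> 'a \<Rightarrow> 'a" where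
  "lift W Z m h = pair (ext W m) Z m (cmp (ext W m) W Z h (wk W m)) (vars W m)"

lemma lift_in: "h \<in> H W Z \<Longrightarrow> lift W Z m h \<in> H (ext W m) (ext Z m)"
  unfolding lift_def by (intro pair_in cmp_in wk_in args_vars)

text \<open>Naturality of the transpose, by its uniqueness: the beta law computes the application of
  the left side to the generic variables.\<close>

lemma lam_cmp:
  assumes f: "f \<in> H (ext Z m) [0]" and h: "h \<in> H W Z"
  shows "cmp W Z [m] (lam Z m f) h = lam W m (cmp (ext W m) (ext Z m) [0] f (lift W Z m h))"
proof (rule lam_unique)
  show "cmp W Z [m] (lam Z m f) h \<in> H W [m]" by (intro cmp_in lam_in f h)
  show "app (ext W m) m (cmp (ext W m) W [m] (cmp W Z [m] (lam Z m f) h) (wk W m)) (vars W m)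
      = cmp (ext W m) (ext Z m) [0] f (lift W Z m h)"
    unfolding lift_def assoc[OF wk_in h lam_in[OF f], symmetric]
    by (intro app_lam_pair f cmp_in wk_in h args_vars)
qed

lemma wk_lift: "h \<in> H W Z \<Longrightarrow> cmp (ext W m) (ext Z m) Z (wk Z m) (lift W Z m h) = cmp (ext W m) W Z h (wk W m)"
  unfolding lift_def by (intro wk_pair cmp_in wk_in args_vars)

lemma var_lift: "h \<in> H W Z \<Longrightarrow> j < m \<Longrightarrow> cmp (ext W m) (ext Z m) [0] (var Z m j) (lift W Z m h) = var W m j"
  unfolding lift_def var_pair[OF cmp_in[OF wk_in] args_vars] by (simp add: vars_def)

end

section \<open>Interpretation of terms in a theory\<close>

context so_theory
begin

definition up_meta :: "nat list \<Rightarrow> nat list \<Rightarrow> nat \<Rightarrow> (nat \<Rightarrow> 'a) \<Rightarrow> nat \<Rightarrow> 'a" where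
  "up_meta \<Theta> Z m \<phi> k = cmp (ext Z m) Z [\<Theta> ! k] (\<phi> k) (wk Z m)"

definition up_env :: "nat list \<Rightarrow> nat \<Rightarrow> (nat \<Rightarrow> 'a) \<Rightarrow> nat \<Rightarrow> 'a" where
  "up_env Z m e j = (if j < m then var Z m j else cmp (ext Z m) Z [0] (e (j - m)) (wk Z m))"

text \<open>The interpretation is given at a stage \<open>Z\<close>: \<open>\<phi>\<close> and \<open>e\<close> assign generalised elements over
  \<open>Z\<close> to the metavariables and to the variables, and \<open>\<sigma> f : arity f \<rightarrow> [0]\<close> interprets the
  operators. A binder extends the stage.\<close>

fun sem :: "('o \<Rightarrow> 'a) \<Rightarrow> nat list \<Rightarrow> nat list \<Rightarrow> (nat \<Rightarrow> 'a) \<Rightarrow> (nat \<Rightarrow> 'a) \<Rightarrow> 'o tm \<Rightarrow> 'a" where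
  "sem \<sigma> \<Theta> Z \<phi> e (Var i) = e i"
| "sem \<sigma> \<Theta> Z \<phi> e (Meta k ts) = app Z (\<Theta> ! k) (\<phi> k) (map (sem \<sigma> \<Theta> Z \<phi> e) ts)"
| "sem \<sigma> \<Theta> Z \<phi> e (Op f bs) = cmp Z (map fst bs) [0] (\<sigma> f) (tup Z (map fst bs)
     (map (\<lambda>(m, t). lam Z m (sem \<sigma> \<Theta> (ext Z m) (up_meta \<Theta> Z m \<phi>) (up_env Z m e) t)) bs))"

definition menv :: "nat list \<Rightarrow> nat list \<Rightarrow> (nat \<Rightarrow> 'a) \<Rightarrow> bool" where
  "menv \<Theta> Z \<phi> \<longleftrightarrow> (\<forall>k<length \<Theta>. \<phi> k \<in> H Z [\<Theta> ! k])"

definition venv :: "nat \<Rightarrow> nat list \<Rightarrow> (nat \<Rightarrow> 'a) \<Rightarrow> bool" where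
  "venv n Z e \<longleftrightarrow> (\<forall>i<n. e i \<in> H Z [0])"

lemma menv_up: "menv \<Theta> Z \<phi> \<Longrightarrow> menv \<Theta> (ext Z m) (up_meta \<Theta> Z m \<phi>)"
  using wk_in cmp_in unfolding menv_def up_meta_def by blast

lemma venv_up: "venv n Z e \<Longrightarrow> venv (n + m) (ext Z m) (up_env Z m e)"
  unfolding venv_def up_env_def using wk_in cmp_in var_in by auto

lemma sem_Op_cong:
  assumes "\<And>m t. (m, t) \<in> set bs \<Longrightarrow>
      sem \<sigma> \<Theta> (ext Z m) (up_meta \<Theta> Z m \<phi>) (up_env Z m e) t = sem \<sigma> \<Theta>' (ext Z m) (up_meta \<Theta>' Z m \<phi>') (up_env Z m e') (F m t)"
  shows "sem \<sigma> \<Theta> Z \<phi> e (Op f bs) = sem \<sigma> \<Theta>' Z \<phi>' e' (Op f (map (\<lambda>(m, t). (m, F m t)) bs))"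
proof -
  have "map fst (map (\<lambda>(m, t). (m, F m t)) bs) = map fst bs" by auto
  moreover have "map (\<lambda>(m, t). lam Z m (sem \<sigma> \<Theta> (ext Z m) (up_meta \<Theta> Z m \<phi>) (up_env Z m e) t)) bs
     = map (\<lambda>(m, t). lam Z m (sem \<sigma> \<Theta>' (ext Z m) (up_meta \<Theta>' Z m \<phi>') (up_env Z m e') t)) (map (\<lambda>(m, t). (m, F m t)) bs)"
    using assms by (auto simp: case_prod_unfold)
  ultimately show ?thesis by (simp only: sem.simps)
qed

lemma sem_cong:
  "wf_tm S \<Theta> n t \<Longrightarrow> (\<And>k. k < length \<Theta> \<Longrightarrow> \<phi> k = \<phi>' k) \<Longrightarrow> (\<And>i. i < n \<Longrightarrow> e i = e' i)
   \<Longrightarrow> sem \<sigma> \<Theta> Z \<phi> e t = sem \<sigma> \<Theta> Z \<phi>' e' t"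
proof (induction t arbitrary: n Z \<phi> \<phi>' e e' rule: tm_induct)
  case (Meta k ts)
  have "sem \<sigma> \<Theta> Z \<phi> e t = sem \<sigma> \<Theta> Z \<phi>' e' t" if "t \<in> set ts" for t
    using Meta.prems that by (intro Meta.IH[OF that, of n]) auto
  then show ?case using Meta.prems(1) Meta.prems(2)[of k] by (simp cong: map_cong)
next
  case (Op f bs)
  have "sem \<sigma> \<Theta> (ext Z m) (up_meta \<Theta> Z m \<phi>) (up_env Z m e) t = sem \<sigma> \<Theta> (ext Z m) (up_meta \<Theta> Z m \<phi>') (up_env Z m e') t"
    if "(m, t) \<in> set bs" for m t
  proof (rule Op.IH[OF that, of "n + m"])
    show "wf_tm S \<Theta> (n + m) t" using Op.prems(1) that by auto
    show "up_meta \<Theta> Z m \<phi> k = up_meta \<Theta> Z m \<phi>' k" if "k < length \<Theta>" for k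
      using Op.prems(2)[OF that] by (simp add: up_meta_def)
    show "up_env Z m e i = up_env Z m e' i" if "i < n + m" for i
      using Op.prems(3)[of "i - m"] that by (auto simp: up_env_def)
  qed
  from sem_Op_cong[of bs \<sigma> \<Theta> Z \<phi> e \<Theta> \<phi>' e' "\<lambda>m t. t", OF this] show ?case by simp
qed auto

lemma sem_rename: "sem \<sigma> \<Theta> Z \<phi> e (rename r t) = sem \<sigma> \<Theta> Z \<phi> (\<lambda>i. e (r i)) t"
proof (induction t arbitrary: Z \<phi> e r rule: tm_induct)
  case (Op f bs)
  have "(\<lambda>i. up_env Z m e (up_ren m r i)) = up_env Z m (\<lambda>i. e (r i))" for m
    by (auto simp: up_env_def up_ren_def fun_eq_iff)
  then have "sem \<sigma> \<Theta> (ext Z m) (up_meta \<Theta> Z m \<phi>) (up_env Z m (\<lambda>i. e (r i))) t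
      = sem \<sigma> \<Theta> (ext Z m) (up_meta \<Theta> Z m \<phi>) (up_env Z m e) (rename (up_ren m r) t)"
    if "(m, t) \<in> set bs" for m t
    using Op.IH[OF that] by simp
  from sem_Op_cong[of bs \<sigma> \<Theta> Z \<phi> "\<lambda>i. e (r i)" \<Theta> \<phi> e "\<lambda>m. rename (up_ren m r)", OF this]
  show ?case by simp
qed (auto cong: map_cong simp: comp_def)

end

locale so_model = so_theory T for T :: "'a so_theory" +
  fixes S :: "'o signature" and \<sigma> :: "'o \<Rightarrow> 'a"
  assumes \<sigma>: "f \<in> ops S \<Longrightarrow> \<sigma> f \<in> H (arity S f) [0]"
begin

lemma args_map: "(\<And>t. t \<in> set ts \<Longrightarrow> F t \<in> H Z [0]) \<Longrightarrow> length ts = a \<Longrightarrow> args Z a (map F ts)"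
  by (auto simp: args_def)

lemma fam_binders:
  assumes "\<And>m t. (m, t) \<in> set bs \<Longrightarrow> F m t \<in> H Z [m]"
  shows "fam Z (map fst bs) (map (\<lambda>(m, t). F m t) bs)"
  using assms by (auto intro!: famI simp: case_prod_unfold)

lemma sem_in:
  "wf_tm S \<Theta> n t \<Longrightarrow> menv \<Theta> Z \<phi> \<Longrightarrow> venv n Z e \<Longrightarrow> sem \<sigma> \<Theta> Z \<phi> e t \<in> H Z [0]"
proof (induction t arbitrary: n Z \<phi> e rule: tm_induct)
  case (Var i)
  then show ?case by (simp add: venv_def)
next
  case (Meta k ts)
  have "sem \<sigma> \<Theta> Z \<phi> e t \<in> H Z [0]" if "t \<in> set ts" for t
    using Meta.prems that by (intro Meta.IH[OF that, of n]) auto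
  then show ?case using Meta.prems by (auto intro!: app_in args_map simp: menv_def)
next
  case (Op f bs)
  have "lam Z m (sem \<sigma> \<Theta> (ext Z m) (up_meta \<Theta> Z m \<phi>) (up_env Z m e) t) \<in> H Z [m]" if "(m, t) \<in> set bs" for m t
    using Op.prems that by (intro lam_in Op.IH[OF that, of "n + m"] menv_up venv_up) auto
  then have "fam Z (map fst bs) (map (\<lambda>(m, t). lam Z m (sem \<sigma> \<Theta> (ext Z m) (up_meta \<Theta> Z m \<phi>) (up_env Z m e) t)) bs)"
    by (rule fam_binders)
  then show ?case using Op.prems(1) \<sigma>[of f] unfolding sem.simps by (intro cmp_in tup_in) auto
qed

section \<open>Naturality in the stage, and the substitution lemmas\<close>

lemma up_meta_lift:
  assumes "menv \<Theta> Z \<phi>" "h \<in> H W Z" "k < length \<Theta>"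
  shows "cmp (ext W m) (ext Z m) [\<Theta> ! k] (up_meta \<Theta> Z m \<phi> k) (lift W Z m h)
    = up_meta \<Theta> W m (\<lambda>k. cmp W Z [\<Theta> ! k] (\<phi> k) h) k"
proof -
  have p: "\<phi> k \<in> H Z [\<Theta> ! k]" using assms by (simp add: menv_def)
  show ?thesis
    unfolding up_meta_def using assoc[OF lift_in[OF assms(2)] wk_in p] assoc[OF wk_in assms(2) p]
      wk_lift[OF assms(2)] by simp
qed

lemma up_env_lift:
  assumes "venv n Z e" "h \<in> H W Z" "i < n + m"
  shows "cmp (ext W m) (ext Z m) [0] (up_env Z m e i) (lift W Z m h) = up_env W m (\<lambda>i. cmp W Z [0] (e i) h) i"
proof (cases "i < m")
  case True
  then show ?thesis using var_lift[OF assms(2)] by (simp add: up_env_def)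
next
  case False
  then have p: "e (i - m) \<in> H Z [0]" using assms by (simp add: venv_def)
  show ?thesis
    unfolding up_env_def using False assoc[OF lift_in[OF assms(2)] wk_in p] assoc[OF wk_in assms(2) p]
      wk_lift[OF assms(2)] by simp
qed

text \<open>The interpretation is natural in the stage. Under a binder \<open>lam_cmp\<close>
  replaces \<open>h\<close> by its lift, and lifting commutes with extending the
  environments.\<close>

lemma sem_cmp:
  "wf_tm S \<Theta> n t \<Longrightarrow> menv \<Theta> Z \<phi> \<Longrightarrow> venv n Z e \<Longrightarrow> h \<in> H W Z \<Longrightarrow>
   cmp W Z [0] (sem \<sigma> \<Theta> Z \<phi> e t) h
     = sem \<sigma> \<Theta> W (\<lambda>k. cmp W Z [\<Theta> ! k] (\<phi> k) h) (\<lambda>i. cmp W Z [0] (e i) h) t"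
proof (induction t arbitrary: n Z W \<phi> e h rule: tm_induct)
  case (Meta k ts)
  have wf: "wf_tm S \<Theta> n t" if "t \<in> set ts" for t using Meta.prems(1) that by simp
  have "map (\<lambda>u. cmp W Z [0] u h) (map (sem \<sigma> \<Theta> Z \<phi> e) ts)
      = map (sem \<sigma> \<Theta> W (\<lambda>k. cmp W Z [\<Theta> ! k] (\<phi> k) h) (\<lambda>i. cmp W Z [0] (e i) h)) ts"
    using Meta.IH[OF _ wf Meta.prems(2-4)] by simp
  moreover have "args Z (\<Theta> ! k) (map (sem \<sigma> \<Theta> Z \<phi> e) ts)"
    using Meta.prems(1) sem_in[OF wf Meta.prems(2,3)] by (intro args_map) auto
  moreover have "\<phi> k \<in> H Z [\<Theta> ! k]" using Meta.prems by (simp add: menv_def)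
  ultimately show ?case
    unfolding sem.simps by (simp only: app_cmp[OF _ _ Meta.prems(4)])
next
  case (Op f bs)
  let ?\<phi> = "\<lambda>k. cmp W Z [\<Theta> ! k] (\<phi> k) h" and ?e = "\<lambda>i. cmp W Z [0] (e i) h"
  let ?l = "\<lambda>m t. lam Z m (sem \<sigma> \<Theta> (ext Z m) (up_meta \<Theta> Z m \<phi>) (up_env Z m e) t)"
  have wf: "wf_tm S \<Theta> (n + m) t" if "(m, t) \<in> set bs" for m t using Op.prems(1) that by auto
  have s: "sem \<sigma> \<Theta> (ext Z m) (up_meta \<Theta> Z m \<phi>) (up_env Z m e) t \<in> H (ext Z m) [0]" if "(m, t) \<in> set bs" for m t
    by (rule sem_in[OF wf[OF that] menv_up[OF Op.prems(2)] venv_up[OF Op.prems(3)]])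
  have l: "cmp W Z [m] (?l m t) h = lam W m (sem \<sigma> \<Theta> (ext W m) (up_meta \<Theta> W m ?\<phi>) (up_env W m ?e) t)"
    if b: "(m, t) \<in> set bs" for m t
    unfolding lam_cmp[OF s[OF b] Op.prems(4)]
      Op.IH[OF b wf[OF b] menv_up[OF Op.prems(2)] venv_up[OF Op.prems(3)] lift_in[OF Op.prems(4)]]
    using sem_cong[OF wf[OF b] up_meta_lift[OF Op.prems(2,4)] up_env_lift[OF Op.prems(3,4)]] by simp
  have fam: "fam Z (map fst bs) (map (\<lambda>(m, t). ?l m t) bs)"
    using s by (intro fam_binders lam_in)
  have "map (\<lambda>i. cmp W Z [map fst bs ! i] (map (\<lambda>(m, t). ?l m t) bs ! i) h) [0..<length (map fst bs)]
      = map (\<lambda>(m, t). lam W m (sem \<sigma> \<Theta> (ext W m) (up_meta \<Theta> W m ?\<phi>) (up_env W m ?e) t)) bs"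
    using l[of "fst (bs ! _)" "snd (bs ! _)"] by (intro nth_equalityI) (auto simp: case_prod_unfold)
  then show ?case
    using assoc[OF Op.prems(4) tup_in[OF fam], of "\<sigma> f" "[0]"] tup_cmp[OF fam Op.prems(4)] \<sigma>[of f] Op.prems(1)
    unfolding sem.simps by simp
qed simp

text \<open>A substituted term is shifted when it passes a binder; its value is then the old value
  precomposed with \<open>wk\<close>, by \<open>sem_cmp\<close>.\<close>

lemma sem_subst:
  "wf_tm S \<Theta> n t \<Longrightarrow> menv \<Theta> Z \<phi> \<Longrightarrow> venv p Z e \<Longrightarrow> (\<And>i. i < n \<Longrightarrow> wf_tm S \<Theta> p (\<rho> i)) \<Longrightarrow>
   sem \<sigma> \<Theta> Z \<phi> e (subst \<rho> t) = sem \<sigma> \<Theta> Z \<phi> (\<lambda>i. sem \<sigma> \<Theta> Z \<phi> e (\<rho> i)) t"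
proof (induction t arbitrary: n p Z \<phi> e \<rho> rule: tm_induct)
  case (Meta k ts)
  have "sem \<sigma> \<Theta> Z \<phi> e (subst \<rho> t) = sem \<sigma> \<Theta> Z \<phi> (\<lambda>i. sem \<sigma> \<Theta> Z \<phi> e (\<rho> i)) t" if "t \<in> set ts" for t
    using Meta.prems that by (intro Meta.IH[OF that, of n _ _ p]) auto
  then show ?case by (simp add: comp_def cong: map_cong)
next
  case (Op f bs)
  have "sem \<sigma> \<Theta> (ext Z m) (up_meta \<Theta> Z m \<phi>) (up_env Z m (\<lambda>i. sem \<sigma> \<Theta> Z \<phi> e (\<rho> i))) t
      = sem \<sigma> \<Theta> (ext Z m) (up_meta \<Theta> Z m \<phi>) (up_env Z m e) (subst (up_subst m \<rho>) t)"
    if b: "(m, t) \<in> set bs" for m t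
  proof -
    have wf: "wf_tm S \<Theta> (n + m) t" using Op.prems(1) b by auto
    have "sem \<sigma> \<Theta> (ext Z m) (up_meta \<Theta> Z m \<phi>) (up_env Z m e) (subst (up_subst m \<rho>) t)
        = sem \<sigma> \<Theta> (ext Z m) (up_meta \<Theta> Z m \<phi>)
            (\<lambda>i. sem \<sigma> \<Theta> (ext Z m) (up_meta \<Theta> Z m \<phi>) (up_env Z m e) (up_subst m \<rho> i)) t"
      using Op.prems(4) by (intro Op.IH[OF b wf menv_up[OF Op.prems(2)] venv_up[OF Op.prems(3)]] wf_up_subst[of n]) auto
    also have "\<dots> = sem \<sigma> \<Theta> (ext Z m) (up_meta \<Theta> Z m \<phi>) (up_env Z m (\<lambda>i. sem \<sigma> \<Theta> Z \<phi> e (\<rho> i))) t"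
    proof (rule sem_cong[OF wf])
      fix i assume i: "i < n + m"
      show "sem \<sigma> \<Theta> (ext Z m) (up_meta \<Theta> Z m \<phi>) (up_env Z m e) (up_subst m \<rho> i)
          = up_env Z m (\<lambda>i. sem \<sigma> \<Theta> Z \<phi> e (\<rho> i)) i"
      proof (cases "i < m")
        case True
        then show ?thesis by (simp add: up_subst_def up_env_def)
      next
        case False
        then have wi: "wf_tm S \<Theta> p (\<rho> (i - m))" using i by (intro Op.prems(4)) auto
        have "up_env Z m e (m + j) = cmp (ext Z m) Z [0] (e j) (wk Z m)" for j by (simp add: up_env_def)
        then show ?thesis
          using False sem_cmp[OF wi Op.prems(2,3) wk_in, of m]
          by (simp add: up_subst_def up_env_def[of Z m "\<lambda>i. sem \<sigma> \<Theta> Z \<phi> e (\<rho> i)"] sem_rename up_meta_def[abs_def])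
      qed
    qed simp
    finally show ?thesis by simp
  qed
  from sem_Op_cong[of bs \<sigma> \<Theta> Z \<phi> _ \<Theta> \<phi> e "\<lambda>m. subst (up_subst m \<rho>)", OF this]
  show ?case by simp
qed auto

definition sem_abs :: "nat list \<Rightarrow> nat list \<Rightarrow> (nat \<Rightarrow> 'a) \<Rightarrow> (nat \<Rightarrow> 'a) \<Rightarrow> nat \<times> 'o tm \<Rightarrow> 'a" where
  "sem_abs \<Theta> Z \<phi> e b = lam Z (fst b) (sem \<sigma> \<Theta> (ext Z (fst b)) (up_meta \<Theta> Z (fst b) \<phi>) (up_env Z (fst b) e) (snd b))"

lemma sem_abs_in: "wf_abs S \<Theta> n b \<Longrightarrow> menv \<Theta> Z \<phi> \<Longrightarrow> venv n Z e \<Longrightarrow> sem_abs \<Theta> Z \<phi> e b \<in> H Z [fst b]"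
  unfolding sem_abs_def wf_abs_def by (intro lam_in sem_in[of \<Theta> "n + fst b"] menv_up venv_up)

lemma sem_abs_cmp:
  assumes b: "wf_abs S \<Theta> n b" and \<phi>: "menv \<Theta> Z \<phi>" and e: "venv n Z e" and h: "h \<in> H W Z"
  shows "cmp W Z [fst b] (sem_abs \<Theta> Z \<phi> e b) h
     = sem_abs \<Theta> W (\<lambda>k. cmp W Z [\<Theta> ! k] (\<phi> k) h) (\<lambda>i. cmp W Z [0] (e i) h) b"
proof -
  note wf = b[unfolded wf_abs_def]
  show ?thesis
    unfolding sem_abs_def lam_cmp[OF sem_in[OF wf menv_up[OF \<phi>] venv_up[OF e]] h]
      sem_cmp[OF wf menv_up[OF \<phi>] venv_up[OF e] lift_in[OF h]]
    using sem_cong[OF wf up_meta_lift[OF \<phi> h] up_env_lift[OF e h]] by simp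
qed

lemma sem_weaken_abs: "sem_abs \<Theta> (ext Z m) (up_meta \<Theta> Z m \<phi>) (up_env Z m e) (weaken_abs m b)
    = sem_abs \<Theta> (ext Z m) (up_meta \<Theta> Z m \<phi>) (\<lambda>i. cmp (ext Z m) Z [0] (e i) (wk Z m)) b"
proof -
  have "(\<lambda>i. up_env (ext Z m) l (up_env Z m e) (up_ren l ((+) m) i))
      = up_env (ext Z m) l (\<lambda>i. cmp (ext Z m) Z [0] (e i) (wk Z m))" for l
    by (auto simp: up_env_def up_ren_def fun_eq_iff)
  then show ?thesis by (simp add: sem_abs_def snd_weaken_abs sem_rename)
qed

text \<open>The metavariable case is the beta law followed by \<open>sem_cmp\<close> and
  \<open>sem_subst\<close>: a value applied to arguments is the body evaluated with the arguments
  for its bound variables. Under a binder the values of the abstractions are pulled back along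
  \<open>wk\<close>.\<close>

lemma sem_msubst:
  "wf_tm S (map fst th) n t \<Longrightarrow> (\<And>b. b \<in> set th \<Longrightarrow> wf_abs S \<Theta> n b) \<Longrightarrow> menv \<Theta> Z \<phi> \<Longrightarrow> venv n Z e \<Longrightarrow>
   sem \<sigma> \<Theta> Z \<phi> e (msubst th t) = sem \<sigma> (map fst th) Z (\<lambda>k. sem_abs \<Theta> Z \<phi> e (th ! k)) e t"
proof (induction t arbitrary: n th Z \<phi> e rule: tm_induct)
  case (Meta k ts)
  have k: "k < length th" "length ts = fst (th ! k)" using Meta.prems by auto
  let ?a = "fst (th ! k)" and ?u = "snd (th ! k)" and ?rs = "map (msubst th) ts"
  have wf: "wf_tm S (map fst th) n t" if "t \<in> set ts" for t using Meta.prems(1) that by simp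
  have wu: "wf_tm S \<Theta> (n + ?a) ?u" using Meta.prems(2)[of "th ! k"] k by (simp add: wf_abs_def)
  have wr: "wf_tm S \<Theta> n r" if "r \<in> set ?rs" for r
    using that wf Meta.prems(2) by (auto intro: wf_msubst)
  let ?us = "map (sem \<sigma> \<Theta> Z \<phi> e) ?rs"
  have us: "args Z ?a ?us" using sem_in[OF wr Meta.prems(3,4)] k by (intro args_map) auto
  have eq: "map (sem \<sigma> (map fst th) Z (\<lambda>k. sem_abs \<Theta> Z \<phi> e (th ! k)) e) ts = ?us"
    using Meta.IH[OF _ wf Meta.prems(2-4)] by simp
  have su: "sem \<sigma> \<Theta> (ext Z ?a) (up_meta \<Theta> Z ?a \<phi>) (up_env Z ?a e) ?u \<in> H (ext Z ?a) [0]"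
    by (rule sem_in[OF wu menv_up[OF Meta.prems(3)] venv_up[OF Meta.prems(4)]])
  \<comment> \<open>A section of the weakening \<open>wk Z ?a\<close> that gives the bound variables
    the values of the arguments.\<close>
  let ?p = "pair Z Z ?a (Id (tcat T) Z) ?us"
  have p: "?p \<in> H Z (ext Z ?a)" by (rule pair_in[OF Id_in us])
  have "app Z ?a (sem_abs \<Theta> Z \<phi> e (th ! k)) ?us
      = cmp Z (ext Z ?a) [0] (sem \<sigma> \<Theta> (ext Z ?a) (up_meta \<Theta> Z ?a \<phi>) (up_env Z ?a e) ?u) ?p"
    using app_lam_pair[OF su Id_in us] cmp_Id[OF lam_in[OF su]] by (simp add: sem_abs_def)
  also have "\<dots> = sem \<sigma> \<Theta> Z (\<lambda>k'. cmp Z (ext Z ?a) [\<Theta> ! k'] (up_meta \<Theta> Z ?a \<phi> k') ?p)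
      (\<lambda>i. cmp Z (ext Z ?a) [0] (up_env Z ?a e i) ?p) ?u"
    by (rule sem_cmp[OF wu menv_up[OF Meta.prems(3)] venv_up[OF Meta.prems(4)] p])
  also have "\<dots> = sem \<sigma> \<Theta> Z \<phi> (\<lambda>i. sem \<sigma> \<Theta> Z \<phi> e (inst ?rs i)) ?u"
  proof (rule sem_cong[OF wu])
    fix k' assume "k' < length \<Theta>"
    then have "\<phi> k' \<in> H Z [\<Theta> ! k']" using Meta.prems(3) by (simp add: menv_def)
    then show "cmp Z (ext Z ?a) [\<Theta> ! k'] (up_meta \<Theta> Z ?a \<phi> k') ?p = \<phi> k'"
      unfolding up_meta_def using assoc[OF p wk_in] wk_pair[OF Id_in us] cmp_Id by metis
  next
    fix i assume i: "i < n + ?a"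
    show "cmp Z (ext Z ?a) [0] (up_env Z ?a e i) ?p = sem \<sigma> \<Theta> Z \<phi> e (inst ?rs i)"
    proof (cases "i < ?a")
      case True
      then show ?thesis using var_pair[OF Id_in us True] k by (simp add: up_env_def inst_def)
    next
      case False
      then have "e (i - ?a) \<in> H Z [0]" using Meta.prems(4) i by (simp add: venv_def)
      then have "cmp Z (ext Z ?a) [0] (cmp (ext Z ?a) Z [0] (e (i - ?a)) (wk Z ?a)) ?p = e (i - ?a)"
        using assoc[OF p wk_in] wk_pair[OF Id_in us] cmp_Id by metis
      then show ?thesis using False k by (simp add: up_env_def inst_def)
    qed
  qed
  also have "\<dots> = sem \<sigma> \<Theta> Z \<phi> e (subst (inst ?rs) ?u)"
    using k wr by (intro sem_subst[OF wu Meta.prems(3,4), symmetric] wf_inst) auto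
  finally show ?case using k unfolding sem.simps msubst.simps eq by simp
next
  case (Op f bs)
  let ?\<Phi> = "\<lambda>k. sem_abs \<Theta> Z \<phi> e (th ! k)"
  have "sem \<sigma> (map fst th) (ext Z m) (up_meta (map fst th) Z m ?\<Phi>) (up_env Z m e) t
      = sem \<sigma> \<Theta> (ext Z m) (up_meta \<Theta> Z m \<phi>) (up_env Z m e) (msubst (map (weaken_abs m) th) t)"
    if b: "(m, t) \<in> set bs" for m t
  proof -
    have wf: "wf_tm S (map fst th) (n + m) t" using Op.prems(1) b by auto
    have "sem \<sigma> \<Theta> (ext Z m) (up_meta \<Theta> Z m \<phi>) (up_env Z m e) (msubst (map (weaken_abs m) th) t)
        = sem \<sigma> (map fst (map (weaken_abs m) th)) (ext Z m)
            (\<lambda>k. sem_abs \<Theta> (ext Z m) (up_meta \<Theta> Z m \<phi>) (up_env Z m e) (map (weaken_abs m) th ! k)) (up_env Z m e) t"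
    proof (rule Op.IH[OF b, of _ "n + m"])
      show "wf_tm S (map fst (map (weaken_abs m) th)) (n + m) t" using wf by simp
    qed (use wf_map_weaken_abs Op.prems menv_up venv_up in blast)+
    also have "map fst (map (weaken_abs m) th) = map fst th" by simp
    also have "sem \<sigma> (map fst th) (ext Z m)
            (\<lambda>k. sem_abs \<Theta> (ext Z m) (up_meta \<Theta> Z m \<phi>) (up_env Z m e) (map (weaken_abs m) th ! k)) (up_env Z m e) t
        = sem \<sigma> (map fst th) (ext Z m) (up_meta (map fst th) Z m ?\<Phi>) (up_env Z m e) t"
    proof (rule sem_cong[OF wf])
      fix k assume k: "k < length (map fst th)"
      then have "sem_abs \<Theta> (ext Z m) (up_meta \<Theta> Z m \<phi>) (\<lambda>i. cmp (ext Z m) Z [0] (e i) (wk Z m)) (th ! k)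
          = cmp (ext Z m) Z [fst (th ! k)] (sem_abs \<Theta> Z \<phi> e (th ! k)) (wk Z m)"
        using sem_abs_cmp[OF _ Op.prems(3,4) wk_in, of "th ! k" m] Op.prems(2)[of "th ! k"]
        by (simp add: up_meta_def[abs_def])
      then show "sem_abs \<Theta> (ext Z m) (up_meta \<Theta> Z m \<phi>) (up_env Z m e) (map (weaken_abs m) th ! k)
          = up_meta (map fst th) Z m ?\<Phi> k"
        using k by (simp add: sem_weaken_abs up_meta_def[of "map fst th"])
    qed simp
    finally show ?thesis by simp
  qed
  from sem_Op_cong[of bs \<sigma> "map fst th" Z ?\<Phi> e \<Theta> \<phi> e "\<lambda>m. msubst (map (weaken_abs m) th)", OF this]
  show ?case by simp
qed simp

text \<open>Soundness. In \<open>ext_msubst\<close> the variables of \<Gamma> come first, so the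
  abstractions over \<Delta> are read in the environment shifted by \<open>g\<close>.\<close>

lemma sem_derivable:
  assumes P: "is_presentation P" and sig: "sig P = S"
    and axs: "\<And>\<Theta> n s t Z \<phi> e. (\<Theta>, n, s, t) \<in> axs P \<Longrightarrow> menv \<Theta> Z \<phi> \<Longrightarrow> venv n Z e
        \<Longrightarrow> sem \<sigma> \<Theta> Z \<phi> e s = sem \<sigma> \<Theta> Z \<phi> e t"
  shows "derivable P \<Theta> n s t \<Longrightarrow> menv \<Theta> Z \<phi> \<Longrightarrow> venv n Z e \<Longrightarrow> sem \<sigma> \<Theta> Z \<phi> e s = sem \<sigma> \<Theta> Z \<phi> e t"
proof (induction arbitrary: Z \<phi> e rule: derivable.induct)
  case (ext_msubst ms g s t ss ts \<Theta> d)
  have eq: "sem \<sigma> \<Theta> Z \<phi> e (msubst (map (weaken_abs g) (zip ms us)) u)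
      = sem \<sigma> ms Z (\<lambda>k. sem_abs \<Theta> Z \<phi> (\<lambda>i. e (g + i)) (ms ! k, us ! k)) e u"
    if u: "wf_tm S ms g u" and len: "length us = length ms"
      and us: "\<And>i. i < length ms \<Longrightarrow> wf_tm S \<Theta> (ms ! i + d) (us ! i)" for u us
  proof -
    let ?th = "map (weaken_abs g) (zip ms us)"
    have m: "map fst ?th = ms" using len by simp
    have "sem \<sigma> \<Theta> Z \<phi> e (msubst ?th u) = sem \<sigma> (map fst ?th) Z (\<lambda>k. sem_abs \<Theta> Z \<phi> e (?th ! k)) e u"
    proof (rule sem_msubst[of _ "d + g"])
      show "wf_tm S (map fst ?th) (d + g) u" unfolding m using u by (rule wf_tm_mono_vars) simp
      show "wf_abs S \<Theta> (d + g) b" if "b \<in> set ?th" for b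
        using wf_map_weaken_abs[OF that] wf_tm_zip[OF len us] by blast
      show "venv (d + g) Z e" using ext_msubst.prems by (simp add: add.commute)
    qed (rule ext_msubst.prems)
    also have "\<dots> = sem \<sigma> ms Z (\<lambda>k. sem_abs \<Theta> Z \<phi> (\<lambda>i. e (g + i)) (ms ! k, us ! k)) e u"
      unfolding m
    proof (rule sem_cong[OF u])
      fix k assume "k < length ms"
      moreover have "(\<lambda>i. up_env Z l e (up_ren l ((+) g) i)) = up_env Z l (\<lambda>i. e (g + i))" for l
        by (auto simp: up_env_def up_ren_def fun_eq_iff)
      ultimately show "sem_abs \<Theta> Z \<phi> e (?th ! k) = sem_abs \<Theta> Z \<phi> (\<lambda>i. e (g + i)) (ms ! k, us ! k)"
        using len by (simp add: sem_abs_def snd_weaken_abs sem_rename)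
    qed simp
    finally show ?thesis .
  qed
  have wf: "wf_tm S ms g s" "wf_tm S ms g t"
    "\<And>i. i < length ms \<Longrightarrow> wf_tm S \<Theta> (ms ! i + d) (ss ! i)"
    "\<And>i. i < length ms \<Longrightarrow> wf_tm S \<Theta> (ms ! i + d) (ts ! i)"
    using derivable_wf[OF P] ext_msubst unfolding sig by blast+
  have v: "venv d Z (\<lambda>i. e (g + i))" "venv g Z e" using ext_msubst.prems by (auto simp: venv_def)
  have "sem_abs \<Theta> Z \<phi> (\<lambda>i. e (g + i)) (ms ! k, ss ! k) = sem_abs \<Theta> Z \<phi> (\<lambda>i. e (g + i)) (ms ! k, ts ! k)"
    if "k < length ms" for k
  proof -
    have "venv (ms ! k + d) (ext Z (ms ! k)) (up_env Z (ms ! k) (\<lambda>i. e (g + i)))"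
      using venv_up[OF v(1), of "ms ! k"] by (simp only: add.commute)
    then show ?thesis
      using ext_msubst.IH(2) that menv_up[OF ext_msubst.prems(1)] by (simp add: sem_abs_def)
  qed
  moreover have "menv ms Z (\<lambda>k. sem_abs \<Theta> Z \<phi> (\<lambda>i. e (g + i)) (ms ! k, ts ! k))"
    using sem_abs_in[OF _ ext_msubst.prems(1) v(1), of "(_, _)"] wf(4)
    by (auto simp: menv_def wf_abs_def add.commute)
  ultimately show ?case
    using eq[OF wf(1) ext_msubst.hyps(2) wf(3)] eq[OF wf(2) ext_msubst.hyps(3) wf(4)]
      sem_cong[OF wf(1), of "\<lambda>k. sem_abs \<Theta> Z \<phi> (\<lambda>i. e (g + i)) (ms ! k, ss ! k)"
        "\<lambda>k. sem_abs \<Theta> Z \<phi> (\<lambda>i. e (g + i)) (ms ! k, ts ! k)" e e \<sigma> Z]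
      ext_msubst.IH(1)[OF _ v(2), of "\<lambda>k. sem_abs \<Theta> Z \<phi> (\<lambda>i. e (g + i)) (ms ! k, ts ! k)"] by simp
qed (auto dest: axs)

text \<open>The value at the universal stage, where metavariables and variables are the projections
  of \<open>ext \<Theta> n\<close>, with the variables then abstracted.\<close>

definition interp :: "nat list \<Rightarrow> nat \<Rightarrow> 'o tm \<Rightarrow> 'a" where
  "interp \<Theta> n t = lam \<Theta> n (sem \<sigma> \<Theta> (ext \<Theta> n) (pr (ext \<Theta> n)) (var \<Theta> n) t)"

section \<open>Generic elements, and equality of interpretations\<close>

lemma menv_pr: "menv \<Theta> (ext \<Theta> n) (pr (ext \<Theta> n))"
  unfolding menv_def
proof (intro allI impI)
  fix k assume "k < length \<Theta>"
  then show "pr (ext \<Theta> n) k \<in> H (ext \<Theta> n) [\<Theta> ! k]"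
    using pr_in[of k "ext \<Theta> n"] by (simp add: nth_ext(1))
qed

lemma venv_var: "venv n (ext Z n) (var Z n)"
  by (simp add: venv_def var_in)

lemma sem_generic_in: "wf_tm S \<Theta> n t \<Longrightarrow> sem \<sigma> \<Theta> (ext \<Theta> n) (pr (ext \<Theta> n)) (var \<Theta> n) t \<in> H (ext \<Theta> n) [0]"
  by (rule sem_in[OF _ menv_pr venv_var])

lemma interp_in: "wf_tm S \<Theta> n t \<Longrightarrow> interp \<Theta> n t \<in> H \<Theta> [n]"
  unfolding interp_def by (intro lam_in sem_generic_in)

lemma pr_pair:
  assumes h: "h \<in> H W Z" and us: "args W m us" and k: "k < length Z"
  shows "cmp W (ext Z m) [Z ! k] (pr (ext Z m) k) (pair W Z m h us) = cmp W Z [Z ! k] (pr Z k) h"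
  using assoc[OF pair_in[OF h us] wk_in pr_in[OF k]] pr_wk[OF k, of m] wk_pair[OF h us] by simp

lemma app_interp:
  assumes t: "wf_tm S \<Theta> n t" and h: "h \<in> H Z \<Theta>" and us: "args Z n us"
  shows "app Z n (cmp Z \<Theta> [n] (interp \<Theta> n t) h) us
    = sem \<sigma> \<Theta> Z (\<lambda>k. cmp Z \<Theta> [\<Theta> ! k] (pr \<Theta> k) h) (\<lambda>i. us ! i) t"
  unfolding interp_def app_lam_pair[OF sem_generic_in[OF t] h us]
    sem_cmp[OF t menv_pr venv_var pair_in[OF h us]]
  using sem_cong[OF t pr_pair[OF h us] var_pair[OF h us]] .

lemma sem_eq_interp_cmp:
  assumes t: "wf_tm S \<Theta> n t" and h: "h \<in> H Z \<Theta>"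
  shows "cmp Z \<Theta> [n] (interp \<Theta> n t) h
    = lam Z n (sem \<sigma> \<Theta> (ext Z n) (\<lambda>k. cmp (ext Z n) Z [\<Theta> ! k] (cmp Z \<Theta> [\<Theta> ! k] (pr \<Theta> k) h) (wk Z n)) (var Z n) t)"
proof (rule lam_unique)
  show "cmp Z \<Theta> [n] (interp \<Theta> n t) h \<in> H Z [n]" by (intro cmp_in interp_in t h)
  have "app (ext Z n) n (cmp (ext Z n) Z [n] (cmp Z \<Theta> [n] (interp \<Theta> n t) h) (wk Z n)) (vars Z n)
      = sem \<sigma> \<Theta> (ext Z n) (\<lambda>k. cmp (ext Z n) \<Theta> [\<Theta> ! k] (pr \<Theta> k) (cmp (ext Z n) Z \<Theta> h (wk Z n))) (\<lambda>i. vars Z n ! i) t"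
    unfolding assoc[OF wk_in h interp_in[OF t], symmetric]
    by (rule app_interp[OF t cmp_in[OF wk_in h] args_vars])
  also have "\<dots> = sem \<sigma> \<Theta> (ext Z n) (\<lambda>k. cmp (ext Z n) Z [\<Theta> ! k] (cmp Z \<Theta> [\<Theta> ! k] (pr \<Theta> k) h) (wk Z n)) (var Z n) t"
    using assoc[OF wk_in h pr_in] by (intro sem_cong[OF t]) (auto simp: vars_def)
  finally show "app (ext Z n) n (cmp (ext Z n) Z [n] (cmp Z \<Theta> [n] (interp \<Theta> n t) h) (wk Z n)) (vars Z n)
      = sem \<sigma> \<Theta> (ext Z n) (\<lambda>k. cmp (ext Z n) Z [\<Theta> ! k] (cmp Z \<Theta> [\<Theta> ! k] (pr \<Theta> k) h) (wk Z n)) (var Z n) t" .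
qed

text \<open>A Yoneda argument: by \<open>app_interp\<close> the value at any stage is obtained from
  the generic one by precomposition and application, so equality at the generic stage is equality
  everywhere.\<close>

lemma interp_eq_iff:
  assumes s: "wf_tm S \<Theta> n s" and t: "wf_tm S \<Theta> n t"
  shows "interp \<Theta> n s = interp \<Theta> n t
    \<longleftrightarrow> (\<forall>Z \<phi> e. menv \<Theta> Z \<phi> \<longrightarrow> venv n Z e \<longrightarrow> sem \<sigma> \<Theta> Z \<phi> e s = sem \<sigma> \<Theta> Z \<phi> e t)"
proof (intro iffI allI impI)
  fix Z \<phi> e assume eq: "interp \<Theta> n s = interp \<Theta> n t" and \<phi>: "menv \<Theta> Z \<phi>" and e: "venv n Z e"
  let ?h = "tup Z \<Theta> (map \<phi> [0..<length \<Theta>])" and ?us = "map e [0..<n]"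
  have f: "fam Z \<Theta> (map \<phi> [0..<length \<Theta>])" using \<phi> by (intro fam_map) (simp add: menv_def)
  have us: "args Z n ?us" using e by (auto simp: args_def venv_def)
  have "sem \<sigma> \<Theta> Z \<phi> e u = app Z n (cmp Z \<Theta> [n] (interp \<Theta> n u) ?h) ?us" if "wf_tm S \<Theta> n u" for u
    unfolding app_interp[OF that tup_in[OF f] us]
    by (rule sem_cong[OF that]) (simp_all add: pr_tup[OF f])
  with s t eq show "sem \<sigma> \<Theta> Z \<phi> e s = sem \<sigma> \<Theta> Z \<phi> e t" by simp
qed (use menv_pr venv_var in \<open>auto simp: interp_def\<close>)

text \<open>Compatibility with composition of tuples. It is \<open>sem_msubst\<close> at the generic
  stage, where the value of each abstraction is the interpretation of the corresponding component
  pulled back along \<open>wk\<close>.\<close>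

lemma interp_msubst:
  assumes ss: "ss \<in> tuples S X Y" and t: "wf_tm S Y n t"
  shows "interp X n (msubst (zip Y ss) t)
    = cmp X Y [n] (interp Y n t) (tup X Y (map (\<lambda>i. interp X (Y ! i) (ss ! i)) [0..<length Y]))"
proof -
  let ?E = "ext X n"
  have f: "fam X Y (map (\<lambda>i. interp X (Y ! i) (ss ! i)) [0..<length Y])"
    using tuples_wf[OF ss] by (intro fam_map interp_in)
  have m: "map fst (zip Y ss) = Y" using ss by (rule map_fst_zip_tuples)
  have "sem \<sigma> X ?E (pr ?E) (var X n) (msubst (zip Y ss) t)
      = sem \<sigma> (map fst (zip Y ss)) ?E (\<lambda>k. sem_abs X ?E (pr ?E) (var X n) (zip Y ss ! k)) (var X n) t"
    using wf_abs_closed[OF zip_tuples_wf[OF ss]] t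
    by (intro sem_msubst[OF _ _ menv_pr venv_var]) (simp_all only: m)
  also have "\<dots> = sem \<sigma> Y ?E (\<lambda>k. cmp ?E X [Y ! k] (cmp X Y [Y ! k] (pr Y k)
        (tup X Y (map (\<lambda>i. interp X (Y ! i) (ss ! i)) [0..<length Y]))) (wk X n)) (var X n) t"
    unfolding m
  proof (rule sem_cong[OF t])
    fix k assume k: "k < length Y"
    have wk: "wf_tm S X (Y ! k) (ss ! k)" by (rule tuples_wf[OF ss k])
    have z: "zip Y ss ! k = (Y ! k, ss ! k)" using k tuples_length[OF ss] by simp
    have "cmp ?E X [Y ! k] (interp X (Y ! k) (ss ! k)) (wk X n)
        = lam ?E (Y ! k) (sem \<sigma> X (ext ?E (Y ! k)) (up_meta X ?E (Y ! k) (\<lambda>k'. cmp ?E X [X ! k'] (pr X k') (wk X n)))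
             (var ?E (Y ! k)) (ss ! k))"
      unfolding sem_eq_interp_cmp[OF wk wk_in] up_meta_def by simp
    also have "sem \<sigma> X (ext ?E (Y ! k)) (up_meta X ?E (Y ! k) (\<lambda>k'. cmp ?E X [X ! k'] (pr X k') (wk X n)))
             (var ?E (Y ! k)) (ss ! k)
        = sem \<sigma> X (ext ?E (Y ! k)) (up_meta X ?E (Y ! k) (pr ?E)) (up_env ?E (Y ! k) (var X n)) (ss ! k)"
      by (rule sem_cong[OF wk]) (simp_all add: up_meta_def up_env_def pr_wk)
    finally have "sem_abs X ?E (pr ?E) (var X n) (zip Y ss ! k) = cmp ?E X [Y ! k] (interp X (Y ! k) (ss ! k)) (wk X n)"
      by (simp add: z sem_abs_def)
    then show "sem_abs X ?E (pr ?E) (var X n) (zip Y ss ! k) = cmp ?E X [Y ! k] (cmp X Y [Y ! k] (pr Y k)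
        (tup X Y (map (\<lambda>i. interp X (Y ! i) (ss ! i)) [0..<length Y]))) (wk X n)"
      using pr_tup[OF f k] k by simp
  qed simp
  finally show ?thesis
    unfolding sem_eq_interp_cmp[OF t tup_in[OF f]] interp_def[of X n] by simp
qed

text \<open>A family of arrows that is compatible with metasubstitution and with the interpretation of
  terms without operators is an interpretation. This applies to the arrows of \<open>\<M>\<close> themselves and
  to the classes of terms in the theory of a presentation.\<close>

lemma interp_unique:
  assumes Q_in: "\<And>\<Theta> n t. wf_tm S \<Theta> n t \<Longrightarrow> Q \<Theta> n t \<in> H \<Theta> [n]"
    and Q_meta: "\<And>\<Theta> k. k < length \<Theta> \<Longrightarrow> Q \<Theta> (\<Theta> ! k) (meta_vars k (\<Theta> ! k)) = pr \<Theta> k"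
    and Q_app: "\<And>a. Q (a # replicate a 0) 0 (app_tm a) = marr (a # replicate a 0) [0] [app_tm a]"
    and Q_msubst: "\<And>X Y n t ss. ss \<in> tuples S X Y \<Longrightarrow> wf_tm S Y n t \<Longrightarrow> Q X n (msubst (zip Y ss) t)
        = cmp X Y [n] (Q Y n t) (tup X Y (map (\<lambda>i. Q X (Y ! i) (ss ! i)) [0..<length Y]))"
    and Q_op: "\<And>f. f \<in> ops S \<Longrightarrow> Q (arity S f) 0 (Op f (id_abs (arity S f))) = \<sigma> f"
    and t: "wf_tm S \<Theta> n t"
  shows "interp \<Theta> n t = Q \<Theta> n t"
proof -
  \<comment> \<open>Closes a term by replacing each variable with the nullary metavariable that
    carries it in the extended stage. The reversed index is that of \<open>var\<close>.\<close>
  define close :: "nat list \<Rightarrow> nat \<Rightarrow> nat \<Rightarrow> 'o tm"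
    where "close Z m = (\<lambda>j. Meta (length Z + (m - 1 - j)) [])" for Z m
  have close_wf: "wf_tm S (ext Z m) l (close Z m j)" if "j < m" for Z m l j
    using that by (auto simp: close_def nth_ext)
  have Q_close: "Q (ext Z m) 0 (close Z m j) = var Z m j" if "j < m" for Z m j
    using Q_meta[of "length Z + (m - 1 - j)" "ext Z m"] that
    by (simp add: close_def var_def nth_ext meta_vars_def)
  \<comment> \<open>Instantiation of bound variables is metasubstitution into \<open>app_tm\<close>,
    on which \<open>Q\<close> is known.\<close>
  have Q_app': "Q Z 0 (subst (inst ts) u) = app Z a (Q Z a u) (map (Q Z 0) ts)"
    if u: "wf_tm S Z a u" and ts: "\<And>t. t \<in> set ts \<Longrightarrow> wf_tm S Z 0 t" and len: "length ts = a" for Z a u ts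
  proof -
    let ?Y = "a # replicate a 0"
    have tup: "u # ts \<in> tuples S Z ?Y"
    proof (rule tuplesI)
      fix i assume "i < length ?Y"
      then show "wf_tm S Z (?Y ! i) ((u # ts) ! i)" using u ts len by (cases i) auto
    qed (simp add: len)
    have "map (\<lambda>i. Q Z (?Y ! i) ((u # ts) ! i)) [0..<length ?Y] = Q Z a u # map (Q Z 0) ts"
    proof (rule nth_equalityI)
      fix i assume "i < length (map (\<lambda>i. Q Z (?Y ! i) ((u # ts) ! i)) [0..<length ?Y])"
      then show "map (\<lambda>i. Q Z (?Y ! i) ((u # ts) ! i)) [0..<length ?Y] ! i = (Q Z a u # map (Q Z 0) ts) ! i"
        using len by (cases i) (simp_all del: upt_Suc)
    qed (simp add: len)
    then show ?thesis
      using Q_msubst[OF tup wf_app_tm, of 0] Q_app[of a] msubst_app_tm[OF len, of u]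
      by (simp add: app_def val_def)
  qed
  have Q_wk: "cmp (ext Z m) Z [m] (Q Z m u) (wk Z m) = Q (ext Z m) m u" if u: "wf_tm S Z m u" for Z m u
  proof -
    have "tup (ext Z m) Z (map (\<lambda>i. Q (ext Z m) (Z ! i) (ids Z ! i)) [0..<length Z]) = wk Z m"
    proof (rule tup_unique[symmetric])
      have e: "Q (ext Z m) (Z ! i) (ids Z ! i) = pr (ext Z m) i" if "i < length Z" for i
        using Q_meta[of i "ext Z m"] that by (simp add: nth_ext)
      show "fam (ext Z m) Z (map (\<lambda>i. Q (ext Z m) (Z ! i) (ids Z ! i)) [0..<length Z])"
        using e menv_pr[of Z m] by (intro fam_map) (simp add: menv_def del: nth_ids)
      show "cmp (ext Z m) Z [Z ! i] (pr Z i) (wk Z m) = map (\<lambda>i. Q (ext Z m) (Z ! i) (ids Z ! i)) [0..<length Z] ! i"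
        if "i < length Z" for i using that e pr_wk[OF that] by (simp del: nth_ids)
    qed (rule wk_in)
    then show ?thesis
      using Q_msubst[OF ids_tuples_ext u, of m] msubst_id[OF u] by (simp add: zip_ids)
  qed
  have wf_ext: "wf_tm S (ext Z m) l u" if "wf_tm S Z l u" for Z m l u
    unfolding ext_def by (rule wf_tm_append_ctx[OF that])
  \<comment> \<open>Uniqueness of the transpose recovers \<open>Q\<close> on an open term from its
    closed form, so it suffices to compare closed terms.\<close>
  have Q_lam: "lam Z m (Q (ext Z m) 0 (subst (close Z m) u)) = Q Z m u" if u: "wf_tm S Z m u" for Z m u
  proof (rule lam_unique[symmetric, OF Q_in[OF u]])
    let ?ts = "map (close Z m) [0..<m]"
    have "subst (inst ?ts) u = subst (close Z m) u" by (rule subst_cong[OF u]) (simp add: inst_def)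
    moreover have "map (Q (ext Z m) 0) ?ts = vars Z m" using Q_close by (simp add: vars_def)
    moreover have "wf_tm S (ext Z m) 0 t" if "t \<in> set ?ts" for t using that close_wf by auto
    ultimately show "app (ext Z m) m (cmp (ext Z m) Z [m] (Q Z m u) (wk Z m)) (vars Z m) = Q (ext Z m) 0 (subst (close Z m) u)"
      using Q_app'[OF wf_ext[OF u], of ?ts m] by (simp add: Q_wk[OF u] del: map_map set_map)
  qed
  have wf_close: "wf_tm S (ext \<Theta> n) 0 (subst (close \<Theta> n) t)" if "wf_tm S \<Theta> n t" for n t
    by (rule wf_subst[OF wf_ext[OF that]]) (rule close_wf)
  have main: "wf_tm S \<Theta> n t \<Longrightarrow> sem \<sigma> \<Theta> (ext \<Theta> n) (pr (ext \<Theta> n)) (var \<Theta> n) t = Q (ext \<Theta> n) 0 (subst (close \<Theta> n) t)" for n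
  proof (induction t arbitrary: n rule: tm_induct)
    case (Var i)
    then show ?case by (simp add: Q_close)
  next
    case (Meta k ts)
    let ?ts = "map (subst (close \<Theta> n)) ts"
    have k: "k < length \<Theta>" "length ts = \<Theta> ! k" and wf: "\<And>t. t \<in> set ts \<Longrightarrow> wf_tm S \<Theta> n t" using Meta.prems by auto
    have "map (sem \<sigma> \<Theta> (ext \<Theta> n) (pr (ext \<Theta> n)) (var \<Theta> n)) ts = map (Q (ext \<Theta> n) 0) ?ts"
      using Meta.IH wf by simp
    moreover have "pr (ext \<Theta> n) k = Q (ext \<Theta> n) (\<Theta> ! k) (meta_vars k (\<Theta> ! k))"
      using Q_meta[of k "ext \<Theta> n"] k by (simp add: nth_ext)
    moreover have "Q (ext \<Theta> n) 0 (subst (inst ?ts) (meta_vars k (\<Theta> ! k)))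
       = app (ext \<Theta> n) (\<Theta> ! k) (Q (ext \<Theta> n) (\<Theta> ! k) (meta_vars k (\<Theta> ! k))) (map (Q (ext \<Theta> n) 0) ?ts)"
      using k wf_close[OF wf] by (intro Q_app' wf_meta_vars) (auto simp: nth_ext)
    moreover have "subst (inst ?ts) (meta_vars k (\<Theta> ! k)) = Meta k ?ts"
      using k by (simp add: subst_meta_vars map_inst)
    ultimately show ?case by (simp only: sem.simps subst.simps)
  next
    case (Op f bs)
    have f: "f \<in> ops S" "map fst bs = arity S f" and wf: "\<And>m t. (m, t) \<in> set bs \<Longrightarrow> wf_tm S \<Theta> (n + m) t"
      using Op.prems by auto
    let ?E = "ext \<Theta> n" and ?u = "\<lambda>m. subst (up_subst m (close \<Theta> n))"
    have wu: "wf_tm S ?E m (?u m t)" if "(m, t) \<in> set bs" for m t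
      using wf_up_subst[of n S ?E 0 "close \<Theta> n" _ m, OF close_wf]
      by (intro wf_subst[OF wf_ext[OF wf[OF that]]]) simp
    have l: "lam ?E m (sem \<sigma> \<Theta> (ext ?E m) (up_meta \<Theta> ?E m (pr ?E)) (up_env ?E m (var \<Theta> n)) t) = Q ?E m (?u m t)"
      if b: "(m, t) \<in> set bs" for m t
    proof -
      have "sem \<sigma> \<Theta> (ext ?E m) (up_meta \<Theta> ?E m (pr ?E)) (up_env ?E m (var \<Theta> n)) t
          = sem \<sigma> \<Theta> (ext \<Theta> (n + m)) (pr (ext \<Theta> (n + m))) (var \<Theta> (n + m)) t"
        unfolding ext_ext
      proof (rule sem_cong[OF wf[OF b]])
        fix k assume "k < length \<Theta>"
        then show "up_meta \<Theta> ?E m (pr ?E) k = pr (ext \<Theta> (n + m)) k"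
          using pr_wk[of k ?E m] by (simp add: up_meta_def nth_ext ext_ext)
      next
        fix i assume i: "i < n + m"
        \<comment> \<open>Newly bound variables have the smallest de Bruijn indices but the last
          positions in the stage; the reversed numbering makes both readings agree.\<close>
        show "up_env ?E m (var \<Theta> n) i = var \<Theta> (n + m) i"
        proof (cases "i < m")
          case True
          then show ?thesis by (simp add: up_env_def var_def ext_ext add.assoc)
        next
          case False
          define p where "p = length \<Theta> + (n - 1 - (i - m))"
          have p: "length \<Theta> \<le> p" "p < length \<Theta> + n" "length \<Theta> + (n + m - 1 - i) = p"
            using False i by (auto simp: p_def)
          then show ?thesis
            using False pr_wk[of p ?E m] unfolding up_env_def var_def p_def[symmetric] p(3)
            by (simp add: nth_ext ext_ext)
        qed
      qed
      also have "\<dots> = Q (ext ?E m) 0 (subst (close \<Theta> (n + m)) t)"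
        using Op.IH[OF b wf[OF b]] by (simp add: ext_ext)
      \<comment> \<open>Closing \<open>n + m\<close> variables at once is closing the outer
        \<open>n\<close> under the binder and then the inner \<open>m\<close>.\<close>
      also have "subst (close \<Theta> (n + m)) t = subst (close ?E m) (?u m t)"
        unfolding subst_subst
      proof (rule subst_cong[OF wf[OF b]])
        fix i assume "i < n + m"
        then show "close \<Theta> (n + m) i = subst (close ?E m) (up_subst m (close \<Theta> n) i)"
          by (auto simp: close_def up_subst_def)
      qed
      finally show ?thesis using Q_lam[OF wu[OF b]] by simp
    qed
    let ?us = "map (\<lambda>(m, t). ?u m t) bs"
    have us: "?us \<in> tuples S ?E (arity S f)"
      using wu by (auto intro!: tuplesI simp: f(2)[symmetric] case_prod_unfold)
    have eq: "map (\<lambda>(m, t). lam ?E m (sem \<sigma> \<Theta> (ext ?E m) (up_meta \<Theta> ?E m (pr ?E)) (up_env ?E m (var \<Theta> n)) t)) bs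
        = map (\<lambda>i. Q ?E (arity S f ! i) (?us ! i)) [0..<length (arity S f)]"
      using l by (intro nth_equalityI) (auto simp: f(2)[symmetric] case_prod_unfold)
    have "wf_tm S (arity S f) 0 (Op f (id_abs (arity S f)))"
      using is_sig_translation_id[of S] f(1) by (simp add: is_sig_translation_def id_translation_eq)
    note Q = Q_msubst[OF us this]
    \<comment> \<open>The term is a metasubstitution instance of the generic application of
      \<open>f\<close>, whose \<open>Q\<close>-value is \<sigma> f by assumption.\<close>
    have "sem \<sigma> \<Theta> ?E (pr ?E) (var \<Theta> n) (Op f bs) = Q ?E 0 (msubst (zip (arity S f) ?us) (Op f (id_abs (arity S f))))"
      unfolding sem.simps Q Q_op[OF f(1)] f(2) eq by (rule HOL.refl)
    also have "msubst (zip (arity S f) ?us) (Op f (id_abs (arity S f))) = Op f (zip (arity S f) ?us)"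
      by (simp only: msubst_Op msubst_abs_id_abs map_fst_zip_tuples[OF us])
    also have "zip (arity S f) ?us = map (\<lambda>(m, t). (m, ?u m t)) bs"
      by (rule nth_equalityI) (auto simp: f(2)[symmetric] case_prod_unfold)
    finally show ?case by simp
  qed
  show ?thesis unfolding interp_def main[OF t] by (rule Q_lam[OF t])
qed

end

context so_theory
begin

lemma marr_eq_tup:
  assumes ts: "ts \<in> tuples empty_signature X Y"
  shows "marr X Y ts = tup X Y (map (\<lambda>i. marr X [Y ! i] [ts ! i]) [0..<length Y])"
proof (rule tup_unique)
  show "fam X Y (map (\<lambda>i. marr X [Y ! i] [ts ! i]) [0..<length Y])"
    by (intro fam_map marr_in single_tuples tuples_wf[OF ts])
qed (simp_all add: marr_in[OF ts] pr_marr[OF ts])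

text \<open>Uniqueness over the empty signature, with the arrows of the structure functor as the
  family. It makes the comparison of a theory with its presentation commute with the functors from
  \<M>.\<close>

lemma interp_M:
  assumes t: "wf_tm empty_signature \<Theta> n t"
  shows "so_model.interp T \<sigma> \<Theta> n t = marr \<Theta> [n] [t]"
proof -
  interpret E: so_model T empty_signature \<sigma> by standard (simp add: empty_signature_def)
  show ?thesis
  proof (rule E.interp_unique[OF _ _ _ _ _ t])
    show "marr \<Theta> [n] [t] \<in> H \<Theta> [n]" if "wf_tm empty_signature \<Theta> n t" for \<Theta> n t
      by (intro marr_in single_tuples that)
    fix X Y n and ss :: "'a tm list" and t :: "'a tm"
    assume ss: "ss \<in> tuples empty_signature X Y" and t: "wf_tm empty_signature Y n t"
    show "marr X [n] [msubst (zip Y ss) t]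
        = cmp X Y [n] (marr Y [n] [t]) (tup X Y (map (\<lambda>i. marr X [Y ! i] [ss ! i]) [0..<length Y]))"
      unfolding marr_eq_tup[OF ss, symmetric] using marr_comp[OF ss single_tuples[OF t]] by simp
  qed (simp_all add: pr_def empty_signature_def)
qed

end

section \<open>Translations preserve the interpretation\<close>

locale so_translation = A: so_theory T + B: so_theory T' for T :: "'a so_theory" and T' :: "'a so_theory" +
  fixes F :: "(nat list, 'a, nat list, 'a) cat_functor"
  assumes F: "F \<in> algebraic_translations T T'"
begin

lemma F_functor: "is_functor (tcat T) (tcat T') F"
  by (rule algebraic_translationsD[OF F])

lemma fobj_F [simp]: "fobj F X = X"
proof -
  have "fobj (comp_functor M_cat F (tfun T)) X = X"
    unfolding algebraic_translationsD[OF F] by simp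
  then show ?thesis by (simp add: fobj_comp_functor)
qed

lemma F_in: "f \<in> A.H X Y \<Longrightarrow> farr F X Y f \<in> B.H X Y"
  using fun_arr[OF F_functor, of X Y f] by simp

lemma F_cmp: "f \<in> A.H X Y \<Longrightarrow> g \<in> A.H Y Z \<Longrightarrow> farr F X Z (A.cmp X Y Z g f) = B.cmp X Y Z (farr F Y Z g) (farr F X Y f)"
  using fun_comp[OF F_functor, of X Y Z f g] by simp

lemma F_marr: "ts \<in> tuples empty_signature X Y \<Longrightarrow> farr F X Y (A.marr X Y ts) = B.marr X Y ts"
  unfolding algebraic_translationsD(2)[OF F, symmetric]
  by (simp add: farr_comp_functor Hom_M_cat)

lemma F_pr: "i < length X \<Longrightarrow> farr F X [X ! i] (A.pr X i) = B.pr X i"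
  unfolding A.pr_def B.pr_def by (intro F_marr single_tuples wf_meta_vars) auto

lemma F_fam: "A.fam Z X fs \<Longrightarrow> B.fam Z X (map (\<lambda>i. farr F Z [X ! i] (fs ! i)) [0..<length X])"
  by (intro B.fam_map F_in) (simp add: A.fam_def)

text \<open>Preservation of products is not assumed of a translation. It follows because
  \<open>F\<close> fixes the projections, which come from \<M>, and tuples are determined by
  projections.\<close>

lemma F_tup:
  assumes fs: "A.fam Z X fs"
  shows "farr F Z X (A.tup Z X fs) = B.tup Z X (map (\<lambda>i. farr F Z [X ! i] (fs ! i)) [0..<length X])"
proof (rule B.tup_unique[OF F_fam[OF fs]])
  show "farr F Z X (A.tup Z X fs) \<in> B.H Z X" by (intro F_in A.tup_in fs)
  fix i assume i: "i < length X"
  show "B.cmp Z X [X ! i] (B.pr X i) (farr F Z X (A.tup Z X fs)) = map (\<lambda>i. farr F Z [X ! i] (fs ! i)) [0..<length X] ! i"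
    using F_cmp[OF A.tup_in[OF fs] A.pr_in[OF i]] F_pr[OF i] A.pr_tup[OF fs i] i by simp
qed

lemma F_val:
  assumes fs: "A.fam Z X fs" and t: "wf_tm empty_signature X n t"
  shows "farr F Z [n] (A.val Z X n t fs) = B.val Z X n t (map (\<lambda>i. farr F Z [X ! i] (fs ! i)) [0..<length X])"
  unfolding A.val_def B.val_def F_tup[OF fs, symmetric] F_marr[OF single_tuples[OF t], symmetric]
  by (rule F_cmp[OF A.tup_in[OF fs] A.marr_in[OF single_tuples[OF t]]])

lemma F_app:
  assumes g: "g \<in> A.H Z [a]" and us: "A.args Z a us"
  shows "farr F Z [0] (A.app Z a g us) = B.app Z a (farr F Z [a] g) (map (farr F Z [0]) us)"
proof -
  have "map (\<lambda>i. farr F Z [(a # replicate a 0) ! i] ((g # us) ! i)) [0..<length (a # replicate a 0)]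
      = farr F Z [a] g # map (farr F Z [0]) us"
  proof (rule nth_equalityI)
    fix i assume "i < length (map (\<lambda>i. farr F Z [(a # replicate a 0) ! i] ((g # us) ! i)) [0..<length (a # replicate a 0)])"
    then show "map (\<lambda>i. farr F Z [(a # replicate a 0) ! i] ((g # us) ! i)) [0..<length (a # replicate a 0)] ! i
       = (farr F Z [a] g # map (farr F Z [0]) us) ! i"
      using us by (cases i) (simp_all add: A.args_def del: upt_Suc)
  qed (use us in \<open>simp add: A.args_def\<close>)
  then show ?thesis unfolding A.app_def B.app_def using F_val[OF A.fam_app[OF g us] wf_app_tm] by simp
qed

lemma F_wk: "farr F (ext Z m) Z (A.wk Z m) = B.wk Z m"
  unfolding A.wk_def B.wk_def by (rule F_marr[OF A.ids_tuples_ext])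

lemma F_var: "j < m \<Longrightarrow> farr F (ext Z m) [0] (A.var Z m j) = B.var Z m j"
  unfolding A.var_def B.var_def using F_pr[of "length Z + (m - 1 - j)" "ext Z m"] by (simp add: nth_ext)

lemma F_vars: "map (farr F (ext Z m) [0]) (A.vars Z m) = B.vars Z m"
  by (simp add: A.vars_def B.vars_def F_var)

text \<open>The same argument for exponentials: application and the generic variables come from
  \<M>, and the transpose is determined by application to them.\<close>

lemma F_lam:
  assumes f: "f \<in> A.H (ext Z m) [0]"
  shows "farr F Z [m] (A.lam Z m f) = B.lam Z m (farr F (ext Z m) [0] f)"
proof (rule B.lam_unique)
  show "farr F Z [m] (A.lam Z m f) \<in> B.H Z [m]" by (intro F_in A.lam_in f)
  have "B.app (ext Z m) m (B.cmp (ext Z m) Z [m] (farr F Z [m] (A.lam Z m f)) (B.wk Z m)) (B.vars Z m)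
      = farr F (ext Z m) [0] (A.app (ext Z m) m (A.cmp (ext Z m) Z [m] (A.lam Z m f) (A.wk Z m)) (A.vars Z m))"
    using F_app[OF A.cmp_in[OF A.wk_in A.lam_in[OF f]] A.args_vars] F_cmp[OF A.wk_in A.lam_in[OF f]]
    by (simp add: F_wk F_vars)
  then show "B.app (ext Z m) m (B.cmp (ext Z m) Z [m] (farr F Z [m] (A.lam Z m f)) (B.wk Z m)) (B.vars Z m)
      = farr F (ext Z m) [0] f"
    using A.app_lam[OF f] by simp
qed

end

locale so_model_translation = so_translation T T' F + M: so_model T S \<sigma> + M': so_model T' S \<sigma>'
  for T T' :: "'a so_theory" and F and S :: "'o signature" and \<sigma> \<sigma>' :: "'o \<Rightarrow> 'a" +
  assumes F_\<sigma>: "f \<in> ops S \<Longrightarrow> farr F (arity S f) [0] (\<sigma> f) = \<sigma>' f"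
begin

lemma F_sem:
  "wf_tm S \<Theta> n t \<Longrightarrow> A.menv \<Theta> Z \<phi> \<Longrightarrow> A.venv n Z e \<Longrightarrow>
   farr F Z [0] (A.sem \<sigma> \<Theta> Z \<phi> e t)
     = B.sem \<sigma>' \<Theta> Z (\<lambda>k. farr F Z [\<Theta> ! k] (\<phi> k)) (\<lambda>i. farr F Z [0] (e i)) t"
proof (induction t arbitrary: n Z \<phi> e rule: tm_induct)
  case (Meta k ts)
  have wf: "wf_tm S \<Theta> n t" if "t \<in> set ts" for t using Meta.prems(1) that by simp
  have "map (farr F Z [0]) (map (A.sem \<sigma> \<Theta> Z \<phi> e) ts)
      = map (B.sem \<sigma>' \<Theta> Z (\<lambda>k. farr F Z [\<Theta> ! k] (\<phi> k)) (\<lambda>i. farr F Z [0] (e i))) ts"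
    using Meta.IH[OF _ wf Meta.prems(2,3)] by simp
  moreover have "A.args Z (\<Theta> ! k) (map (A.sem \<sigma> \<Theta> Z \<phi> e) ts)"
    using Meta.prems(1) M.sem_in[OF wf Meta.prems(2,3)] by (intro M.args_map) auto
  moreover have "\<phi> k \<in> A.H Z [\<Theta> ! k]" using Meta.prems by (simp add: A.menv_def)
  ultimately show ?case unfolding A.sem.simps B.sem.simps by (simp only: F_app)
next
  case (Op f bs)
  let ?\<phi> = "\<lambda>k. farr F Z [\<Theta> ! k] (\<phi> k)" and ?e = "\<lambda>i. farr F Z [0] (e i)"
  let ?l = "\<lambda>m t. A.lam Z m (A.sem \<sigma> \<Theta> (ext Z m) (A.up_meta \<Theta> Z m \<phi>) (A.up_env Z m e) t)"
  have f: "f \<in> ops S" "map fst bs = arity S f" using Op.prems(1) by auto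
  have wf: "wf_tm S \<Theta> (n + m) t" if "(m, t) \<in> set bs" for m t using Op.prems(1) that by auto
  have s: "A.sem \<sigma> \<Theta> (ext Z m) (A.up_meta \<Theta> Z m \<phi>) (A.up_env Z m e) t \<in> A.H (ext Z m) [0]" if "(m, t) \<in> set bs" for m t
    by (rule M.sem_in[OF wf[OF that] A.menv_up[OF Op.prems(2)] A.venv_up[OF Op.prems(3)]])
  have l: "farr F Z [m] (?l m t) = B.lam Z m (B.sem \<sigma>' \<Theta> (ext Z m) (B.up_meta \<Theta> Z m ?\<phi>) (B.up_env Z m ?e) t)"
    if b: "(m, t) \<in> set bs" for m t
  proof -
    have "B.sem \<sigma>' \<Theta> (ext Z m) (\<lambda>k. farr F (ext Z m) [\<Theta> ! k] (A.up_meta \<Theta> Z m \<phi> k))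
        (\<lambda>i. farr F (ext Z m) [0] (A.up_env Z m e i)) t
      = B.sem \<sigma>' \<Theta> (ext Z m) (B.up_meta \<Theta> Z m ?\<phi>) (B.up_env Z m ?e) t"
    proof (rule B.sem_cong[OF wf[OF b]])
      fix k assume "k < length \<Theta>"
      then have "\<phi> k \<in> A.H Z [\<Theta> ! k]" using Op.prems(2) by (simp add: A.menv_def)
      then show "farr F (ext Z m) [\<Theta> ! k] (A.up_meta \<Theta> Z m \<phi> k) = B.up_meta \<Theta> Z m ?\<phi> k"
        by (simp add: A.up_meta_def B.up_meta_def F_cmp[OF A.wk_in] F_wk)
    next
      fix i assume i: "i < n + m"
      show "farr F (ext Z m) [0] (A.up_env Z m e i) = B.up_env Z m ?e i"
      proof (cases "i < m")
        case False
        then have "e (i - m) \<in> A.H Z [0]" using i Op.prems(3) by (simp add: A.venv_def)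
        then show ?thesis using False by (simp add: A.up_env_def B.up_env_def F_cmp[OF A.wk_in] F_wk)
      qed (simp add: A.up_env_def B.up_env_def F_var)
    qed
    then show ?thesis
      unfolding F_lam[OF s[OF b]] Op.IH[OF b wf[OF b] A.menv_up[OF Op.prems(2)] A.venv_up[OF Op.prems(3)]] by simp
  qed
  have fam: "A.fam Z (map fst bs) (map (\<lambda>(m, t). ?l m t) bs)"
    using s by (intro M.fam_binders A.lam_in)
  have eq: "map (\<lambda>i. farr F Z [map fst bs ! i] (map (\<lambda>(m, t). ?l m t) bs ! i)) [0..<length (map fst bs)]
      = map (\<lambda>(m, t). B.lam Z m (B.sem \<sigma>' \<Theta> (ext Z m) (B.up_meta \<Theta> Z m ?\<phi>) (B.up_env Z m ?e) t)) bs"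
    using l[of "fst (bs ! _)" "snd (bs ! _)"] by (intro nth_equalityI) (auto simp: case_prod_unfold)
  have "\<sigma> f \<in> A.H (map fst bs) [0]" using M.\<sigma>[OF f(1)] f(2) by simp
  then show ?case
    using F_cmp[OF A.tup_in[OF fam], of "\<sigma> f" "[0]"] F_\<sigma>[OF f(1)] f(2)
    unfolding A.sem.simps B.sem.simps F_tup[OF fam] eq by simp
qed simp

lemma F_interp:
  assumes t: "wf_tm S \<Theta> n t"
  shows "farr F \<Theta> [n] (M.interp \<Theta> n t) = M'.interp \<Theta> n t"
proof -
  have "farr F (ext \<Theta> n) [\<Theta> ! k] (A.pr (ext \<Theta> n) k) = B.pr (ext \<Theta> n) k" if "k < length \<Theta>" for k
    using F_pr[of k "ext \<Theta> n"] that by (simp add: nth_ext)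
  then show ?thesis
    unfolding M.interp_def M'.interp_def F_lam[OF M.sem_generic_in[OF t]] F_sem[OF t M.menv_pr M.venv_var]
    using B.sem_cong[OF t, of "\<lambda>k. farr F (ext \<Theta> n) [\<Theta> ! k] (A.pr (ext \<Theta> n) k)" "B.pr (ext \<Theta> n)"
        "\<lambda>i. farr F (ext \<Theta> n) [0] (A.var \<Theta> n i)" "B.var \<Theta> n" \<sigma>' "ext \<Theta> n"] F_var by simp
qed

end

section \<open>Theories of presentations\<close>

lemma translate_msubst_tuples:
  assumes \<tau>: "is_sig_translation S S' \<tau>" and ss: "ss \<in> tuples S X Y" and t: "wf_tm S Y n t"
  shows "translate \<tau> (msubst (zip Y ss) t) = msubst (zip Y (map (translate \<tau>) ss)) (translate \<tau> t)"
proof -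
  have "translate \<tau> (msubst (zip Y ss) t) = msubst (map (translate_abs \<tau>) (zip Y ss)) (translate \<tau> t)"
    using t wf_abs_closed[OF zip_tuples_wf[OF ss]]
    by (intro translate_msubst[OF \<tau>]) (simp_all only: map_fst_zip_tuples[OF ss])
  also have "map (translate_abs \<tau>) (zip Y ss) = zip Y (map (translate \<tau>) ss)"
    by (simp add: translate_abs_def zip_map2)
  finally show ?thesis .
qed

lemma map_translate_tuples:
  "is_sig_translation S S' \<tau> \<Longrightarrow> ts \<in> tuples S X Y \<Longrightarrow> map (translate \<tau>) ts \<in> tuples S' X Y"
  by (auto intro!: tuplesI wf_translate simp: tuples_length tuples_wf)

locale presentation_theory =
  fixes P :: "'u presentation"
  assumes inf: "infinite (UNIV :: 'u set)" and P: "is_presentation P"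
begin

sublocale tuple_category "sig P" "derivable P" "syn_cat P" "tm_class P"
  by (rule tuple_category_syn_cat[OF inf P])

sublocale so_theory "syn_theory P"
  by standard (rule is_so_theory_syn_theory[OF inf P])

lemma tcat_syn [simp]: "tcat (syn_theory P) = syn_cat P"
  by (simp add: syn_theory_def)

lemma marr_syn: "ts \<in> tuples empty_signature X Y \<Longrightarrow> marr X Y ts = tm_class P X Y ts"
  by (simp add: syn_theory_def Hom_M_cat)

lemma pr_syn: "i < length X \<Longrightarrow> pr X i = tm_class P X [X ! i] [meta_vars i (X ! i)]"
  unfolding pr_def by (intro marr_syn single_tuples wf_meta_vars) auto

lemma tup_syn:
  assumes ts: "ts \<in> tuples (sig P) X Y"
  shows "tup X Y (map (\<lambda>i. tm_class P X [Y ! i] [ts ! i]) [0..<length Y]) = tm_class P X Y ts"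
proof (rule tup_unique[symmetric])
  show "fam X Y (map (\<lambda>i. tm_class P X [Y ! i] [ts ! i]) [0..<length Y])"
    using q_in_Hom[OF single_tuples[OF tuples_wf[OF ts]]] by (intro fam_map) simp
  show "tm_class P X Y ts \<in> H X Y" using q_in_Hom[OF ts] by simp
  fix i assume i: "i < length Y"
  have "msubst (zip Y ts) (meta_vars i (Y ! i)) = ts ! i"
    using msubst_meta_vars[of i "zip Y ts" "Y ! i" "sig P" X] i tuples_wf[OF ts i] tuples_length[OF ts] by simp
  then show "cmp X Y [Y ! i] (pr Y i) (tm_class P X Y ts) = map (\<lambda>i. tm_class P X [Y ! i] [ts ! i]) [0..<length Y] ! i"
    using Comp_C[OF ts single_tuples[OF wf_meta_vars[OF i HOL.refl order.refl]]] i by (simp add: pr_syn)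
qed

text \<open>Uniqueness again, with the classes of translated terms as the family. For the identity
  translation it says that a term of \<open>P\<close> denotes its own class; for \<tau> it computes
  the interpretation on the target side of fullness.\<close>

lemma interp_translate:
  fixes S :: "'o signature"
  assumes \<tau>: "is_sig_translation S (sig P) \<tau>" and t: "wf_tm S \<Theta> n t"
    and \<sigma>: "\<And>f. f \<in> ops S \<Longrightarrow> \<sigma> f = tm_class P (arity S f) [0] [\<tau> f]"
  shows "so_model.interp (syn_theory P) \<sigma> \<Theta> n t = tm_class P \<Theta> [n] [translate \<tau> t]"
proof -
  interpret E: so_model "syn_theory P" S \<sigma>
    by standard (simp add: \<sigma> q_in_Hom single_tuples wf_sig_translation[OF \<tau>])
  show ?thesis
  proof (rule E.interp_unique[OF _ _ _ _ _ t])
    show "tm_class P \<Theta> [n] [translate \<tau> t] \<in> H \<Theta> [n]" if "wf_tm S \<Theta> n t" for \<Theta> n t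
      using q_in_Hom[OF single_tuples[OF wf_translate[OF \<tau> that]]] by simp
    have "map (translate \<tau>) (map Var xs) = map Var xs" for xs by simp
    then show "tm_class P \<Theta> [\<Theta> ! k] [translate \<tau> (meta_vars k (\<Theta> ! k))] = pr \<Theta> k" if "k < length \<Theta>" for \<Theta> k
      unfolding pr_syn[OF that] by (simp only: meta_vars_def translate.simps)
    have "translate \<tau> (app_tm a) = app_tm a" for a by (simp add: app_tm_def)
    then show "tm_class P (a # replicate a 0) [0] [translate \<tau> (app_tm a)] = marr (a # replicate a 0) [0] [app_tm a]" for a
      by (simp only: marr_syn[OF single_tuples[OF wf_app_tm]])
    show "tm_class P (arity S f) [0] [translate \<tau> (Op f (id_abs (arity S f)))] = \<sigma> f" if "f \<in> ops S" for f
      unfolding translate_Op translate_id_abs[OF \<tau>] msubst_id[OF wf_sig_translation[OF \<tau> that, of 0]] \<sigma>[OF that] ..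
    fix X Y n and ss :: "'o tm list" and t :: "'o tm"
    assume ss: "ss \<in> tuples S X Y" and t: "wf_tm S Y n t"
    note ss' = map_translate_tuples[OF \<tau> ss]
    have "tm_class P X [n] [translate \<tau> (msubst (zip Y ss) t)]
        = cmp X Y [n] (tm_class P Y [n] [translate \<tau> t]) (tm_class P X Y (map (translate \<tau>) ss))"
      using Comp_C[OF ss' single_tuples[OF wf_translate[OF \<tau> t]]] translate_msubst_tuples[OF \<tau> ss t] by simp
    also have "tm_class P X Y (map (translate \<tau>) ss)
        = tup X Y (map (\<lambda>i. tm_class P X [Y ! i] [translate \<tau> (ss ! i)]) [0..<length Y])"
      unfolding tup_syn[OF ss', symmetric] using tuples_length[OF ss] by (intro arg_cong[of _ _ "tup X Y"]) auto
    finally show "tm_class P X [n] [translate \<tau> (msubst (zip Y ss) t)]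
        = cmp X Y [n] (tm_class P Y [n] [translate \<tau> t])
            (tup X Y (map (\<lambda>i. tm_class P X [Y ! i] [translate \<tau> (ss ! i)]) [0..<length Y]))" .
  qed
qed

end

definition op_class :: "'u presentation \<Rightarrow> 'u \<Rightarrow> 'u" where
  "op_class P f = tm_class P (arity (sig P) f) [0] [id_translation (sig P) f]"

definition syn_functor :: "'u presentation \<Rightarrow> 'u presentation \<Rightarrow> ('u \<Rightarrow> 'u tm) \<Rightarrow> (nat list, 'u, nat list, 'u) cat_functor" where
  "syn_functor P Q \<tau> = \<lparr>fobj = (\<lambda>ms. ms),
     farr = (\<lambda>ms ns. \<lambda>f\<in>Hom (syn_cat P) ms ns. tm_class Q ms ns (map (translate \<tau>) (inv tuple_code f)))\<rparr>"

locale two_presentations = P: presentation_theory P + Q: presentation_theory Q for P Q :: "'u presentation"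
begin

lemma syn_functor_class:
  assumes \<tau>: "\<tau> \<in> syntactic_translations P Q" and ts: "ts \<in> tuples (sig P) X Y"
  shows "farr (syn_functor P Q \<tau>) X Y (tm_class P X Y ts) = tm_class Q X Y (map (translate \<tau>) ts)"
proof -
  note t = syntactic_translationsD[OF \<tau>]
  have dec: "inv tuple_code (tm_class P X Y ts) = nfs P X Y ts"
    by (simp add: tm_class_def inj_tuple_code[OF P.inf])
  have nf: "derivable P X (Y ! i) (nfs P X Y ts ! i) (ts ! i)" if "i < length Y" for i
    using derivable_nf[OF tuples_wf[OF ts that]] that by (simp add: nfs_def derivable.sym)
  have len: "length (nfs P X Y ts) = length Y" by (simp add: nfs_def)
  have nfs: "nfs P X Y ts \<in> tuples (sig P) X Y"
    using derivable_wf[OF P.P nf] len by (auto intro!: tuplesI)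
  have "tm_class Q X Y (map (translate \<tau>) (nfs P X Y ts)) = tm_class Q X Y (map (translate \<tau>) ts)"
    using derivable_translate[OF P.P \<tau> nf] len tuples_length[OF ts]
    by (simp add: Q.q_eq_iff[OF map_translate_tuples[OF t nfs] map_translate_tuples[OF t ts]])
  then show ?thesis using P.q_in_Hom[OF ts] by (simp add: syn_functor_def dec)
qed

lemma fobj_syn_functor [simp]: "fobj (syn_functor P Q \<tau>) X = X"
  by (simp add: syn_functor_def)

lemma translate_M: "wf_tm empty_signature \<Theta> n t \<Longrightarrow> translate \<tau> t = t"
proof (induction t rule: tm_induct)
  case (Meta k ts)
  then show ?case by (auto intro: map_idI)
qed (simp_all add: empty_signature_def)

lemma map_translate_M:
  assumes "ts \<in> tuples empty_signature X Y"
  shows "map (translate \<tau>) ts = ts"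
  using translate_M[OF tuples_wf[OF assms]] by (intro nth_equalityI) (simp_all add: tuples_length[OF assms])

section \<open>Translations of presentations as algebraic translations\<close>

lemma syn_functor_algebraic:
  assumes \<tau>: "\<tau> \<in> syntactic_translations P Q"
  shows "syn_functor P Q \<tau> \<in> algebraic_translations (syn_theory P) (syn_theory Q)"
proof -
  note t = syntactic_translationsD[OF \<tau>]
  let ?F = "syn_functor P Q \<tau>"
  have F: "is_functor (syn_cat P) (syn_cat Q) ?F"
    unfolding is_functor_def
  proof (intro conjI ballI allI impI P.is_category_C Q.is_category_C)
    show "fobj ?F \<in> Obj (syn_cat P) \<rightarrow>\<^sub>E Obj (syn_cat Q)" by (simp add: P.Obj_C Q.Obj_C)
    fix X Y Z
    show "farr ?F X Y \<in> Hom (syn_cat P) X Y \<rightarrow>\<^sub>E Hom (syn_cat Q) (fobj ?F X) (fobj ?F Y)"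
    proof (rule PiE_I)
      fix f assume "f \<in> Hom (syn_cat P) X Y"
      then obtain ts where "ts \<in> tuples (sig P) X Y" "f = tm_class P X Y ts" by (auto simp: P.Hom_C)
      then show "farr ?F X Y f \<in> Hom (syn_cat Q) (fobj ?F X) (fobj ?F Y)"
        by (simp add: syn_functor_class[OF \<tau>] Q.q_in_Hom map_translate_tuples[OF t])
    qed (simp add: syn_functor_def)
    have "(ids X :: 'u tm list) \<in> tuples empty_signature X X" by (rule ids_tuples)
    then show "farr ?F X X (Id (syn_cat P) X) = Id (syn_cat Q) (fobj ?F X)"
      by (simp add: P.Id_C Q.Id_C syn_functor_class[OF \<tau> ids_tuples] map_translate_M)
    fix f g assume "f \<in> Hom (syn_cat P) X Y" "g \<in> Hom (syn_cat P) Y Z"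
    then obtain ss ts where ss: "ss \<in> tuples (sig P) X Y" "f = tm_class P X Y ss"
      and ts: "ts \<in> tuples (sig P) Y Z" "g = tm_class P Y Z ts" by (auto simp: P.Hom_C)
    have "map (translate \<tau>) (map (msubst (zip Y ss)) ts) = map (msubst (zip Y (map (translate \<tau>) ss))) (map (translate \<tau>) ts)"
      using translate_msubst_tuples[OF t ss(1) tuples_wf[OF ts(1)]]
      by (intro nth_equalityI) (simp_all add: tuples_length[OF ts(1)])
    then show "farr ?F X Z (Comp (syn_cat P) X Y Z g f)
        = Comp (syn_cat Q) (fobj ?F X) (fobj ?F Y) (fobj ?F Z) (farr ?F Y Z g) (farr ?F X Y f)"
      unfolding ss(2) ts(2) P.Comp_C[OF ss(1) ts(1)] syn_functor_class[OF \<tau> ss(1)] syn_functor_class[OF \<tau> ts(1)]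
        syn_functor_class[OF \<tau> map_msubst_tuples[OF ss(1) ts(1)]] fobj_syn_functor
        Q.Comp_C[OF map_translate_tuples[OF t ss(1)] map_translate_tuples[OF t ts(1)]] by (simp only:)
  qed (simp add: P.Obj_C)
  have "comp_functor M_cat ?F (tfun (syn_theory P)) = tfun (syn_theory Q)"
  proof (rule functor_eqI[OF is_functor_comp Q.T_functor])
    show "is_functor M_cat (tcat (syn_theory P)) (tfun (syn_theory P))" by (rule P.T_functor)
    show "is_functor (tcat (syn_theory P)) (tcat (syn_theory Q)) ?F" using F by simp
    fix X Y and f :: "'u tm list" assume f: "f \<in> Hom M_cat X Y"
    then have ts: "f \<in> tuples empty_signature X Y" by (simp add: Hom_M_cat)
    then show "farr (comp_functor M_cat ?F (tfun (syn_theory P))) X Y f = Q.marr X Y f"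
      using syn_functor_class[OF \<tau> tuples_empty[OF ts]]
      by (simp add: farr_comp_functor f P.marr_syn Q.marr_syn map_translate_M)
  qed (simp add: fobj_comp_functor)
  with F show ?thesis by (simp add: algebraic_translations_def)
qed

lemma translate_id_translation:
  assumes "is_sig_translation (sig P) (sig Q) \<tau>" "f \<in> ops (sig P)"
  shows "translate \<tau> (id_translation (sig P) f) = \<tau> f"
  unfolding id_translation_eq translate_Op translate_id_abs[OF assms(1)]
  by (rule msubst_id[OF wf_sig_translation[OF assms, of 0]])

lemma id_translation_tuples: "f \<in> ops (sig P) \<Longrightarrow> [id_translation (sig P) f] \<in> tuples (sig P) (arity (sig P) f) [0]"
  using is_sig_translation_id[of "sig P"] by (intro single_tuples) (simp add: is_sig_translation_def)

text \<open>Faithfulness and independence of the representative in one. Equal functors are compared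
  on the generic applications of operators, which they send to the classes of \<tau> f and \<tau>'
  f.\<close>

lemma syn_functor_eq_iff:
  assumes \<tau>: "\<tau> \<in> syntactic_translations P Q" and \<tau>': "\<tau>' \<in> syntactic_translations P Q"
  shows "syn_functor P Q \<tau> = syn_functor P Q \<tau>' \<longleftrightarrow> tr_class P Q \<tau> = tr_class P Q \<tau>'"
proof
  note t = syntactic_translationsD[OF \<tau>] and t' = syntactic_translationsD[OF \<tau>']
  assume eq: "syn_functor P Q \<tau> = syn_functor P Q \<tau>'"
  have "derivable Q (arity (sig P) f) 0 (\<tau> f) (\<tau>' f)" if f: "f \<in> ops (sig P)" for f
  proof -
    have "tm_class Q (arity (sig P) f) [0] [\<tau> f] = tm_class Q (arity (sig P) f) [0] [\<tau>' f]"
      using syn_functor_class[OF \<tau> id_translation_tuples[OF f]] syn_functor_class[OF \<tau>' id_translation_tuples[OF f]] eq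
      by (simp add: translate_id_translation[OF t f] translate_id_translation[OF t' f])
    then show ?thesis
      using Q.q_eq_iff[OF single_tuples[OF wf_sig_translation[OF t f]] single_tuples[OF wf_sig_translation[OF t' f]], of 0]
      by simp
  qed
  then show "tr_class P Q \<tau> = tr_class P Q \<tau>'" by (simp add: tr_class_eq_iff[OF \<tau> \<tau>'])
next
  note t = syntactic_translationsD[OF \<tau>] and t' = syntactic_translationsD[OF \<tau>']
  assume "tr_class P Q \<tau> = tr_class P Q \<tau>'"
  then have d: "\<And>f. f \<in> ops (sig P) \<Longrightarrow> derivable Q (arity (sig P) f) 0 (\<tau> f) (\<tau>' f)"
    by (simp add: tr_class_eq_iff[OF \<tau> \<tau>'])
  show "syn_functor P Q \<tau> = syn_functor P Q \<tau>'"
  proof (rule functor_eqI)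
    show "is_functor (syn_cat P) (syn_cat Q) (syn_functor P Q \<tau>)" "is_functor (syn_cat P) (syn_cat Q) (syn_functor P Q \<tau>')"
      using algebraic_translationsD(1)[OF syn_functor_algebraic] \<tau> \<tau>' by fastforce+
    fix X Y f assume "f \<in> Hom (syn_cat P) X Y"
    then obtain ts where ts: "ts \<in> tuples (sig P) X Y" "f = tm_class P X Y ts" by (auto simp: P.Hom_C)
    then show "farr (syn_functor P Q \<tau>) X Y f = farr (syn_functor P Q \<tau>') X Y f"
      using translate_cong[OF t d tuples_wf[OF ts(1)]]
      by (simp add: syn_functor_class[OF \<tau>] syn_functor_class[OF \<tau>'] tuples_length[OF ts(1)]
          Q.q_eq_iff[OF map_translate_tuples[OF t ts(1)] map_translate_tuples[OF t' ts(1)]])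
  qed simp
qed

text \<open>Fullness: both the source theory and the image of \<open>F\<close> interpret the terms of \<open>P\<close>, so \<open>F\<close> is
  determined by its values on the operators.\<close>

lemma syn_functor_full:
  assumes F: "F \<in> algebraic_translations (syn_theory P) (syn_theory Q)"
  shows "\<exists>\<tau>\<in>syntactic_translations P Q. syn_functor P Q \<tau> = F"
proof -
  interpret F: so_translation "syn_theory P" "syn_theory Q" F by standard (rule F)
  have op_in: "op_class P f \<in> Hom (syn_cat P) (arity (sig P) f) [0]" if "f \<in> ops (sig P)" for f
    unfolding op_class_def by (rule P.q_in_Hom[OF id_translation_tuples[OF that]])
  define \<sigma>' where "\<sigma>' f = farr F (arity (sig P) f) [0] (op_class P f)" for f
  have \<sigma>'_in: "\<sigma>' f \<in> Hom (syn_cat Q) (arity (sig P) f) [0]" if "f \<in> ops (sig P)" for f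
    using F.F_in[of "op_class P f"] op_in[OF that] by (simp add: \<sigma>'_def)
  have "\<exists>t. wf_tm (sig Q) (arity (sig P) f) 0 t \<and> \<sigma>' f = tm_class Q (arity (sig P) f) [0] [t]"
    if "f \<in> ops (sig P)" for f
  proof -
    obtain ts where ts: "ts \<in> tuples (sig Q) (arity (sig P) f) [0]" "\<sigma>' f = tm_class Q (arity (sig P) f) [0] ts"
      using \<sigma>'_in[OF \<open>f \<in> _\<close>] by (auto simp: Q.Hom_C)
    then obtain t where "ts = [t]" by (auto simp: tuples_def length_Suc_conv)
    with ts show ?thesis by (auto simp: tuples_def)
  qed
  \<comment> \<open>\<tau> picks, for each operator, a term that represents the image under
    \<open>F\<close> of its generic application.\<close>
  then obtain \<tau> where \<tau>: "\<And>f. f \<in> ops (sig P) \<Longrightarrow> wf_tm (sig Q) (arity (sig P) f) 0 (\<tau> f)"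
    and \<sigma>': "\<And>f. f \<in> ops (sig P) \<Longrightarrow> \<sigma>' f = tm_class Q (arity (sig P) f) [0] [\<tau> f]"
    by metis
  have t: "is_sig_translation (sig P) (sig Q) \<tau>" using \<tau> by (simp add: is_sig_translation_def)
  interpret M: so_model_translation "syn_theory P" "syn_theory Q" F "sig P" "op_class P" \<sigma>'
    by standard (use op_in \<sigma>'_in in \<open>simp_all add: \<sigma>'_def\<close>)
  \<comment> \<open>Both sides are interpretations of \<open>s\<close>: the class of
    \<open>s\<close> in the source, sent by \<open>F\<close> to the interpretation over \<sigma>' in
    the target.\<close>
  have F1: "farr F \<Theta> [n] (tm_class P \<Theta> [n] [s]) = tm_class Q \<Theta> [n] [translate \<tau> s]" if s: "wf_tm (sig P) \<Theta> n s" for \<Theta> n s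
  proof -
    have "M.M.interp \<Theta> n s = tm_class P \<Theta> [n] [s]"
      using P.interp_translate[OF is_sig_translation_id s, of "op_class P"] translate_id[OF s]
      by (simp add: op_class_def)
    moreover have "M.M'.interp \<Theta> n s = tm_class Q \<Theta> [n] [translate \<tau> s]"
      by (rule Q.interp_translate[OF t s \<sigma>'])
    ultimately show ?thesis using M.F_interp[OF s] by simp
  qed
  \<comment> \<open>The two sides of an axiom have the same class in the source theory, so
    \<open>F\<close> identifies their translations; equality of classes in the target is
    derivability.\<close>
  have "derivable Q \<Theta> n (translate \<tau> s) (translate \<tau> u)" if a: "(\<Theta>, n, s, u) \<in> axs P" for \<Theta> n s u
  proof -
    have w: "wf_tm (sig P) \<Theta> n s" "wf_tm (sig P) \<Theta> n u" using P.P a by (auto simp: is_presentation_def)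
    have "tm_class P \<Theta> [n] [s] = tm_class P \<Theta> [n] [u]"
      using P.q_eq_iff[OF single_tuples[OF w(1)] single_tuples[OF w(2)]] derivable.ax[OF a] by simp
    then have "tm_class Q \<Theta> [n] [translate \<tau> s] = tm_class Q \<Theta> [n] [translate \<tau> u]"
      using F1[OF w(1)] F1[OF w(2)] by simp
    then show ?thesis
      using Q.q_eq_iff[OF single_tuples[OF wf_translate[OF t w(1)]] single_tuples[OF wf_translate[OF t w(2)]]] by simp
  qed
  then have tr: "\<tau> \<in> syntactic_translations P Q" using t by (auto simp: syntactic_translations_def)
  have "syn_functor P Q \<tau> = F"
  proof (rule functor_eqI)
    show "is_functor (syn_cat P) (syn_cat Q) (syn_functor P Q \<tau>)" "is_functor (syn_cat P) (syn_cat Q) F"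
      using algebraic_translationsD(1)[OF syn_functor_algebraic[OF tr]] F.F_functor by simp_all
    fix X Y f assume "f \<in> Hom (syn_cat P) X Y"
    then obtain ts where ts: "ts \<in> tuples (sig P) X Y" "f = tm_class P X Y ts" by (auto simp: P.Hom_C)
    let ?fs = "map (\<lambda>i. tm_class P X [Y ! i] [ts ! i]) [0..<length Y]"
    have fam: "P.fam X Y ?fs"
      using P.q_in_Hom[OF single_tuples[OF tuples_wf[OF ts(1)]]] by (intro P.fam_map) simp
    have "farr F X Y f = Q.tup X Y (map (\<lambda>i. farr F X [Y ! i] (?fs ! i)) [0..<length Y])"
      unfolding ts(2) P.tup_syn[OF ts(1), symmetric] by (rule F.F_tup[OF fam])
    also have "map (\<lambda>i. farr F X [Y ! i] (?fs ! i)) [0..<length Y]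
        = map (\<lambda>i. tm_class Q X [Y ! i] [map (translate \<tau>) ts ! i]) [0..<length Y]"
      using F1[OF tuples_wf[OF ts(1)]] by (simp add: tuples_length[OF ts(1)])
    also have "Q.tup X Y \<dots> = tm_class Q X Y (map (translate \<tau>) ts)"
      by (rule Q.tup_syn[OF map_translate_tuples[OF t ts(1)]])
    finally show "farr (syn_functor P Q \<tau>) X Y f = farr F X Y f"
      unfolding ts(2) syn_functor_class[OF tr ts(1)] by simp
  qed simp
  with tr show ?thesis by blast
qed

end

section \<open>The presentation of a theory\<close>

definition op_code :: "nat list \<times> 'u \<Rightarrow> 'u" where
  "op_code = (SOME f. inj f)"

lemma inj_op_code: "infinite (UNIV :: 'u set) \<Longrightarrow> inj (op_code :: nat list \<times> 'u \<Rightarrow> 'u)"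
  unfolding op_code_def by (drule infinite_nat_list_times_embedding) (erule someI_ex)

definition op_value :: "'u \<Rightarrow> 'u" where
  "op_value c = snd (inv op_code c)"

text \<open>Hom-sets need not be disjoint, so an operator records the source \<open>ms\<close> along
  with the arrow; otherwise its arity would not be determined.\<close>

definition theory_sig :: "'u so_theory \<Rightarrow> 'u signature" where
  "theory_sig T = \<lparr>ops = {op_code (ms, f) |ms f. f \<in> Hom (tcat T) ms [0]}, arity = (\<lambda>c. fst (inv op_code c))\<rparr>"

definition theory_pres :: "'u so_theory \<Rightarrow> 'u presentation" where
  "theory_pres T = \<lparr>sig = theory_sig T,
     axs = {(\<Theta>, n, s, t). wf_tm (theory_sig T) \<Theta> n s \<and> wf_tm (theory_sig T) \<Theta> n t \<and>
              so_model.interp T op_value \<Theta> n s = so_model.interp T op_value \<Theta> n t}\<rparr>"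

lemma is_presentation_theory_pres: "is_presentation (theory_pres T)"
  by (auto simp: is_presentation_def theory_pres_def)

definition comparison :: "'u so_theory \<Rightarrow> (nat list, 'u, nat list, 'u) cat_functor" where
  "comparison T = \<lparr>fobj = (\<lambda>ms. ms),
     farr = (\<lambda>ms ns. \<lambda>f\<in>Hom (syn_cat (theory_pres T)) ms ns.
       so_theory.tup T ms ns (map (\<lambda>i. so_model.interp T op_value ms (ns ! i) (inv tuple_code f ! i)) [0..<length ns]))\<rparr>"

locale infinite_theory = so_theory T for T :: "'u so_theory" +
  assumes inf: "infinite (UNIV :: 'u set)"
begin

lemma decode: "inv op_code (op_code (ms, f :: 'u)) = (ms, f)"
  by (simp add: inj_op_code[OF inf])

lemma sig_theory_pres [simp]: "sig (theory_pres T) = theory_sig T"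
  by (simp add: theory_pres_def)

lemma op_code_in: "f \<in> H ms [0] \<Longrightarrow> op_code (ms, f) \<in> ops (theory_sig T)"
  by (auto simp: theory_sig_def)

lemma arity_op_code: "arity (theory_sig T) (op_code (ms, f)) = ms"
  by (simp add: theory_sig_def decode)

lemma op_value_op_code: "op_value (op_code (ms, f :: 'u)) = f"
  by (simp add: op_value_def decode)

sublocale Mod: so_model T "theory_sig T" op_value
proof
  fix f assume "f \<in> ops (theory_sig T)"
  then obtain ms g where "f = op_code (ms, g)" "g \<in> H ms [0]" by (auto simp: theory_sig_def)
  then show "op_value f \<in> H (arity (theory_sig T) f) [0]" by (simp add: arity_op_code op_value_op_code)
qed

sublocale P: presentation_theory "theory_pres T"
  by standard (rule inf, rule is_presentation_theory_pres)

text \<open>True equations are derivable by the choice of axioms. The converse is soundness; the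
  axioms equate only generic values, and \<open>interp_eq_iff\<close> extends this to all stages, as
  \<open>sem_derivable\<close> requires.\<close>

lemma derivable_theory_pres:
  assumes s: "wf_tm (theory_sig T) \<Theta> n s" and t: "wf_tm (theory_sig T) \<Theta> n t"
  shows "derivable (theory_pres T) \<Theta> n s t \<longleftrightarrow> Mod.interp \<Theta> n s = Mod.interp \<Theta> n t"
proof
  assume d: "derivable (theory_pres T) \<Theta> n s t"
  have "sem op_value \<Theta> Z \<phi> e s = sem op_value \<Theta> Z \<phi> e t" if "menv \<Theta> Z \<phi>" "venv n Z e" for Z \<phi> e
  proof (rule Mod.sem_derivable[OF P.P sig_theory_pres _ d that])
    fix \<Theta> n s t Z \<phi> e
    assume "(\<Theta>, n, s, t) \<in> axs (theory_pres T)" "menv \<Theta> Z \<phi>" "venv n Z e"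
    then show "sem op_value \<Theta> Z \<phi> e s = sem op_value \<Theta> Z \<phi> e t"
      using Mod.interp_eq_iff[of \<Theta> n s t] by (simp add: theory_pres_def)
  qed
  then show "Mod.interp \<Theta> n s = Mod.interp \<Theta> n t" by (simp add: Mod.interp_eq_iff[OF s t])
next
  assume "Mod.interp \<Theta> n s = Mod.interp \<Theta> n t"
  then show "derivable (theory_pres T) \<Theta> n s t"
    using s t by (intro derivable.ax) (simp add: theory_pres_def)
qed

lemma lam_0: "f \<in> H Z [0] \<Longrightarrow> lam Z 0 f = f"
  by (rule lam_unique[symmetric]) (simp_all add: wk_def marr_ids vars_def cmp_Id app_0)

text \<open>The witness is the operator that encodes the transpose of \<open>g\<close>, applied to the generic
  arguments. The variables occur in reverse order because \<open>ext\<close> stores them so.\<close>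

lemma interp_surj:
  assumes g: "g \<in> H \<Theta> [n]"
  shows "\<exists>t. wf_tm (theory_sig T) \<Theta> n t \<and> Mod.interp \<Theta> n t = g"
proof -
  let ?E = "ext \<Theta> n"
  define f where "f = app ?E n (cmp ?E \<Theta> [n] g (wk \<Theta> n)) (vars \<Theta> n)"
  have f: "f \<in> H ?E [0]" unfolding f_def by (intro app_in cmp_in wk_in g args_vars)
  define bs :: "(nat \<times> 'u tm) list" where "bs = id_abs \<Theta> @ map (\<lambda>i. (0, Var (n - 1 - i))) [0..<n]"
  have fst_bs: "map fst bs = ?E" by (auto simp: bs_def ext_def comp_def intro: nth_equalityI)
  have len: "length bs = length \<Theta> + n" by (simp add: bs_def)
  let ?t = "Op (op_code (?E, f)) bs"
  have "wf_abs (theory_sig T) \<Theta> n b" if "b \<in> set bs" for b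
    using that wf_id_abs[of b \<Theta> "theory_sig T" n] by (auto simp: bs_def wf_abs_def[of _ _ _ "(_, _)"])
  then have t: "wf_tm (theory_sig T) \<Theta> n ?t"
    using op_code_in[OF f] fst_bs by (auto simp: arity_op_code wf_abs_def)
  let ?l = "\<lambda>m t. lam ?E m (sem op_value \<Theta> (ext ?E m) (up_meta \<Theta> ?E m (pr ?E)) (up_env ?E m (var \<Theta> n)) t)"
  \<comment> \<open>The arguments denote the projections of \<open>?E\<close>. Their tuple is the
    identity, so the operator contributes exactly the arrow \<open>f\<close> that it
    encodes.\<close>
  have comp: "map (\<lambda>(m, t). ?l m t) bs ! i = pr ?E i" if i: "i < length ?E" for i
  proof (cases "i < length \<Theta>")
    case True
    let ?m = "\<Theta> ! i"
    have bi: "bs ! i = (?m, meta_vars i ?m)" using True by (simp add: bs_def nth_append)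
    have "map (sem op_value \<Theta> (ext ?E ?m) (up_meta \<Theta> ?E ?m (pr ?E)) (up_env ?E ?m (var \<Theta> n))) (map Var [0..<?m]) = vars ?E ?m"
      by (simp add: vars_def up_env_def)
    then have "sem op_value \<Theta> (ext ?E ?m) (up_meta \<Theta> ?E ?m (pr ?E)) (up_env ?E ?m (var \<Theta> n)) (meta_vars i ?m)
        = app (ext ?E ?m) ?m (cmp (ext ?E ?m) ?E [?m] (pr ?E i) (wk ?E ?m)) (vars ?E ?m)"
      by (simp only: meta_vars_def sem.simps up_meta_def)
    moreover have "pr ?E i \<in> H ?E [?m]" using pr_in[of i ?E] True by (simp add: nth_ext)
    ultimately have "?l ?m (meta_vars i ?m) = pr ?E i" using lam_unique by metis
    then show ?thesis using bi i len by simp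
  next
    case False
    define j where "j = i - length \<Theta>"
    have j: "i = length \<Theta> + j" "j < n" using False i by (auto simp: j_def)
    define l where "l = n - 1 - j"
    have v: "l < n" using j by (simp add: l_def)
    have bi: "bs ! i = (0, Var l)" using j by (simp add: bs_def nth_append l_def)
    have "?l 0 (Var l) = var \<Theta> n l"
      using lam_0[OF var_in[OF v]] by (simp add: up_env_def wk_def marr_ids cmp_Id[OF var_in[OF v]])
    also have "\<dots> = pr ?E i" using j by (simp add: var_def l_def)
    finally show ?thesis using bi i len by simp
  qed
  have "tup ?E ?E (map (\<lambda>(m, t). ?l m t) bs) = Id (tcat T) ?E"
  proof (rule tup_unique[symmetric])
    show "fam ?E ?E (map (\<lambda>(m, t). ?l m t) bs)"
      using comp pr_in[of _ ?E] len by (intro famI) simp_all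
  qed (use comp cmp_Id[OF pr_in] in \<open>simp_all add: Id_in\<close>)
  then have "sem op_value \<Theta> ?E (pr ?E) (var \<Theta> n) ?t = f"
    by (simp add: fst_bs op_value_op_code cmp_Id[OF f])
  then have "Mod.interp \<Theta> n ?t = g"
    unfolding Mod.interp_def using lam_unique[OF g f_def[symmetric]] by simp
  with t show ?thesis by blast
qed

section \<open>The comparison between a theory and the theory of its presentation\<close>

lemma fam_interp:
  assumes "ts \<in> tuples (theory_sig T) X Y"
  shows "fam X Y (map (\<lambda>i. Mod.interp X (Y ! i) (ts ! i)) [0..<length Y])"
  by (intro fam_map Mod.interp_in tuples_wf[OF assms])

lemma comparison_class:
  assumes ts: "ts \<in> tuples (theory_sig T) X Y"
  shows "farr (comparison T) X Y (tm_class (theory_pres T) X Y ts)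
    = tup X Y (map (\<lambda>i. Mod.interp X (Y ! i) (ts ! i)) [0..<length Y])"
proof -
  let ?P = "theory_pres T"
  have dec: "inv tuple_code (tm_class ?P X Y ts) = nfs ?P X Y ts"
    by (simp add: tm_class_def inj_tuple_code[OF inf])
  have "Mod.interp X (Y ! i) (nfs ?P X Y ts ! i) = Mod.interp X (Y ! i) (ts ! i)" if i: "i < length Y" for i
  proof -
    have d: "derivable ?P X (Y ! i) (ts ! i) (nf ?P X (Y ! i) (ts ! i))"
      using derivable_nf[of ?P] tuples_wf[OF ts i] by simp
    then show ?thesis
      using derivable_theory_pres[of X "Y ! i" "ts ! i"] derivable_wf[OF P.P d] i by (simp add: nfs_def)
  qed
  then have eq: "map (\<lambda>i. Mod.interp X (Y ! i) (nfs ?P X Y ts ! i)) [0..<length Y]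
      = map (\<lambda>i. Mod.interp X (Y ! i) (ts ! i)) [0..<length Y]" by simp
  have "tm_class ?P X Y ts \<in> Hom (syn_cat ?P) X Y" by (rule P.q_in_Hom) (simp add: ts)
  then show ?thesis by (simp add: comparison_def dec eq)
qed

lemma fobj_comparison [simp]: "fobj (comparison T) X = X"
  by (simp add: comparison_def)

text \<open>Injectivity is completeness of the axioms, surjectivity is \<open>interp_surj\<close>,
  each applied to the components.\<close>

lemma bij_comparison: "bij_betw (farr (comparison T) X Y) (Hom (syn_cat (theory_pres T)) X Y) (H X Y)"
proof (rule bij_betw_imageI)
  show "inj_on (farr (comparison T) X Y) (Hom (syn_cat (theory_pres T)) X Y)"
  proof (rule inj_onI)
    fix f g assume "f \<in> Hom (syn_cat (theory_pres T)) X Y" "g \<in> Hom (syn_cat (theory_pres T)) X Y"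
      and eq: "farr (comparison T) X Y f = farr (comparison T) X Y g"
    then obtain ss ts where ss: "ss \<in> tuples (theory_sig T) X Y" "f = tm_class (theory_pres T) X Y ss"
      and ts: "ts \<in> tuples (theory_sig T) X Y" "g = tm_class (theory_pres T) X Y ts"
      by (auto simp: P.Hom_C)
    have "Mod.interp X (Y ! i) (ss ! i) = Mod.interp X (Y ! i) (ts ! i)" if "i < length Y" for i
      using pr_tup[OF fam_interp[OF ss(1)] that] pr_tup[OF fam_interp[OF ts(1)] that] eq that
      by (simp add: ss(2) ts(2) comparison_class[OF ss(1)] comparison_class[OF ts(1)])
    then show "f = g"
      unfolding ss(2) ts(2) using P.q_eq_iff[of ss X Y ts] ss(1) ts(1)
      by (simp add: derivable_theory_pres[OF tuples_wf[OF ss(1)] tuples_wf[OF ts(1)]])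
  qed
  show "farr (comparison T) X Y ` Hom (syn_cat (theory_pres T)) X Y = H X Y"
  proof (intro equalityI subsetI)
    fix f assume "f \<in> farr (comparison T) X Y ` Hom (syn_cat (theory_pres T)) X Y"
    then obtain ts where ts: "ts \<in> tuples (theory_sig T) X Y"
      and f: "f = farr (comparison T) X Y (tm_class (theory_pres T) X Y ts)"
      by (auto simp: P.Hom_C)
    show "f \<in> H X Y" unfolding f comparison_class[OF ts] by (rule tup_in[OF fam_interp[OF ts]])
  next
    fix g assume g: "g \<in> H X Y"
    have "\<exists>t. wf_tm (theory_sig T) X (Y ! i) t \<and> Mod.interp X (Y ! i) t = cmp X Y [Y ! i] (pr Y i) g"
      if "i < length Y" for i
      by (rule interp_surj[OF cmp_in[OF g pr_in[OF that]]])
    then obtain t where t: "\<And>i. i < length Y \<Longrightarrow> wf_tm (theory_sig T) X (Y ! i) (t i)"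
      "\<And>i. i < length Y \<Longrightarrow> Mod.interp X (Y ! i) (t i) = cmp X Y [Y ! i] (pr Y i) g" by metis
    let ?ts = "map t [0..<length Y]"
    have ts: "?ts \<in> tuples (theory_sig T) X Y" using t(1) by (auto intro!: tuplesI)
    have "g = tup X Y (map (\<lambda>i. Mod.interp X (Y ! i) (?ts ! i)) [0..<length Y])"
      using t(2) by (intro tup_unique[OF fam_interp[OF ts] g]) simp
    then have "g = farr (comparison T) X Y (tm_class (theory_pres T) X Y ?ts)"
      using comparison_class[OF ts] by simp
    moreover have "tm_class (theory_pres T) X Y ?ts \<in> Hom (syn_cat (theory_pres T)) X Y"
      by (rule P.q_in_Hom) (simp add: ts)
    ultimately show "g \<in> farr (comparison T) X Y ` Hom (syn_cat (theory_pres T)) X Y" by blast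
  qed
qed

lemma comparison_M:
  assumes ts: "ts \<in> tuples empty_signature X Y"
  shows "farr (comparison T) X Y (tm_class (theory_pres T) X Y ts) = marr X Y ts"
proof -
  have "map (\<lambda>i. Mod.interp X (Y ! i) (ts ! i)) [0..<length Y] = map (\<lambda>i. marr X [Y ! i] [ts ! i]) [0..<length Y]"
    using interp_M[OF tuples_wf[OF ts], of _ op_value] by simp
  then show ?thesis unfolding comparison_class[OF tuples_empty[OF ts]] marr_eq_tup[OF ts] by (rule arg_cong)
qed

lemma comparison_functor: "is_functor (syn_cat (theory_pres T)) (tcat T) (comparison T)"
  unfolding is_functor_def
proof (intro conjI ballI allI impI P.is_category_C T_cat)
  let ?P = "theory_pres T" and ?F = "comparison T"
  show "fobj ?F \<in> Obj (syn_cat ?P) \<rightarrow>\<^sub>E Obj (tcat T)" by (simp add: P.Obj_C)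
  fix X Y Z
  show "farr ?F X Y \<in> Hom (syn_cat ?P) X Y \<rightarrow>\<^sub>E H (fobj ?F X) (fobj ?F Y)"
  proof (rule PiE_I)
    show "farr ?F X Y f \<in> H (fobj ?F X) (fobj ?F Y)" if "f \<in> Hom (syn_cat ?P) X Y" for f
      using bij_betwE[OF bij_comparison] that by auto
  qed (simp add: comparison_def)
  show "farr ?F X X (Id (syn_cat ?P) X) = Id (tcat T) (fobj ?F X)"
    by (simp add: P.Id_C comparison_M[OF ids_tuples] marr_ids)
  fix f g assume "f \<in> Hom (syn_cat ?P) X Y" "g \<in> Hom (syn_cat ?P) Y Z"
  then obtain ss ts where ss: "ss \<in> tuples (theory_sig T) X Y" "f = tm_class ?P X Y ss"
    and ts: "ts \<in> tuples (theory_sig T) Y Z" "g = tm_class ?P Y Z ts" by (auto simp: P.Hom_C)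
  let ?S = "tup X Y (map (\<lambda>i. Mod.interp X (Y ! i) (ss ! i)) [0..<length Y])"
  have "map (\<lambda>i. Mod.interp X (Z ! i) (map (msubst (zip Y ss)) ts ! i)) [0..<length Z]
      = map (\<lambda>i. cmp X Y [Z ! i] (map (\<lambda>i. Mod.interp Y (Z ! i) (ts ! i)) [0..<length Z] ! i) ?S) [0..<length Z]"
    using Mod.interp_msubst[OF ss(1) tuples_wf[OF ts(1)]] by (simp add: tuples_length[OF ts(1)])
  then have "tup X Z (map (\<lambda>i. Mod.interp X (Z ! i) (map (msubst (zip Y ss)) ts ! i)) [0..<length Z])
      = cmp X Y Z (tup Y Z (map (\<lambda>i. Mod.interp Y (Z ! i) (ts ! i)) [0..<length Z])) ?S"
    using tup_cmp[OF fam_interp[OF ts(1)] tup_in[OF fam_interp[OF ss(1)]]] by (simp only:)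
  then show "farr ?F X Z (Comp (syn_cat ?P) X Y Z g f)
      = cmp (fobj ?F X) (fobj ?F Y) (fobj ?F Z) (farr ?F Y Z g) (farr ?F X Y f)"
    using P.Comp_C[of ss X Y ts Z] ss ts
    by (simp add: comparison_class[OF ss(1)] comparison_class[OF ts(1)]
        comparison_class[OF map_msubst_tuples[OF ss(1) ts(1)]])
qed (simp add: P.Obj_C)

lemma comparison_algebraic: "comparison T \<in> algebraic_translations (syn_theory (theory_pres T)) T"
proof -
  have "comp_functor M_cat (comparison T) (tfun (syn_theory (theory_pres T))) = tfun T"
  proof (rule functor_eqI[OF is_functor_comp T_functor])
    show "is_functor M_cat (tcat (syn_theory (theory_pres T))) (tfun (syn_theory (theory_pres T)))" by (rule P.T_functor)
    show "is_functor (tcat (syn_theory (theory_pres T))) (tcat T) (comparison T)" using comparison_functor by simp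
    fix X Y and f :: "'u tm list" assume f: "f \<in> Hom M_cat X Y"
    then have ts: "f \<in> tuples empty_signature X Y" by (simp add: Hom_M_cat)
    then show "farr (comp_functor M_cat (comparison T) (tfun (syn_theory (theory_pres T)))) X Y f = marr X Y f"
      by (simp add: farr_comp_functor f P.marr_syn comparison_M)
  qed (simp add: fobj_comp_functor)
  with comparison_functor show ?thesis by (simp add: algebraic_translations_def)
qed

end

text \<open>Translations are the identity on objects, so the inverse functions of the hom-set
  bijections already form a functor; it commutes with the functors from \<M> because
  \<open>F\<close> does.\<close>

lemma is_iso_SOATI:
  assumes T: "is_so_theory T" and T': "is_so_theory T'" and F: "F \<in> algebraic_translations T T'"
    and bij: "\<And>X Y. bij_betw (farr F X Y) (Hom (tcat T) X Y) (Hom (tcat T') X Y)"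
  shows "is_iso SOAT T T' F"
proof -
  interpret so_translation T T' F by standard (rule T T' F)+
  define I where "I = \<lparr>fobj = (\<lambda>X. X), farr = (\<lambda>X Y. \<lambda>f\<in>Hom (tcat T') X Y. inv_into (Hom (tcat T) X Y) (farr F X Y) f)\<rparr>"
  have fobj_I [simp]: "fobj I X = X" for X by (simp add: I_def)
  have I_in: "farr I X Y f \<in> Hom (tcat T) X Y" and FI: "farr F X Y (farr I X Y f) = f" if "f \<in> Hom (tcat T') X Y" for X Y f
    using bij_betw_imp_surj_on[OF bij, of X Y] that by (auto simp: I_def intro: inv_into_into f_inv_into_f)
  have IF: "farr I X Y (farr F X Y f) = f" if "f \<in> Hom (tcat T) X Y" for X Y f
    using bij_betw_inv_into_left[OF bij that] F_in[OF that] by (simp add: I_def)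
  have fI: "is_functor (tcat T') (tcat T) I"
    unfolding is_functor_def
  proof (intro conjI ballI allI impI A.T_cat B.T_cat)
    fix X Y Z
    show "farr I X Y \<in> B.H X Y \<rightarrow>\<^sub>E A.H (fobj I X) (fobj I Y)"
    proof (rule PiE_I)
      show "farr I X Y f \<in> A.H (fobj I X) (fobj I Y)" if "f \<in> B.H X Y" for f using I_in[OF that] by simp
    qed (simp add: I_def)
    show "farr I X X (Id (tcat T') X) = Id (tcat T) (fobj I X)"
      using IF[OF A.Id_in[of X]] fun_id[OF F_functor, of X] by simp
    fix f g assume f: "f \<in> B.H X Y" and g: "g \<in> B.H Y Z"
    show "farr I X Z (B.cmp X Y Z g f) = A.cmp (fobj I X) (fobj I Y) (fobj I Z) (farr I Y Z g) (farr I X Y f)"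
      using IF[OF A.cmp_in[OF I_in[OF f] I_in[OF g]]] F_cmp[OF I_in[OF f] I_in[OF g]] FI[OF f] FI[OF g] by simp
  qed simp_all
  have "comp_functor M_cat I (tfun T') = tfun T"
  proof (rule functor_eqI[OF is_functor_comp[OF B.T_functor fI] A.T_functor])
    fix X Y and f :: "'a tm list" assume f: "f \<in> Hom M_cat X Y"
    then have ts: "f \<in> tuples empty_signature X Y" by (simp add: Hom_M_cat)
    show "farr (comp_functor M_cat I (tfun T')) X Y f = A.marr X Y f"
      using IF[OF A.marr_in[OF ts]] F_marr[OF ts] by (simp add: farr_comp_functor f)
  qed (simp add: fobj_comp_functor)
  then have I: "I \<in> algebraic_translations T' T" using fI by (simp add: algebraic_translations_def)
  have "comp_functor (tcat T) I F = id_functor (tcat T)"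
    by (rule functor_eqI[OF is_functor_comp[OF F_functor fI] is_functor_id[OF A.T_cat]])
      (simp_all add: fobj_comp_functor farr_comp_functor id_functor_def IF)
  moreover have "comp_functor (tcat T') F I = id_functor (tcat T')"
    by (rule functor_eqI[OF is_functor_comp[OF fI F_functor] is_functor_id[OF B.T_cat]])
      (simp_all add: fobj_comp_functor farr_comp_functor id_functor_def FI)
  ultimately show ?thesis using F I by (auto simp: is_iso_def SOAT_def)
qed

section \<open>The equivalence\<close>

text \<open>Arrows of presentations are classes, so a representative has to be chosen here;
  \<open>farr_syn\<close> removes the choice.\<close>

definition syn :: "('u presentation, ('u \<Rightarrow> 'u tm) set, 'u so_theory, (nat list, 'u, nat list, 'u) cat_functor) cat_functor" where
  "syn = \<lparr>fobj = restrict syn_theory (Obj SOEP),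
     farr = (\<lambda>P Q. if P \<in> Obj SOEP \<and> Q \<in> Obj SOEP
       then \<lambda>X\<in>Hom SOEP P Q. syn_functor P Q (SOME \<tau>. \<tau> \<in> X) else undefined)\<rparr>"

context
  assumes inf: "infinite (UNIV :: 'u set)"
begin

section \<open>The functor from presentations to theories\<close>

lemma presentation_theoryI: "is_presentation (P :: 'u presentation) \<Longrightarrow> presentation_theory P"
  by (simp add: presentation_theory_def inf)

lemma two_presentationsI:
  "is_presentation (P :: 'u presentation) \<Longrightarrow> is_presentation Q \<Longrightarrow> two_presentations P Q"
  by (simp add: two_presentations_def presentation_theoryI)

lemma fobj_syn: "is_presentation (P :: 'u presentation) \<Longrightarrow> fobj syn P = syn_theory P"
  by (simp add: syn_def SOEP_Obj)

lemma farr_syn: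
  assumes P: "is_presentation (P :: 'u presentation)" and Q: "is_presentation Q"
    and \<tau>: "\<tau> \<in> syntactic_translations P Q"
  shows "farr syn P Q (tr_class P Q \<tau>) = syn_functor P Q \<tau>"
proof -
  interpret two_presentations P Q by (rule two_presentationsI[OF P Q])
  let ?\<tau> = "SOME \<tau>'. \<tau>' \<in> tr_class P Q \<tau>"
  have "\<tau> \<in> tr_class P Q \<tau>"
    using equiv_class_self[OF equiv_translation_eq \<tau>] by (simp add: tr_class_def)
  then have s: "?\<tau> \<in> tr_class P Q \<tau>" by (rule someI[of "\<lambda>\<tau>'. \<tau>' \<in> tr_class P Q \<tau>"])
  then have \<tau>': "?\<tau> \<in> syntactic_translations P Q"
    and d: "\<forall>f\<in>ops (sig P). derivable Q (arity (sig P) f) 0 (\<tau> f) (?\<tau> f)"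
    using tr_class_mem[of ?\<tau>] by blast+
  from d have "tr_class P Q \<tau> = tr_class P Q ?\<tau>" by (simp only: tr_class_eq_iff[OF \<tau> \<tau>'])
  then have "syn_functor P Q ?\<tau> = syn_functor P Q \<tau>" using syn_functor_eq_iff[OF \<tau> \<tau>'] by simp
  then show ?thesis using P Q \<tau> by (simp add: syn_def SOEP_Obj SOEP_Hom)
qed

text \<open>Injectivity is the forward direction of \<open>syn_functor_eq_iff\<close>; surjectivity
  is \<open>syn_functor_full\<close>.\<close>

lemma bij_syn:
  assumes P: "is_presentation (P :: 'u presentation)" and Q: "is_presentation Q"
  shows "bij_betw (farr syn P Q) (Hom SOEP P Q) (Hom SOAT (fobj syn P) (fobj syn Q))"
proof -
  interpret two_presentations P Q by (rule two_presentationsI[OF P Q])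
  have "Hom SOAT (fobj syn P) (fobj syn Q) = algebraic_translations (syn_theory P) (syn_theory Q)"
    by (simp add: SOAT_def fobj_syn P Q)
  moreover have "inj_on (farr syn P Q) (Hom SOEP P Q)"
    by (rule inj_onI) (auto simp: SOEP_Hom farr_syn[OF P Q] syn_functor_eq_iff)
  moreover have "farr syn P Q ` Hom SOEP P Q = algebraic_translations (syn_theory P) (syn_theory Q)"
  proof (intro equalityI subsetI)
    fix F assume "F \<in> algebraic_translations (syn_theory P) (syn_theory Q)"
    then obtain \<tau> where "\<tau> \<in> syntactic_translations P Q" "syn_functor P Q \<tau> = F"
      using syn_functor_full by blast
    then show "F \<in> farr syn P Q ` Hom SOEP P Q"
      using farr_syn[OF P Q] by (force simp: SOEP_Hom)
  qed (auto simp: SOEP_Hom farr_syn[OF P Q] intro: syn_functor_algebraic)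
  ultimately show ?thesis by (simp add: bij_betw_def)
qed

lemma syn_functor_id:
  assumes P: "is_presentation (P :: 'u presentation)"
  shows "syn_functor P P (id_translation (sig P)) = id_functor (syn_cat P)"
proof -
  interpret two_presentations P P by (rule two_presentationsI[OF P P])
  note id = syntactic_translations_id[OF P]
  show ?thesis
  proof (rule functor_eqI)
    show "is_functor (syn_cat P) (syn_cat P) (syn_functor P P (id_translation (sig P)))"
      using algebraic_translationsD(1)[OF syn_functor_algebraic[OF id]] by simp
    show "is_functor (syn_cat P) (syn_cat P) (id_functor (syn_cat P))"
      by (rule is_functor_id[OF P.is_category_C])
    fix X Y f assume f: "f \<in> Hom (syn_cat P) X Y"
    then obtain ts where ts: "ts \<in> tuples (sig P) X Y" "f = tm_class P X Y ts" by (auto simp: P.Hom_C)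
    have "map (translate (id_translation (sig P))) ts = ts"
      using translate_id[OF tuples_wf[OF ts(1)]] by (intro nth_equalityI) (simp_all add: tuples_length[OF ts(1)])
    then have "farr (syn_functor P P (id_translation (sig P))) X Y f = f"
      unfolding ts(2) syn_functor_class[OF id ts(1)] by (simp only:)
    then show "farr (syn_functor P P (id_translation (sig P))) X Y f = farr (id_functor (syn_cat P)) X Y f"
      using f by (simp add: id_functor_def P.Obj_C)
  qed (simp add: id_functor_def P.Obj_C)
qed

lemma syn_functor_comp:
  assumes P: "is_presentation (P :: 'u presentation)" and Q: "is_presentation Q" and R: "is_presentation R"
    and \<tau>: "\<tau> \<in> syntactic_translations P Q" and \<tau>': "\<tau>' \<in> syntactic_translations Q R"
  shows "syn_functor P R (comp_translation \<tau>' \<tau>) = comp_functor (syn_cat P) (syn_functor Q R \<tau>') (syn_functor P Q \<tau>)"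
proof -
  interpret PQ: two_presentations P Q by (rule two_presentationsI[OF P Q])
  interpret QR: two_presentations Q R by (rule two_presentationsI[OF Q R])
  interpret PR: two_presentations P R by (rule two_presentationsI[OF P R])
  note t = syntactic_translationsD[OF \<tau>] and t' = syntactic_translationsD[OF \<tau>']
  note c = syntactic_translations_comp[OF P Q \<tau> \<tau>']
  show ?thesis
  proof (rule functor_eqI)
    show "is_functor (syn_cat P) (syn_cat R) (syn_functor P R (comp_translation \<tau>' \<tau>))"
      using algebraic_translationsD(1)[OF PR.syn_functor_algebraic[OF c]] by simp
    show "is_functor (syn_cat P) (syn_cat R) (comp_functor (syn_cat P) (syn_functor Q R \<tau>') (syn_functor P Q \<tau>))"
      using is_functor_comp[OF algebraic_translationsD(1)[OF PQ.syn_functor_algebraic[OF \<tau>]]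
          algebraic_translationsD(1)[OF QR.syn_functor_algebraic[OF \<tau>']]] by simp
    fix X Y f assume f: "f \<in> Hom (syn_cat P) X Y"
    then obtain ts where ts: "ts \<in> tuples (sig P) X Y" "f = tm_class P X Y ts" by (auto simp: PQ.P.Hom_C)
    have "map (translate \<tau>') (map (translate \<tau>) ts) = map (translate (comp_translation \<tau>' \<tau>)) ts"
      using translate_translate[OF t t' tuples_wf[OF ts(1)]]
      by (intro nth_equalityI) (simp_all add: tuples_length[OF ts(1)])
    then have "farr (syn_functor P R (comp_translation \<tau>' \<tau>)) X Y f
        = farr (syn_functor Q R \<tau>') X Y (farr (syn_functor P Q \<tau>) X Y f)"
      unfolding ts(2) PQ.syn_functor_class[OF \<tau> ts(1)] PR.syn_functor_class[OF c ts(1)]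
        QR.syn_functor_class[OF \<tau>' map_translate_tuples[OF t ts(1)]] by (simp only:)
    then show "farr (syn_functor P R (comp_translation \<tau>' \<tau>)) X Y f
        = farr (comp_functor (syn_cat P) (syn_functor Q R \<tau>') (syn_functor P Q \<tau>)) X Y f"
      using f by (simp add: farr_comp_functor PQ.P.Obj_C)
  qed (simp add: fobj_comp_functor PQ.P.Obj_C)
qed

lemma is_functor_syn: "is_functor SOEP SOAT (syn :: ('u presentation, _, _, _) cat_functor)"
  unfolding is_functor_def
proof (intro conjI ballI allI impI is_category_SOEP is_category_SOAT)
  show "fobj syn \<in> Obj SOEP \<rightarrow>\<^sub>E (Obj SOAT :: 'u so_theory set)"
    using is_so_theory_syn_theory[OF inf] by (auto simp: syn_def SOEP_Obj) (simp add: SOAT_def)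
  fix P Q R :: "'u presentation"
  show "farr syn P Q = undefined" if "\<not> (P \<in> Obj SOEP \<and> Q \<in> Obj SOEP)"
    using that by (auto simp: syn_def)
  assume "P \<in> Obj SOEP" then have P: "is_presentation P" by (simp add: SOEP_Obj)
  show "farr syn P P (Id SOEP P) = Id SOAT (fobj syn P)"
    unfolding SOEP_Id farr_syn[OF P P syntactic_translations_id[OF P]] fobj_syn[OF P] syn_functor_id[OF P]
    by (simp add: SOAT_def syn_theory_def)
  assume "Q \<in> Obj SOEP" then have Q: "is_presentation Q" by (simp add: SOEP_Obj)
  show "farr syn P Q \<in> Hom SOEP P Q \<rightarrow>\<^sub>E Hom SOAT (fobj syn P) (fobj syn Q)"
  proof (rule PiE_I)
    show "farr syn P Q X \<in> Hom SOAT (fobj syn P) (fobj syn Q)" if "X \<in> Hom SOEP P Q" for X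
      using bij_betwE[OF bij_syn[OF P Q]] that by blast
  qed (simp add: syn_def SOEP_Obj P Q)
  assume "R \<in> Obj SOEP" then have R: "is_presentation R" by (simp add: SOEP_Obj)
  fix X Y assume "X \<in> Hom SOEP P Q" "Y \<in> Hom SOEP Q R"
  then obtain \<tau> \<tau>' where \<tau>: "\<tau> \<in> syntactic_translations P Q" "X = tr_class P Q \<tau>"
    and \<tau>': "\<tau>' \<in> syntactic_translations Q R" "Y = tr_class Q R \<tau>'" by (auto simp: SOEP_Hom)
  show "farr syn P R (Comp SOEP P Q R Y X)
      = Comp SOAT (fobj syn P) (fobj syn Q) (fobj syn R) (farr syn Q R Y) (farr syn P Q X)"
    unfolding \<tau>(2) \<tau>'(2) SOEP_Comp[OF P Q \<tau>(1) \<tau>'(1)] farr_syn[OF P Q \<tau>(1)] farr_syn[OF Q R \<tau>'(1)]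
      farr_syn[OF P R syntactic_translations_comp[OF P Q \<tau>(1) \<tau>'(1)]] syn_functor_comp[OF P Q R \<tau>(1) \<tau>'(1)]
      fobj_syn[OF P]
    by (simp add: SOAT_def syn_theory_def)
qed

lemma syn_essentially_surjective:
  assumes T: "is_so_theory (T :: 'u so_theory)"
  shows "is_iso SOAT (syn_theory (theory_pres T)) T (comparison T)"
proof -
  interpret infinite_theory T by standard (rule T inf)+
  show ?thesis
    by (rule is_iso_SOATI[OF P.T T comparison_algebraic]) (use bij_comparison in simp)
qed

end

theorem theorem3:
  assumes "infinite (UNIV :: 'u set)"
  shows "equivalent_categories
           (SOAT :: ('u so_theory, (nat list, 'u, nat list, 'u) cat_functor) category)
           (SOEP :: ('u presentation, ('u \<Rightarrow> 'u tm) set) category)"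
proof (rule equivalent_categoriesI[OF is_functor_syn[OF assms]])
  fix P Q :: "'u presentation" assume "P \<in> Obj SOEP" "Q \<in> Obj SOEP"
  then show "bij_betw (farr syn P Q) (Hom SOEP P Q) (Hom SOAT (fobj syn P) (fobj syn Q))"
    by (intro bij_syn[OF assms]) (simp_all add: SOEP_Obj)
next
  fix T :: "'u so_theory" assume "T \<in> Obj SOAT"
  then have "is_iso SOAT (fobj syn (theory_pres T)) T (comparison T)"
    using syn_essentially_surjective[OF assms, of T]
    by (simp add: SOAT_def fobj_syn[OF assms is_presentation_theory_pres])
  then show "\<exists>P\<in>Obj SOEP. \<exists>h. is_iso SOAT (fobj syn P) T h"
    using is_presentation_theory_pres[of T] by (auto simp: SOEP_Obj)
qed

end
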